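(* Suppose $\theta\in[1,2]$ and let $\varsigma=\frac{2(\theta-1)}{\theta}$. Let $d\mu_\theta=\frac{e^{-\beta d^\theta}}{Z}d\lambda$ be a probability measure on $\mathbb{R}^N$, $\beta\in(0,\infty)$. Suppose $0<\frac1\sigma\le|\nabla d|\le1$ for some $\sigma\in[1,\infty)$, and $\Delta d\le K+\beta\theta\,\varepsilon\,d^{\theta-1}$ outside the unit ball $\{d<1\}$ for some $K\in[0,\infty)$ and $\varepsilon\in[0,\frac1{\sigma^2})$. Suppose also that a Sobolev inequality holds: there are $\epsilon_0\in(0,1)$ and $\bar C,\bar D\in(0,\infty)$ such that $\big(\int|g|^{2+\epsilon_0}d\lambda\big)^{\frac2{2+\epsilon_0}}\le\bar C\int|\nabla g|^2d\lambda+\bar D\int g^2d\lambda$ for all $g\in\mathcal{L}$. Then there exist constants $C,D\in(0,\infty)$ such that for all $f\in\mathcal{L}$ with $\int f^2d\mu_\theta<\infty$ $$\int f^2\Big|\log\frac{f^2}{\int f^2d\mu_\theta}\Big|^\varsigma d\mu_\theta\le C\int|\nabla f|^2d\mu_\theta+D\int f^2d\mu_\theta .$$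
   Context: Setting. $\lambda$ is Lebesgue measure on $\mathbb{R}^N$. $\nabla=(X_1,\dots,X_k)$ is a finite collection of smooth, possibly noncommuting, vector fields on $\mathbb{R}^N$, each with zero divergence with respect to $\lambda$; $\nabla f=(X_1f,\dots,X_kf)$, $|\nabla f|=(\sum_i (X_if)^2)^{1/2}$ and $\Delta=\sum_i X_i^2$. $\mathcal{L}$ denotes the class of continuous functions $f:\mathbb{R}^N\to\mathbb{R}$ whose distributional derivatives $X_if$ are all in $L^\infty_{loc}$. $d:\mathbb{R}^N\to[0,\infty)$ is the distance from a fixed point (the origin) in some metric; it is assumed that $d\in\mathcal{L}$ and that the balls $\{d\le R\}$ are compact. Bounds on $|\nabla d|$ are understood almost everywhere, and the upper bound on $\Delta d$ in the sense of distributions on $\{d>1\}$. The integrand on the left is taken to be $0$ where $f=0$. *)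

theory Defs
  imports "HOL-Analysis.Analysis" "HOL-Probability.Probability"
begin

primrec Ck :: "nat \<Rightarrow> ('a::euclidean_space \<Rightarrow> 'b::real_normed_vector) \<Rightarrow> bool" where
  "Ck 0 f \<longleftrightarrow> continuous_on UNIV f"
| "Ck (Suc n) f \<longleftrightarrow>
     (\<forall>x. f differentiable (at x)) \<and> (\<forall>v. Ck n (\<lambda>x. frechet_derivative f (at x) v))"

definition smooth :: "('a::euclidean_space \<Rightarrow> 'b::real_normed_vector) \<Rightarrow> bool" where
  "smooth f \<longleftrightarrow> (\<forall>n. Ck n f)"

definition test_functions :: "'a::euclidean_space set \<Rightarrow> ('a \<Rightarrow> real) set" where
  "test_functions U =
     {\<phi>. smooth \<phi> \<and> compact (closure {x. \<phi> x \<noteq> 0}) \<and> closure {x. \<phi> x \<noteq> 0} \<subseteq> U}"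

definition vderiv :: "('a::euclidean_space \<Rightarrow> 'a) \<Rightarrow> ('a \<Rightarrow> real) \<Rightarrow> 'a \<Rightarrow> real" where
  "vderiv V \<phi> x = frechet_derivative \<phi> (at x) (V x)"

definition divergence :: "('a::euclidean_space \<Rightarrow> 'a) \<Rightarrow> 'a \<Rightarrow> real" where
  "divergence V x = (\<Sum>b\<in>Basis. frechet_derivative V (at x) b \<bullet> b)"

text \<open>The formal adjoint of \<open>V\<close> with respect to Lebesgue measure, $V^*\varphi = -\mathrm{div}(\varphi V)$;
  it is \<open>- vderiv V \<phi>\<close> if \<open>V\<close> has zero divergence.\<close>

definition formal_adjoint :: "('a::euclidean_space \<Rightarrow> 'a) \<Rightarrow> ('a \<Rightarrow> real) \<Rightarrow> 'a \<Rightarrow> real" where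
  "formal_adjoint V \<phi> x = - vderiv V \<phi> x - divergence V x * \<phi> x"

definition locally_integrable :: "('a::euclidean_space \<Rightarrow> real) \<Rightarrow> bool" where
  "locally_integrable g \<longleftrightarrow>
     g \<in> borel_measurable borel \<and> (\<forall>K. compact K \<longrightarrow> set_integrable lborel K g)"

definition locally_ess_bounded :: "('a::euclidean_space \<Rightarrow> real) \<Rightarrow> bool" where
  "locally_ess_bounded g \<longleftrightarrow>
     g \<in> borel_measurable borel \<and>
     (\<forall>K. compact K \<longrightarrow> (\<exists>M. AE x in lborel. x \<in> K \<longrightarrow> \<bar>g x\<bar> \<le> M))"

definition has_distr_deriv ::
  "('a::euclidean_space \<Rightarrow> 'a) \<Rightarrow> ('a \<Rightarrow> real) \<Rightarrow> ('a \<Rightarrow> real) \<Rightarrow> bool" where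
  "has_distr_deriv V f g \<longleftrightarrow>
     locally_integrable f \<and> locally_integrable g \<and>
     (\<forall>\<phi>\<in>test_functions UNIV.
        (LINT x|lborel. f x * formal_adjoint V \<phi> x) = (LINT x|lborel. g x * \<phi> x))"

text \<open>A Borel representative of the distributional derivative; where one exists, it is unique up
  to Lebesgue null sets.\<close>

definition distr_deriv :: "('a::euclidean_space \<Rightarrow> 'a) \<Rightarrow> ('a \<Rightarrow> real) \<Rightarrow> 'a \<Rightarrow> real" where
  "distr_deriv V f = (SOME g. has_distr_deriv V f g)"

definition grad ::
  "('k::finite \<Rightarrow> 'a::euclidean_space \<Rightarrow> 'a) \<Rightarrow> ('a \<Rightarrow> real) \<Rightarrow> 'a \<Rightarrow> real ^ 'k" where
  "grad X f x = (\<chi> i. distr_deriv (X i) f x)"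

definition class_L :: "('k::finite \<Rightarrow> 'a::euclidean_space \<Rightarrow> 'a) \<Rightarrow> ('a \<Rightarrow> real) set" where
  "class_L X =
     {f. continuous_on UNIV f \<and> (\<forall>i. \<exists>g. has_distr_deriv (X i) f g \<and> locally_ess_bounded g)}"

text \<open>The inequality $\sum_i X_i^2 u \le h$ in the sense of distributions on the open set \<open>U\<close>;
  the distribution $X_i^2 u$ is $\varphi \mapsto \int u\, X_i^* X_i^* \varphi\, d\lambda$.\<close>

definition distr_laplacian_le ::
  "('k::finite \<Rightarrow> 'a::euclidean_space \<Rightarrow> 'a) \<Rightarrow> 'a set \<Rightarrow> ('a \<Rightarrow> real) \<Rightarrow> ('a \<Rightarrow> real) \<Rightarrow> bool" where
  "distr_laplacian_le X U u h \<longleftrightarrow>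
     (\<forall>\<phi>\<in>test_functions U. (\<forall>x. 0 \<le> \<phi> x) \<longrightarrow>
        (LINT x|lborel. u x * (\<Sum>i\<in>UNIV. formal_adjoint (X i) (formal_adjoint (X i) \<phi>) x))
          \<le> (LINT x|lborel. h x * \<phi> x))"

definition mu :: "real \<Rightarrow> real \<Rightarrow> real \<Rightarrow> ('a::euclidean_space \<Rightarrow> real) \<Rightarrow> 'a measure" where
  "mu \<theta> \<beta> Z d = density lborel (\<lambda>x. ennreal (exp (- \<beta> * d x powr \<theta>) / Z))"

text \<open>Only meant for \<open>p > 0\<close>.\<close>

definition ennpowr :: "ennreal \<Rightarrow> real \<Rightarrow> ennreal" where
  "ennpowr x p = (if x = \<infinity> then \<infinity> else ennreal (enn2real x powr p))"

text \<open>$|\log t|^s$ for $s \ge 0$. Since \<open>0 powr 0 = 0\<close>, the case $s = 0$ is separated in order to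
  have $0^0 = 1$.\<close>

definition abs_log_pow :: "real \<Rightarrow> real \<Rightarrow> real" where
  "abs_log_pow t s = (if s = 0 then 1 else \<bar>ln t\<bar> powr s)"

end

theory Submission
  imports Defs
begin

text \<open>
  Testing the bound on \<open>\<Delta> d\<close> against \<open>f\<^sup>2 e\<^sup>-\<^sup>U d powr (\<theta> - 1)\<close> with \<open>U = \<beta> d powr \<theta>\<close> (times cutoffs near
  the unit ball and near infinity) and integrating by parts, the derivative of \<open>e\<^sup>-\<^sup>U\<close> produces
  \<open>\<beta> \<theta> (1 / \<sigma>\<^sup>2 - \<epsilon>) d powr (2 (\<theta> - 1))\<close>, which absorbs the other terms. This is the U-bound
  \<open>\<integral> f\<^sup>2 d powr (2 (\<theta> - 1)) d\<mu> \<le> A \<integral> |\<nabla>f|\<^sup>2 d\<mu> + B \<integral> f\<^sup>2 d\<mu>\<close>. Now let \<open>f\<close> be normalised in \<open>L\<^sup>2(\<mu>)\<close> and put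
  \<open>g\<^sup>2 = f\<^sup>2 e\<^sup>-\<^sup>U / Z\<close>, so that \<open>log f\<^sup>2 = log g\<^sup>2 + U + log Z\<close>. The Sobolev inequality for \<open>g\<close> bounds
  \<open>\<integral> g\<^sup>2 log\<^sup>+ g\<^sup>2 d\<lambda>\<close>, and the exponent \<open>s\<close> is such that \<open>U powr s\<close> is a multiple of
  \<open>d powr (2 (\<theta> - 1))\<close>; this term and \<open>|\<nabla>g|\<^sup>2\<close> are controlled by the U-bound.

  Functions in the class \<open>\<L>\<close> are only weakly differentiable, so product rule, chain rule and the
  integration by parts are obtained by mollification and Friedrichs' commutator estimate.
\<close>

section \<open>Smooth functions and test functions\<close>

text \<open>The bound on the Laplacian speaks about smooth test functions, whereas the function to
  be tested is built from \<open>f\<close> and \<open>d\<close>, which are merely continuous with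
  locally bounded weak derivatives. Its mollifications are admissible, and since it is continuous,
  the commutator of mollification with a vector field tends to 0 locally uniformly; the limit then
  costs only the pairing of a bounded function with an L1-convergent sequence. The second obstacle
  is that neither \<open>f\<close> nor \<open>d powr (\<theta> - 1)\<close> is controlled at
  infinity. The truncation at distance \<open>R\<close> must therefore give constants independent of
  \<open>R\<close>, and Fatou's lemma removes it. For \<theta> > 1 the function
  \<open>exp (- U / 2)\<close> is continuously differentiable in \<open>d\<close> up to
  \<open>d = 0\<close>, so its product with \<open>f\<close> stays in the class and the Sobolev
  inequality applies to it directly. For \<theta> = 1 this smoothness fails at 0, but then
  \<open>s = 0\<close> and the claim is immediate. The entropy bound rests on
  \<open>ln x \<le> x\<close> with a free scaling parameter, which takes over the part usually
  played by Jensen's inequality.\<close>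

lemma Ck_SucI:
  assumes "\<And>x. (f has_derivative f' x) (at x)" "\<And>v. Ck n (\<lambda>x. f' x v)"
  shows "Ck (Suc n) f"
proof -
  have "frechet_derivative f (at x) = f' x" for x
    using assms(1) frechet_derivative_at by metis
  then show ?thesis using assms by (auto simp: differentiable_def)
qed

lemma Ck_Suc_has_derivative:
  "Ck (Suc n) f \<Longrightarrow> (f has_derivative frechet_derivative f (at x)) (at x)"
  by (simp add: frechet_derivative_works[symmetric])

lemma Ck_SucD: "Ck (Suc n) f \<Longrightarrow> Ck n f"
proof (induction n arbitrary: f)
  case 0
  then show ?case
    by (simp add: continuous_at_imp_continuous_on differentiable_imp_continuous_within)
next
  case (Suc n)
  then show ?case by simp
qed

lemma Ck_const: "Ck n (\<lambda>_. c)"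
proof (induction n arbitrary: c)
  case (Suc n)
  show ?case by (rule Ck_SucI[where f'="\<lambda>_ _. 0"]) (auto simp: Suc)
qed simp

lemma Ck_bounded_linear:
  assumes "bounded_linear L" shows "Ck n L"
proof (cases n)
  case 0 then show ?thesis using assms by (simp add: linear_continuous_on)
next
  case (Suc m)
  show ?thesis
    unfolding Suc using assms
    by (intro Ck_SucI[where f'="\<lambda>_. L"] bounded_linear_imp_has_derivative Ck_const)
qed

lemma Ck_linear_compose:
  assumes "bounded_linear L" "Ck n f" shows "Ck n (\<lambda>x. L (f x))"
  using assms(2)
proof (induction n arbitrary: f)
  case 0 then show ?case using assms(1) by (auto intro: bounded_linear.continuous_on)
next
  case (Suc n)
  show ?case
    by (rule Ck_SucI[where f'="\<lambda>x v. L (frechet_derivative f (at x) v)"])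
      (use Suc Ck_Suc_has_derivative[OF Suc.prems] assms(1) in \<open>auto intro: bounded_linear.has_derivative\<close>)
qed

lemma Ck_add:
  assumes "Ck n f" "Ck n g" shows "Ck n (\<lambda>x. f x + g x)"
  using assms
proof (induction n arbitrary: f g)
  case 0 then show ?case by (auto intro: continuous_on_add)
next
  case (Suc n)
  show ?case
    by (rule Ck_SucI[where f'="\<lambda>x v. frechet_derivative f (at x) v + frechet_derivative g (at x) v"])
      (use Suc Ck_Suc_has_derivative[OF Suc.prems(1)] Ck_Suc_has_derivative[OF Suc.prems(2)]
        in \<open>auto intro: has_derivative_add\<close>)
qed

lemma Ck_mult:
  fixes f g :: "'a::euclidean_space \<Rightarrow> real"
  assumes "Ck n f" "Ck n g" shows "Ck n (\<lambda>x. f x * g x)"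
  using assms
proof (induction n arbitrary: f g)
  case 0 then show ?case by (auto intro: continuous_on_mult)
next
  case (Suc n)
  note D = Ck_Suc_has_derivative[OF Suc.prems(1)] Ck_Suc_has_derivative[OF Suc.prems(2)]
  show ?case
    by (rule Ck_SucI[where f'="\<lambda>x v. f x * frechet_derivative g (at x) v + frechet_derivative f (at x) v * g x"])
      (use Suc.IH Suc.prems Ck_SucD[OF Suc.prems(1)] Ck_SucD[OF Suc.prems(2)]
        in \<open>auto intro!: has_derivative_mult D Ck_add\<close>)
qed

lemma Ck_sum:
  assumes "\<And>i. i \<in> I \<Longrightarrow> Ck n (f i)" shows "Ck n (\<lambda>x. \<Sum>i\<in>I. f i x)"
  using assms by (induction I rule: infinite_finite_induct) (auto intro: Ck_const Ck_add)

text \<open>By the chain rule the derivative in direction \<open>v\<close> is the derivative of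
  \<open>f\<close> in the fixed direction \<open>c *\<^sub>R v\<close>, composed with the same
  affine map. The induction hypothesis therefore applies to it as it stands.\<close>

lemma Ck_affine:
  assumes "Ck n f" shows "Ck n (\<lambda>x. f (c *\<^sub>R x + a))"
  using assms
proof (induction n arbitrary: f)
  case 0 then show ?case
    by (auto intro!: continuous_on_compose2[of UNIV f] continuous_intros)
next
  case (Suc n)
  have "Ck n (\<lambda>x. frechet_derivative f (at (c *\<^sub>R x + a)) (c *\<^sub>R v))" for v
    using Suc.IH[of "\<lambda>x. frechet_derivative f (at x) (c *\<^sub>R v)"] Suc.prems by simp
  moreover have "((\<lambda>x. f (c *\<^sub>R x + a)) has_derivative
      (\<lambda>v. frechet_derivative f (at (c *\<^sub>R x + a)) (c *\<^sub>R v))) (at x)" for x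
    by (rule has_derivative_compose[where f="\<lambda>x. c *\<^sub>R x + a"])
      (auto intro!: derivative_eq_intros Ck_Suc_has_derivative[OF Suc.prems])
  ultimately show ?case by (rule Ck_SucI[rotated])
qed

lemma smooth_Ck: "smooth f \<Longrightarrow> Ck n f"
  by (simp add: smooth_def)

lemma smooth_has_derivative:
  "smooth f \<Longrightarrow> (f has_derivative frechet_derivative f (at x)) (at x)"
  using Ck_Suc_has_derivative smooth_Ck by blast

lemma smooth_continuous_on: "smooth f \<Longrightarrow> continuous_on A f"
  using smooth_Ck[of f 0] continuous_on_subset by auto

lemma smooth_fderiv: "smooth f \<Longrightarrow> smooth (\<lambda>x. frechet_derivative f (at x) v)"
  unfolding smooth_def by (metis Ck.simps(2))

lemma smooth_mult:
  fixes f g :: "'a::euclidean_space \<Rightarrow> real"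
  shows "smooth f \<Longrightarrow> smooth g \<Longrightarrow> smooth (\<lambda>x. f x * g x)"
  by (simp add: smooth_def Ck_mult)

lemma smooth_linear_compose:
  "bounded_linear L \<Longrightarrow> smooth f \<Longrightarrow> smooth (\<lambda>x. L (f x))"
  by (simp add: smooth_def Ck_linear_compose)

lemma smooth_inner_left: "smooth V \<Longrightarrow> smooth (\<lambda>x. V x \<bullet> b)"
  by (rule smooth_linear_compose[OF bounded_linear_inner_left])

lemma smooth_sum: "(\<And>i. i \<in> I \<Longrightarrow> smooth (f i)) \<Longrightarrow> smooth (\<lambda>x. \<Sum>i\<in>I. f i x)"
  by (simp add: smooth_def Ck_sum)

lemma smooth_reflect: "smooth f \<Longrightarrow> smooth (\<lambda>y. f (x - y))"
  using Ck_affine[of _ f "-1" x] by (simp add: smooth_def)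

lemma fderiv_basis_sum:
  assumes "f differentiable at x"
  shows "frechet_derivative f (at x) v = (\<Sum>b\<in>Basis. (v \<bullet> b) *\<^sub>R frechet_derivative f (at x) b)"
proof -
  have L: "linear (frechet_derivative f (at x))"
    using assms by (simp add: linear_frechet_derivative)
  have "frechet_derivative f (at x) v = frechet_derivative f (at x) (\<Sum>b\<in>Basis. (v \<bullet> b) *\<^sub>R b)"
    by (simp add: euclidean_representation)
  also have "\<dots> = (\<Sum>b\<in>Basis. (v \<bullet> b) *\<^sub>R frechet_derivative f (at x) b)"
    by (simp only: linear_sum[OF L] linear_scale[OF L] o_def)
  finally show ?thesis .
qed

lemma smooth_differentiable: "smooth f \<Longrightarrow> f differentiable at x"
  unfolding differentiable_def by (rule exI, erule smooth_has_derivative)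

text \<open>Smoothness is available for derivatives in a fixed direction, while the direction
  \<open>V x\<close> moves with the point. The expansion puts the dependence on \<open>x\<close>
  into smooth coefficients.\<close>

lemma vderiv_basis_sum:
  assumes "smooth \<phi>"
  shows "vderiv V \<phi> x = (\<Sum>b\<in>Basis. (V x \<bullet> b) * frechet_derivative \<phi> (at x) b)"
  using fderiv_basis_sum[where v="V x", OF smooth_differentiable[OF assms, of x]]
  by (simp add: vderiv_def)

lemma smooth_vderiv:
  assumes "smooth V" "smooth \<phi>" shows "smooth (vderiv V \<phi>)"
proof -
  have "vderiv V \<phi> = (\<lambda>x. \<Sum>b\<in>Basis. (V x \<bullet> b) * frechet_derivative \<phi> (at x) b)"
    by (rule ext) (rule vderiv_basis_sum[OF assms(2)])
  moreover have "smooth (\<lambda>x. \<Sum>b\<in>Basis. (V x \<bullet> b) * frechet_derivative \<phi> (at x) b)"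
    by (rule smooth_sum, rule smooth_mult)
      (rule smooth_inner_left smooth_fderiv, rule assms)+
  ultimately show ?thesis by simp
qed

lemma fderiv_mult:
  fixes f g :: "'a::euclidean_space \<Rightarrow> real"
  assumes "smooth f" "smooth g"
  shows "frechet_derivative (\<lambda>x. f x * g x) (at x) v =
    f x * frechet_derivative g (at x) v + frechet_derivative f (at x) v * g x"
  using frechet_derivative_at[OF has_derivative_mult[OF
      smooth_has_derivative[OF assms(1), of x] smooth_has_derivative[OF assms(2), of x]]]
  by (simp add: fun_eq_iff)

lemma fderiv_reflect:
  assumes "smooth f"
  shows "frechet_derivative (\<lambda>y. f (x - y)) (at y) v = - frechet_derivative f (at (x - y)) v"
proof -
  have "((\<lambda>y. f (x - y)) has_derivative (\<lambda>v. frechet_derivative f (at (x - y)) (- v))) (at y)"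
    by (rule has_derivative_compose[where f="\<lambda>y. x - y"])
      (auto intro!: derivative_eq_intros smooth_has_derivative assms)
  note frechet_derivative_at[OF this]
  moreover have "linear (frechet_derivative f (at (x - y)))"
    by (simp add: linear_frechet_derivative smooth_differentiable assms)
  ultimately show ?thesis
    using linear_neg[of "frechet_derivative f (at (x - y))" v] by (simp add: fun_eq_iff)
qed

section \<open>Closure properties of test functions\<close>

lemma test_functionsI:
  assumes "smooth \<phi>" "compact C" "C \<subseteq> U" "\<And>x. x \<notin> C \<Longrightarrow> \<phi> x = 0"
  shows "\<phi> \<in> test_functions U"
proof -
  have *: "closure {x. \<phi> x \<noteq> 0} \<subseteq> C"
    using assms by (intro closure_minimal) (auto simp: compact_imp_closed)
  then have "compact (closure {x. \<phi> x \<noteq> 0})"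
    using compact_Int_closed[OF assms(2) closed_closure[of "{x. \<phi> x \<noteq> 0}"]] by (simp add: Int_absorb1)
  then show ?thesis using * assms by (auto simp: test_functions_def)
qed

lemma test_functionsE:
  assumes "\<phi> \<in> test_functions U"
  obtains C where "smooth \<phi>" "compact C" "C \<subseteq> U" "\<And>x. x \<notin> C \<Longrightarrow> \<phi> x = 0"
proof
  show "smooth \<phi>" "compact (closure {x. \<phi> x \<noteq> 0})" "closure {x. \<phi> x \<noteq> 0} \<subseteq> U"
    using assms by (auto simp: test_functions_def)
  show "\<phi> x = 0" if "x \<notin> closure {x. \<phi> x \<noteq> 0}" for x
    using that closure_subset[of "{x. \<phi> x \<noteq> 0}"] by auto
qed

lemma test_functions_smooth: "\<phi> \<in> test_functions U \<Longrightarrow> smooth \<phi>"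
  by (simp add: test_functions_def)

lemma fderiv_eq_0_outside:
  fixes f :: "'a::euclidean_space \<Rightarrow> 'b::real_normed_vector"
  assumes "closed C" "\<And>x. x \<notin> C \<Longrightarrow> f x = 0" "x \<notin> C"
  shows "frechet_derivative f (at x) v = 0"
proof -
  have "(f has_derivative (\<lambda>_. 0)) (at x)"
    by (rule has_derivative_transform_within_open[of "\<lambda>_. 0" _ _ _ "- C"])
      (use assms in auto)
  from frechet_derivative_at[OF this] show ?thesis by (simp add: fun_eq_iff)
qed

lemma test_functions_fderiv:
  assumes "\<phi> \<in> test_functions U"
  shows "(\<lambda>x. frechet_derivative \<phi> (at x) v) \<in> test_functions U"
proof -
  obtain C where C: "smooth \<phi>" "compact C" "C \<subseteq> U" "\<And>x. x \<notin> C \<Longrightarrow> \<phi> x = 0"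
    by (rule test_functionsE[OF assms]) blast
  show ?thesis
    using C fderiv_eq_0_outside[OF compact_imp_closed[OF C(2)], of \<phi>]
    by (intro test_functionsI[of _ C] smooth_fderiv) auto
qed

lemma test_functions_mult:
  assumes "\<phi> \<in> test_functions U" "smooth g"
  shows "(\<lambda>x. \<phi> x * g x) \<in> test_functions U"
proof -
  obtain C where C: "smooth \<phi>" "compact C" "C \<subseteq> U" "\<And>x. x \<notin> C \<Longrightarrow> \<phi> x = 0"
    by (rule test_functionsE[OF assms(1)]) blast
  show ?thesis
    using C assms(2) by (intro test_functionsI[of _ C] smooth_mult) auto
qed

lemma test_functions_vderiv:
  assumes "\<phi> \<in> test_functions U" "smooth V"
  shows "vderiv V \<phi> \<in> test_functions U"
proof -
  obtain C where C: "smooth \<phi>" "compact C" "C \<subseteq> U" "\<And>x. x \<notin> C \<Longrightarrow> \<phi> x = 0"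
    by (rule test_functionsE[OF assms(1)]) blast
  show ?thesis
    using C assms(2) fderiv_eq_0_outside[OF compact_imp_closed[OF C(2)], of \<phi>]
    by (intro test_functionsI[of _ C] smooth_vderiv) (auto simp: vderiv_def)
qed

lemma test_functions_uminus:
  assumes "\<phi> \<in> test_functions U"
  shows "(\<lambda>x. - \<phi> x) \<in> test_functions U"
proof -
  have "smooth (\<lambda>_::'a. -1::real)" by (simp add: smooth_def Ck_const)
  from test_functions_mult[OF assms this] show ?thesis by simp
qed

lemma test_functions_reflect:
  assumes "\<phi> \<in> test_functions UNIV"
  shows "(\<lambda>y. \<phi> (x - y)) \<in> test_functions UNIV"
proof -
  obtain C where C: "smooth \<phi>" "compact C" "\<And>x. x \<notin> C \<Longrightarrow> \<phi> x = 0"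
    by (rule test_functionsE[OF assms]) blast
  have "compact ((\<lambda>y. x - y) ` C)" using C(2) by (auto intro!: compact_continuous_image continuous_intros)
  moreover have "\<phi> (x - y) = 0" if "y \<notin> (\<lambda>y. x - y) ` C" for y
    using that C(3)[of "x - y"] by (force simp: image_iff algebra_simps)
  ultimately show ?thesis
    using C by (intro test_functionsI[of _ "(\<lambda>y. x - y) ` C"] smooth_reflect) auto
qed

section \<open>Boundedness and integrability under compact support\<close>

lemma continuous_bounded_on_compact:
  fixes u :: "'a::euclidean_space \<Rightarrow> real"
  assumes "continuous_on UNIV u" "compact C"
  obtains B where "\<And>x. x \<in> C \<Longrightarrow> \<bar>u x\<bar> \<le> B"
proof -
  have "bounded (u ` C)"
    using assms by (meson compact_continuous_image compact_imp_bounded continuous_on_subset subset_UNIV)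
  then show ?thesis using that by (auto simp: bounded_iff)
qed

lemma compact_support_bounded:
  fixes \<phi> :: "'a::euclidean_space \<Rightarrow> real"
  assumes "continuous_on UNIV \<phi>" "compact C" "\<And>x. x \<notin> C \<Longrightarrow> \<phi> x = 0"
  obtains M where "0 \<le> M" "\<And>x. \<bar>\<phi> x\<bar> \<le> M"
proof -
  obtain M where M: "\<And>x. x \<in> C \<Longrightarrow> \<bar>\<phi> x\<bar> \<le> M"
    by (rule continuous_bounded_on_compact[OF assms(1,2)]) blast
  have "\<bar>\<phi> x\<bar> \<le> \<bar>M\<bar>" for x
    using M[of x] assms(3)[of x] by (cases "x \<in> C") auto
  then show ?thesis using that[of "\<bar>M\<bar>"] by simp
qed

lemma compact_support_integrable:
  fixes \<phi> :: "'a::euclidean_space \<Rightarrow> real"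
  assumes "continuous_on UNIV \<phi>" "compact C" "\<And>x. x \<notin> C \<Longrightarrow> \<phi> x = 0"
  shows "integrable lborel \<phi>"
proof -
  have "set_integrable lborel C \<phi>"
    unfolding set_integrable_def
    by (rule borel_integrable_compact) (use assms in \<open>auto intro: continuous_on_subset\<close>)
  moreover have "(\<lambda>x. indicator C x *\<^sub>R \<phi> x) = \<phi>"
    by (intro ext, rename_tac x, case_tac "x \<in> C") (simp_all add: assms(3))
  ultimately show ?thesis by (simp add: set_integrable_def)
qed

lemma test_functions_bounded:
  assumes "\<phi> \<in> test_functions U"
  obtains M where "0 \<le> M" "\<And>x. \<bar>\<phi> x\<bar> \<le> M"
  using assms by (metis compact_support_bounded test_functionsE smooth_continuous_on)

lemma test_functions_integrable: "\<phi> \<in> test_functions U \<Longrightarrow> integrable lborel \<phi>"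
  by (metis compact_support_integrable test_functionsE smooth_continuous_on)

lemma test_functions_fderiv_bounded:
  assumes "\<phi> \<in> test_functions U"
  obtains M where "0 \<le> M" "\<And>x v. \<bar>frechet_derivative \<phi> (at x) v\<bar> \<le> M * norm v"
proof -
  have "\<exists>M. 0 \<le> M \<and> (\<forall>x. \<bar>frechet_derivative \<phi> (at x) b\<bar> \<le> M)" for b
    using test_functions_bounded[OF test_functions_fderiv[OF assms, of b]] by metis
  then obtain m where m: "\<And>b. 0 \<le> m b" "\<And>b x. \<bar>frechet_derivative \<phi> (at x) b\<bar> \<le> m b" by metis
  show ?thesis
  proof (rule that[of "\<Sum>b\<in>Basis. m b"])
    show "0 \<le> (\<Sum>b\<in>Basis. m b)" by (simp add: m sum_nonneg)
    fix x v
    have "\<bar>frechet_derivative \<phi> (at x) v\<bar> = \<bar>\<Sum>b\<in>Basis. (v \<bullet> b) * frechet_derivative \<phi> (at x) b\<bar>"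
      using fderiv_basis_sum[of \<phi> x v] test_functions_smooth[OF assms] smooth_differentiable by fastforce
    also have "\<dots> \<le> (\<Sum>b\<in>Basis. norm v * m b)"
      by (rule order.trans[OF sum_abs]) (auto simp: abs_mult intro!: sum_mono mult_mono m Basis_le_norm)
    finally show "\<bar>frechet_derivative \<phi> (at x) v\<bar> \<le> (\<Sum>b\<in>Basis. m b) * norm v"
      by (simp add: sum_distrib_left mult.commute)
  qed
qed

lemma formal_adjoint_divfree:
  "(\<And>x. divergence V x = 0) \<Longrightarrow> formal_adjoint V \<phi> = (\<lambda>x. - vderiv V \<phi> x)"
  by (auto simp: formal_adjoint_def)

section \<open>Mollifiers\<close>

text \<open>This family of functions is closed under differentiation.\<close>

definition flat :: "real poly \<Rightarrow> real \<Rightarrow> real" where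
  "flat p t = (if t > 0 then poly p (1 / t) * exp (- (1 / t)) else 0)"

lemma poly_exp_tendsto_0: "((\<lambda>x. poly p x * exp (- x)) \<longlongrightarrow> (0::real)) at_top"
proof -
  have "((\<lambda>x. \<Sum>i\<le>degree p. coeff p i * (x ^ i / exp x)) \<longlongrightarrow> (\<Sum>i\<le>degree p. coeff p i * (0::real))) at_top"
    by (intro tendsto_intros tendsto_power_div_exp_0)
  then show ?thesis
    by (simp add: poly_altdef exp_minus sum_distrib_right divide_inverse mult.assoc)
qed

text \<open>This is the difference quotient at 0, the only point where differentiability of
  \<open>flat p\<close> is in doubt. Dividing by \<open>t\<close> multiplies the polynomial in
  \<open>1 / t\<close> by its variable, and the exponential still wins.\<close>

lemma flat_quotient_tendsto_0: "((\<lambda>t. flat p t / t) \<longlongrightarrow> 0) (at 0)"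
proof (rule filterlim_split_at)
  have "((\<lambda>t. flat p t / t) \<longlongrightarrow> 0) (at_left 0) \<longleftrightarrow> ((\<lambda>t. 0) \<longlongrightarrow> (0::real)) (at_left (0::real))"
    by (intro filterlim_cong refl) (auto simp: eventually_at_filter flat_def)
  then show "((\<lambda>t. flat p t / t) \<longlongrightarrow> 0) (at_left 0)" by simp
  have "((\<lambda>t. flat p t / t) \<longlongrightarrow> 0) (at_right 0) \<longleftrightarrow>
      ((\<lambda>t. poly (pCons 0 p) (inverse t) * exp (- inverse t)) \<longlongrightarrow> 0) (at_right (0::real))"
    by (intro filterlim_cong refl) (auto simp: eventually_at_filter flat_def divide_inverse)
  also have \<dots>
    by (rule filterlim_compose[OF poly_exp_tendsto_0 filterlim_inverse_at_top_right])
  finally show "((\<lambda>t. flat p t / t) \<longlongrightarrow> 0) (at_right 0)" .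
qed

text \<open>For positive \<open>t\<close> the product rule on
  \<open>p(1 / t) * exp (- 1 / t)\<close> gives the factor \<open>1 / t ^ 2\<close> times
  \<open>p - p'\<close> at \<open>1 / t\<close>; in the variable \<open>1 / t\<close> that factor is
  the polynomial \<open>[:0, 0, 1:]\<close>.\<close>

lemma flat_has_derivative:
  "(flat p has_real_derivative flat ([:0, 0, 1:] * (p - pderiv p)) t) (at t)"
proof -
  consider "t > 0" | "t < 0" | "t = 0" by linarith
  then show ?thesis
  proof cases
    case 1
    have "((\<lambda>t. poly p (1 / t) * exp (- (1 / t))) has_real_derivative
        flat ([:0, 0, 1:] * (p - pderiv p)) t) (at t)"
      using 1 by (auto intro!: derivative_eq_intros poly_DERIV[THEN DERIV_chain2] simp: flat_def field_simps power2_eq_square)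
    then show ?thesis
      by (rule has_field_derivative_transform_within_open[of _ _ _ "{0<..}"])
        (use 1 in \<open>auto simp: flat_def\<close>)
  next
    case 2
    have "((\<lambda>_. 0) has_real_derivative flat ([:0, 0, 1:] * (p - pderiv p)) t) (at t)"
      using 2 by (auto simp: flat_def)
    then show ?thesis
      by (rule has_field_derivative_transform_within_open[of _ _ _ "{..<0}"])
        (use 2 in \<open>auto simp: flat_def\<close>)
  next
    case 3
    then show ?thesis
      using flat_quotient_tendsto_0[of p]
      by (simp add: has_field_derivative_iff) (simp add: flat_def)
  qed
qed

lemma Ck_flat_compose:
  fixes u :: "'a::euclidean_space \<Rightarrow> real"
  assumes "smooth u" shows "Ck n (\<lambda>x. flat p (u x))"
proof (induction n arbitrary: p)
  case 0
  have "continuous_on UNIV (flat p)"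
    using flat_has_derivative DERIV_isCont continuous_at_imp_continuous_on by blast
  then show ?case
    using smooth_continuous_on[OF assms] by (auto intro: continuous_on_compose2)
next
  case (Suc n)
  have D: "((\<lambda>x. flat p (u x)) has_derivative
      (\<lambda>v. flat ([:0, 0, 1:] * (p - pderiv p)) (u x) * frechet_derivative u (at x) v)) (at x)" for x
    using has_derivative_compose[OF smooth_has_derivative[OF assms] has_field_derivative_imp_has_derivative[OF flat_has_derivative[of p]]] 
    by simp
  show ?case
    by (rule Ck_SucI[OF D], rule Ck_mult[OF Suc], rule smooth_Ck, rule smooth_fderiv[OF assms])
qed

text \<open>The standard bump \<open>exp (- 1 / (1 - norm x ^ 2))\<close> on the open unit ball,
  extended by 0.\<close>

definition bump :: "'a::euclidean_space \<Rightarrow> real" where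
  "bump x = flat 1 (1 - x \<bullet> x)"

lemma smooth_bump: "smooth (bump :: 'a::euclidean_space \<Rightarrow> real)"
proof -
  have "Ck n (\<lambda>x::'a. 1 - x \<bullet> x)" for n
  proof (cases n)
    case (Suc m)
    have "((\<lambda>x::'a. 1 - x \<bullet> x) has_derivative (\<lambda>v. - 2 * (x \<bullet> v))) (at x)" for x
      by (auto intro!: derivative_eq_intros simp: inner_commute)
    moreover have "Ck m (\<lambda>x::'a. -2 * (x \<bullet> v))" for v
      by (intro Ck_bounded_linear bounded_linear_intros)
    ultimately show ?thesis unfolding Suc by (rule Ck_SucI)
  qed (auto intro!: continuous_intros)
  then have "smooth (\<lambda>x::'a. 1 - x \<bullet> x)" by (simp add: smooth_def)
  from Ck_flat_compose[OF this, of _ 1] show ?thesis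
    unfolding smooth_def bump_def by blast
qed

lemma bump_nonneg: "0 \<le> bump x"
  by (simp add: bump_def flat_def)

lemma bump_pos: "norm x < 1 \<Longrightarrow> 0 < bump x"
  by (simp add: bump_def flat_def dot_square_norm abs_square_less_1)

lemma bump_eq_0: "norm x \<ge> 1 \<Longrightarrow> bump x = 0"
  by (simp add: bump_def flat_def dot_square_norm not_less one_le_power)

lemma bump_test: "(bump :: 'a::euclidean_space \<Rightarrow> real) \<in> test_functions UNIV"
  by (rule test_functionsI[OF smooth_bump, of "cball 0 1"]) (auto simp: bump_eq_0)

lemma integral_bump_pos: "0 < (LBINT x. bump (x::'a::euclidean_space))"
proof -
  have "(LBINT x. bump (x::'a)) \<noteq> 0"
  proof
    assume "(LBINT x. bump (x::'a)) = 0"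
    then have "AE x in lborel. bump (x::'a) = 0"
      using integral_nonneg_eq_0_iff_AE[OF test_functions_integrable[OF bump_test[where 'a='a]]] bump_nonneg
      by auto
    then have "AE x in lborel. x \<notin> ball (0::'a) 1"
      by eventually_elim (use bump_pos in force)
    then have "emeasure lborel (ball (0::'a) 1) = 0"
      by (subst (asm) AE_iff_measurable[OF _ refl]) (auto simp: ball_def)
    then show False
      using content_ball_pos[of 1 "0::'a"] by (simp add: measure_def)
  qed
  moreover have "0 \<le> (LBINT x. bump (x::'a))" by (simp add: bump_nonneg)
  ultimately show ?thesis by linarith
qed

text \<open>The support has radius \<open>1 / Suc n\<close>, which is at most 1 for every
  \<open>n\<close>; all smearing thus stays within a unit neighbourhood.\<close>

definition mollifier :: "nat \<Rightarrow> 'a::euclidean_space \<Rightarrow> real" where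
  "mollifier n x = real (Suc n) ^ DIM('a) * bump (real (Suc n) *\<^sub>R x) / (LBINT x. bump (x::'a))"

lemma mollifier_test: "mollifier n \<in> test_functions UNIV"
proof (rule test_functionsI[of _ "cball 0 1"])
  have "Ck k (\<lambda>x::'a. (real (Suc n) ^ DIM('a) / (LBINT x. bump (x::'a))) * bump (real (Suc n) *\<^sub>R x + 0))" for k
    by (intro Ck_mult Ck_const Ck_affine smooth_Ck smooth_bump)
  then show "smooth (mollifier n :: 'a \<Rightarrow> real)"
    unfolding smooth_def mollifier_def[abs_def] by simp
  fix x :: 'a assume "x \<notin> cball 0 1"
  then have "norm (real (Suc n) *\<^sub>R x) \<ge> 1" 
  proof -
    have "1 * 1 \<le> real (Suc n) * norm x"
      using \<open>x \<notin> cball 0 1\<close> by (intro mult_mono) auto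
    then show ?thesis by (simp only: norm_scaleR abs_of_nat mult_1)
  qed
  then show "mollifier n x = 0" by (simp add: mollifier_def bump_eq_0)
qed auto

lemma mollifier_nonneg: "0 \<le> mollifier n x"
  using integral_bump_pos by (simp add: mollifier_def bump_nonneg less_imp_le)

lemma mollifier_eq_0:
  assumes "inverse (real (Suc n)) \<le> norm x" shows "mollifier n x = 0"
proof -
  have "1 \<le> real (Suc n) * norm x" using assms by (simp add: field_simps)
  then have "1 \<le> norm (real (Suc n) *\<^sub>R x)" by (simp only: norm_scaleR abs_of_nat)
  then show ?thesis by (simp add: mollifier_def bump_eq_0)
qed

lemma mollifier_neq_0D:
  assumes "mollifier n x \<noteq> 0"
  shows "norm x < inverse (real (Suc n))" "norm x \<le> 1"
proof -
  show "norm x < inverse (real (Suc n))" using mollifier_eq_0[of n x] assms by force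
  also have "\<dots> \<le> 1" by (simp add: inverse_le_1_iff)
  finally show "norm x \<le> 1" by simp
qed

lemma integral_mollifier: "(LBINT x. mollifier n (x::'a::euclidean_space)) = 1"
proof -
  have [measurable]: "(bump :: 'a \<Rightarrow> real) \<in> borel_measurable borel"
    by (intro borel_measurable_continuous_onI smooth_continuous_on smooth_bump)
  define c where "c = real (Suc n)"
  have c: "c > 0" by (simp add: c_def)
  have "(LBINT x. bump (x::'a)) =
      (LINT x|density (distr lborel borel (\<lambda>x::'a. 0 + c *\<^sub>R x)) (\<lambda>_. \<bar>c\<bar>^DIM('a)). bump x)"
    using lborel_affine[of c "0::'a"] c by simp
  also have "\<dots> = c ^ DIM('a) * (LBINT x. bump (c *\<^sub>R (x::'a)))"
    using c by (subst integral_density) (auto simp: integral_distr)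
  finally show ?thesis
    using integral_bump_pos[where 'a='a] c
    by (simp add: mollifier_def c_def[symmetric] zero_less_mult_iff del: of_nat_Suc)
qed

text \<open>The power of \<open>Suc n\<close> is matched to the commutator estimate:
  \<open>DIM('a)\<close> factors cancel against the volume of the support and the remaining one
  against the Lipschitz bound for \<open>V x - V y\<close>.\<close>

lemma mollifier_fderiv_bound:
  obtains C where "0 \<le> C"
    "\<And>n w v. \<bar>frechet_derivative (mollifier n :: 'a::euclidean_space \<Rightarrow> real) (at w) v\<bar>
       \<le> C * real (Suc n) ^ Suc DIM('a) * norm v"
proof -
  obtain M where M: "0 \<le> M" "\<And>x v. \<bar>frechet_derivative (bump :: 'a \<Rightarrow> real) (at x) v\<bar> \<le> M * norm v"
    by (rule test_functions_fderiv_bounded[OF bump_test[where 'a='a]]) blast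
  define I where "I = (LBINT x. bump (x::'a))"
  have I: "I > 0" unfolding I_def by (rule integral_bump_pos)
  show ?thesis
  proof (rule that[of "M / I"])
    show "0 \<le> M / I" using M I by simp
    fix n and w v :: 'a
    let ?c = "real (Suc n)"
    have "((\<lambda>w. bump (?c *\<^sub>R w)) has_derivative (\<lambda>v. frechet_derivative bump (at (?c *\<^sub>R w)) (?c *\<^sub>R v))) (at w)"
      by (rule has_derivative_compose[where f="\<lambda>w. ?c *\<^sub>R w"])
        (auto intro!: derivative_eq_intros smooth_has_derivative smooth_bump)
    then have "((\<lambda>w. (?c ^ DIM('a) / I) * bump (?c *\<^sub>R w)) has_derivative
       (\<lambda>v. (?c ^ DIM('a) / I) * frechet_derivative bump (at (?c *\<^sub>R w)) (?c *\<^sub>R v))) (at w)"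
      by (rule has_derivative_mult_right)
    from frechet_derivative_at[OF this]
    have "frechet_derivative (mollifier n) (at w) v =
        (?c ^ DIM('a) / I) * frechet_derivative bump (at (?c *\<^sub>R w)) (?c *\<^sub>R v)"
      by (simp add: mollifier_def[abs_def] I_def fun_eq_iff)
    then have "\<bar>frechet_derivative (mollifier n) (at w) v\<bar> \<le> (?c ^ DIM('a) / I) * (M * norm (?c *\<^sub>R v))"
      using M(2)[of "?c *\<^sub>R w" "?c *\<^sub>R v"] I by (simp only: abs_mult) (intro mult_mono, auto)
    then show "\<bar>frechet_derivative (mollifier n) (at w) v\<bar> \<le> M / I * ?c ^ Suc DIM('a) * norm v"
      by (simp add: mult_ac)
  qed
qed

section \<open>Convolution\<close>

lemma distr_lborel_reflect: "distr lborel borel (\<lambda>y. x - y) = (lborel :: 'a::euclidean_space measure)"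
proof -
  have "density (distr lborel borel (\<lambda>y. x - y)) (\<lambda>_. 1) = (lborel :: 'a measure)"
    using lborel_affine[of "-1" x] by simp
  then show ?thesis by (simp add: density_1)
qed

lemma integral_lborel_reflect:
  fixes f :: "'a::euclidean_space \<Rightarrow> real"
  assumes [measurable]: "f \<in> borel_measurable borel"
  shows "(LBINT y. f (x - y)) = (LBINT y. f y)"
proof -
  have "(LBINT y. f y) = (LINT y|distr lborel borel (\<lambda>y. x - y). f y)"
    by (simp add: distr_lborel_reflect)
  also have "\<dots> = (LBINT y. f (x - y))" by (rule integral_distr) auto
  finally show ?thesis by simp
qed

lemma integrable_lborel_reflect:
  fixes f :: "'a::euclidean_space \<Rightarrow> real"
  assumes "integrable lborel f"
  shows "integrable lborel (\<lambda>y. f (x - y))"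
proof -
  have "integrable (distr lborel borel (\<lambda>y. x - y)) f"
    using assms by (simp add: distr_lborel_reflect)
  then show ?thesis by (subst (asm) integrable_distr_eq) (use assms in auto)
qed

lemma locally_integrable_mult_compact_support:
  assumes "locally_integrable g" "continuous_on UNIV \<psi>" "compact C" "\<And>x. x \<notin> C \<Longrightarrow> \<psi> x = 0"
  shows "integrable lborel (\<lambda>x. g x * \<psi> x)"
proof -
  obtain M where M: "0 \<le> M" "\<And>x. \<bar>\<psi> x\<bar> \<le> M"
    by (rule compact_support_bounded[OF assms(2-4)]) auto
  have [measurable]: "g \<in> borel_measurable borel" "\<psi> \<in> borel_measurable borel"
    using assms(1,2) by (auto simp: locally_integrable_def intro: borel_measurable_continuous_onI)
  have "set_integrable lborel C g" using assms by (simp add: locally_integrable_def)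
  then have "integrable lborel (\<lambda>x. M * (indicator C x *\<^sub>R g x))"
    unfolding set_integrable_def by (rule integrable_mult_right)
  then show ?thesis
  proof (rule Bochner_Integration.integrable_bound)
    have "norm (g x * \<psi> x) \<le> norm (M * (indicator C x *\<^sub>R g x))" for x
    proof (cases "x \<in> C")
      case True
      then show ?thesis
        using mult_right_mono[OF M(2)[of x], of "\<bar>g x\<bar>"] M(1) by (simp add: abs_mult mult.commute)
    qed (simp add: assms(4))
    then show "AE x in lborel. norm (g x * \<psi> x) \<le> norm (M * (indicator C x *\<^sub>R g x))" by simp
  qed auto
qed

lemma continuous_locally_integrable:
  assumes "continuous_on UNIV g" shows "locally_integrable g"
  unfolding locally_integrable_def set_integrable_def
  by (intro conjI allI impI borel_measurable_continuous_onI assms borel_integrable_compact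
      continuous_on_subset[OF assms]) auto

lemma integrable_locally_integrable:
  assumes "integrable lborel (g :: 'a::euclidean_space \<Rightarrow> real)" shows "locally_integrable g"
  unfolding locally_integrable_def set_integrable_def
  using assms by (intro conjI allI impI integrable_mult_indicator) (auto intro: borel_compact)

lemma locally_integrable_mult_test:
  assumes "locally_integrable g" "\<phi> \<in> test_functions U"
  shows "integrable lborel (\<lambda>x. g x * \<phi> x)"
  by (rule test_functionsE[OF assms(2)])
    (rule locally_integrable_mult_compact_support[OF assms(1) smooth_continuous_on])

lemma locally_integrable_mult_reflect:
  assumes "locally_integrable g" "\<phi> \<in> test_functions UNIV"
  shows "integrable lborel (\<lambda>y. g y * \<phi> (x - y))"
  by (rule locally_integrable_mult_test[OF assms(1) test_functions_reflect[OF assms(2)]])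

lemma test_functions_lipschitz:
  assumes "\<phi> \<in> test_functions U" "\<And>x v. \<bar>frechet_derivative \<phi> (at x) v\<bar> \<le> M * norm v"
  shows "\<bar>\<phi> x - \<phi> y\<bar> \<le> M * norm (x - y)"
proof -
  have "norm (\<phi> x - \<phi> y) \<le> M * norm (x - y)"
    by (rule differentiable_bound[of UNIV \<phi> "\<lambda>x. frechet_derivative \<phi> (at x)"])
      (use assms(2) in \<open>auto intro!: onorm_le smooth_has_derivative test_functions_smooth[OF assms(1)]\<close>)
  then show ?thesis by simp
qed

definition conv :: "('a::euclidean_space \<Rightarrow> real) \<Rightarrow> ('a \<Rightarrow> real) \<Rightarrow> 'a \<Rightarrow> real" where
  "conv g \<phi> x = (LBINT y. g y * \<phi> (x - y))"

text \<open>Differentiation under the integral sign by dominated convergence along sequences.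
  Boundedness of the derivative of the test function bounds the quotient, and compact support
  confines it to a fixed ball, over which a locally integrable \<open>g\<close> is
  integrable.\<close>

lemma conv_has_derivative:
  assumes g: "locally_integrable g" and \<phi>: "\<phi> \<in> test_functions UNIV"
  shows "(conv g \<phi> has_derivative (\<lambda>v. conv g (\<lambda>w. frechet_derivative \<phi> (at w) v) x)) (at x)"
  unfolding has_derivative_at
proof
  let ?D = "\<lambda>w v. frechet_derivative \<phi> (at w) v"
  note int0 = locally_integrable_mult_reflect[OF g \<phi>]
  note int1 = locally_integrable_mult_reflect[OF g test_functions_fderiv[OF \<phi>]]
  have Dlin: "linear (?D w)" for w
    by (simp add: linear_frechet_derivative smooth_differentiable test_functions_smooth[OF \<phi>])
  have "linear (\<lambda>v. conv g (\<lambda>w. ?D w v) x)"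
    using int1 by (intro linearI)
      (simp_all add: conv_def linear_add[OF Dlin] linear_scale[OF Dlin] distrib_left mult.left_commute[of _ "_::real"])
  then show "bounded_linear (\<lambda>v. conv g (\<lambda>w. ?D w v) x)"
    by (simp add: linear_conv_bounded_linear)
  obtain M where M: "0 \<le> M" "\<And>x v. \<bar>?D x v\<bar> \<le> M * norm v"
    by (rule test_functions_fderiv_bounded[OF \<phi>]) blast
  note lip = test_functions_lipschitz[OF \<phi> M(2)]
  obtain C where C: "smooth \<phi>" "compact C" "\<And>x. x \<notin> C \<Longrightarrow> \<phi> x = 0"
    by (rule test_functionsE[OF \<phi>]) blast
  obtain R where R: "C \<subseteq> cball 0 R"
    using compact_imp_bounded[OF C(2)] unfolding bounded_iff subset_iff mem_cball_0 by blast
  have \<phi>0: "\<phi> w = 0" if "norm w > R" for w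
    using C(3)[of w] R that by force
  have D0: "?D w v = 0" if "norm w > R" for w v
    by (rule fderiv_eq_0_outside[of "cball 0 R"]) (use \<phi>0 that in auto)
  have [measurable]: "g \<in> borel_measurable borel" using g by (simp add: locally_integrable_def)
  have [measurable]: "\<phi> \<in> borel_measurable borel" "(\<lambda>w. ?D w v) \<in> borel_measurable borel" for v
    using C(1) by (auto intro!: borel_measurable_continuous_onI smooth_continuous_on smooth_fderiv)
  show "((\<lambda>h. norm (conv g \<phi> (x + h) - conv g \<phi> x - conv g (\<lambda>w. ?D w h) x) / norm h) \<longlongrightarrow> 0) (at 0)"
    unfolding tendsto_at_iff_sequentially comp_def
  proof (intro allI impI)
    fix S :: "nat \<Rightarrow> 'a" assume S: "\<forall>i. S i \<in> UNIV - {0}" "S \<longlonglongrightarrow> 0"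
    obtain B where B: "\<And>i. norm (S i) \<le> B"
      using convergent_imp_Bseq[of S] S(2) by (auto simp: convergent_def Bseq_def)
    \<comment> \<open>The remainder of the first-order expansion of the test function at
      \<open>x - y\<close>, divided by the length of the increment: it tends to 0 for each
      \<open>y\<close>.\<close>
    define r where "r i y = (\<phi> (x + S i - y) - \<phi> (x - y) - ?D (x - y) (S i)) / norm (S i)" for i y
    have eq: "conv g \<phi> (x + S i) - conv g \<phi> x - conv g (\<lambda>w. ?D w (S i)) x = norm (S i) * (LBINT y. g y * r i y)" for i
    proof -
      have "conv g \<phi> (x + S i) - conv g \<phi> x - conv g (\<lambda>w. ?D w (S i)) x =
        (LBINT y. g y * \<phi> (x + S i - y) - g y * \<phi> (x - y) - g y * ?D (x - y) (S i))"
        unfolding conv_def using int0 int1 by simp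
      also have "\<dots> = (LBINT y. norm (S i) * (g y * r i y))"
        using S(1) by (intro Bochner_Integration.integral_cong) (auto simp: r_def field_simps)
      finally show ?thesis by simp
    qed
    have "(\<lambda>i. LBINT y. g y * r i y) \<longlonglongrightarrow> (LBINT y::'a. 0 :: real)"
    \<comment> \<open>The Lipschitz bound and the derivative each contribute \<open>M\<close>. The
      radius is enlarged by \<open>B\<close> because the increments shift the support by at most
      \<open>B\<close>.\<close>
    proof (rule integral_dominated_convergence[where w="\<lambda>y. 2 * M * norm (indicator (cball x (R + B)) y *\<^sub>R g y)"])
      show "integrable lborel (\<lambda>y. 2 * M * norm (indicator (cball x (R + B)) y *\<^sub>R g y))"
      proof -
        have "set_integrable lborel (cball x (R + B)) g" using g by (simp add: locally_integrable_def)
        then show ?thesis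
          unfolding set_integrable_def by (rule integrable_mult_right[OF integrable_norm])
      qed
      have "(\<lambda>i. r i y) \<longlonglongrightarrow> 0" for y
      proof -
        have "((\<lambda>h. norm (\<phi> (x - y + h) - \<phi> (x - y) - ?D (x - y) h) / norm h) \<longlongrightarrow> 0) (at 0)"
          using smooth_has_derivative[OF C(1), of "x - y"] unfolding has_derivative_at by (rule conjunct2)
        then have "(\<lambda>i. norm (\<phi> (x - y + S i) - \<phi> (x - y) - ?D (x - y) (S i)) / norm (S i)) \<longlonglongrightarrow> 0"
          using S unfolding tendsto_at_iff_sequentially comp_def by blast
        moreover have "x - y + S i = x + S i - y" for i by simp
        ultimately have "(\<lambda>i. \<bar>r i y\<bar>) \<longlonglongrightarrow> 0" by (simp add: r_def)
        then show ?thesis by (rule tendsto_rabs_zero_cancel)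
      qed
      from tendsto_mult_right_zero[OF this]
      show "AE y in lborel. (\<lambda>i. g y * r i y) \<longlonglongrightarrow> 0" by (rule AE_I2)
      fix i
      have "norm (g y * r i y) \<le> 2 * M * norm (indicator (cball x (R + B)) y *\<^sub>R g y)" for y
      proof (cases "y \<in> cball x (R + B)")
        case True
        have "\<bar>\<phi> (x + S i - y) - \<phi> (x - y) - ?D (x - y) (S i)\<bar> \<le> M * norm (S i) + M * norm (S i)"
          using lip[of "x + S i - y" "x - y"] M(2)[of "x - y" "S i"] by simp
        then have "\<bar>r i y\<bar> \<le> 2 * M"
          using S(1) by (simp add: r_def field_simps)
        then show ?thesis using True mult_left_mono[of "\<bar>r i y\<bar>" "2 * M" "\<bar>g y\<bar>"]
          by (simp add: abs_mult mult_ac)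
      next
        case False
        then have "R + B < norm (x - y)" by (simp add: dist_norm)
        moreover have "norm (x - y) \<le> norm (x + S i - y) + norm (S i)"
          using norm_triangle_ineq4[of "x + S i - y" "S i"] by simp
        moreover have "0 \<le> B" using B[of 0] norm_ge_zero order.trans by blast
        ultimately have "norm (x - y) > R" "norm (x + S i - y) > R" using B[of i] by linarith+
        then show ?thesis using False by (simp add: r_def \<phi>0 D0)
      qed
      then show "AE y in lborel. norm (g y * r i y) \<le> 2 * M * norm (indicator (cball x (R + B)) y *\<^sub>R g y)" by simp
    qed (auto simp: r_def)
    then have "(\<lambda>i. \<bar>LBINT y. g y * r i y\<bar>) \<longlonglongrightarrow> 0" by (simp add: tendsto_rabs_zero)
    then show "(\<lambda>i. norm (conv g \<phi> (x + S i) - conv g \<phi> x - conv g (\<lambda>w. ?D w (S i)) x) / norm (S i)) \<longlonglongrightarrow> 0"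
      unfolding eq using S(1) by (simp add: abs_mult)
  qed
qed

lemma conv_smooth:
  assumes g: "locally_integrable g" and \<phi>: "\<phi> \<in> test_functions UNIV"
  shows "smooth (conv g \<phi>)"
proof -
  have "Ck n (conv g \<phi>)" for n
    using \<phi>
  proof (induction n arbitrary: \<phi>)
    case 0
    then show ?case
      using has_derivative_continuous[OF conv_has_derivative[OF g]] by (simp add: continuous_on_eq_continuous_at)
  next
    case (Suc n)
    show ?case
      by (rule Ck_SucI[OF conv_has_derivative[OF g Suc.prems]])
        (rule Suc.IH[OF test_functions_fderiv[OF Suc.prems]])
  qed
  then show ?thesis by (simp add: smooth_def)
qed

lemma conv_vderiv:
  assumes "locally_integrable g" "\<phi> \<in> test_functions UNIV"
  shows "vderiv V (conv g \<phi>) x = conv g (\<lambda>w. frechet_derivative \<phi> (at w) (V x)) x"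
  using frechet_derivative_at[OF conv_has_derivative[OF assms, of x]] by (simp add: vderiv_def fun_eq_iff)

lemma conv_nonneg: "(\<And>x. 0 \<le> g x) \<Longrightarrow> (\<And>x. 0 \<le> \<phi> x) \<Longrightarrow> 0 \<le> conv g \<phi> x"
  by (simp add: conv_def)

lemma conv_cong:
  assumes "\<And>y. \<phi> (x - y) \<noteq> 0 \<Longrightarrow> g y = h y" shows "conv g \<phi> x = conv h \<phi> x"
  unfolding conv_def by (rule Bochner_Integration.integral_cong) (use assms in force)+

lemma conv_eq_0:
  assumes "\<And>y. \<phi> (x - y) \<noteq> 0 \<Longrightarrow> g y = 0" shows "conv g \<phi> x = 0"
  using conv_cong[of \<phi> x g "\<lambda>_. 0"] assms by (simp add: conv_def)

lemma integral_mollifier_reflect: "(LBINT y. mollifier n (x - y)) = (1::real)"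
  by (subst integral_lborel_reflect)
    (auto intro!: borel_measurable_continuous_onI smooth_continuous_on test_functions_smooth mollifier_test simp: integral_mollifier)

text \<open>A mollifier has mass one, so a constant may be moved inside the integral; closeness to
  \<open>g x\<close> is then a matter of the oscillation of \<open>g\<close>.\<close>

lemma conv_mollifier_diff:
  assumes "locally_integrable g"
  shows "conv g (mollifier n) x - c = (LBINT y. (g y - c) * mollifier n (x - y))"
  unfolding left_diff_distrib
  by (subst Bochner_Integration.integral_diff)
   (auto simp: conv_def integral_mollifier_reflect intro!: locally_integrable_mult_reflect assms mollifier_test
      integrable_lborel_reflect test_functions_integrable[OF mollifier_test])

lemma conv_mollifier_bound:
  assumes "locally_integrable g" "\<And>y. norm (x - y) < inverse (real (Suc n)) \<Longrightarrow> \<bar>g y - c\<bar> \<le> e"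
  shows "\<bar>conv g (mollifier n) x - c\<bar> \<le> e"
proof -
  have "\<bar>conv g (mollifier n) x - c\<bar> \<le> (LBINT y. e * mollifier n (x - y))"
    unfolding conv_mollifier_diff[OF assms(1)]
  proof (rule integral_abs_bound_integral)
    show "integrable lborel (\<lambda>y. (g y - c) * mollifier n (x - y))"
      unfolding left_diff_distrib by (intro Bochner_Integration.integrable_diff integrable_mult_right locally_integrable_mult_reflect assms mollifier_test
      integrable_lborel_reflect test_functions_integrable[OF mollifier_test])
    show "integrable lborel (\<lambda>y. e * mollifier n (x - y))"
      by (intro integrable_mult_right integrable_lborel_reflect test_functions_integrable[OF mollifier_test])
    fix y
    show "\<bar>(g y - c) * mollifier n (x - y)\<bar> \<le> e * mollifier n (x - y)"
    proof (cases "norm (x - y) < inverse (real (Suc n))")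
      case True
      then show ?thesis using assms(2) by (simp add: abs_mult mollifier_nonneg mult_right_mono)
    next
      case False
      then have "mollifier n (x - y) = 0" by (intro mollifier_eq_0) simp
      then show ?thesis by simp
    qed
  qed
  then show ?thesis by (simp add: integral_mollifier_reflect)
qed

lemma continuous_osc:
  fixes g :: "'a::euclidean_space \<Rightarrow> real"
  assumes "continuous_on UNIV g" "compact A" "e > 0"
  shows "\<forall>\<^sub>F n in sequentially. \<forall>x\<in>A. \<forall>y. norm (x - y) < inverse (real (Suc n)) \<longrightarrow> \<bar>g y - g x\<bar> < e"
proof -
  obtain R where R: "A \<subseteq> cball 0 R"
    using compact_imp_bounded[OF assms(2)] unfolding bounded_iff subset_iff mem_cball_0 by blast
  have "uniformly_continuous_on (cball 0 (R + 1)) g"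
    using assms(1) by (intro compact_uniformly_continuous) (auto intro: continuous_on_subset)
  then obtain \<delta> where \<delta>: "\<delta> > 0" "\<And>x y. x \<in> cball 0 (R+1) \<Longrightarrow> y \<in> cball 0 (R+1) \<Longrightarrow> dist y x < \<delta> \<Longrightarrow> dist (g y) (g x) < e"
    unfolding uniformly_continuous_on_def using assms(3) by metis
  have "\<forall>\<^sub>F n in sequentially. inverse (real (Suc n)) < min \<delta> 1"
    using order_tendstoD(2)[OF LIMSEQ_inverse_real_of_nat, of "min \<delta> 1"] \<delta>(1) by simp
  then show ?thesis
  proof eventually_elim
    case (elim n)
    show ?case
    proof (intro ballI allI impI)
      fix x y assume *: "x \<in> A" "norm (x - y) < inverse (real (Suc n))"
      have "norm x \<le> R" using R * by auto
      moreover have "norm y \<le> norm x + norm (x - y)" using norm_triangle_sub[of y x] by (simp add: norm_minus_commute)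
      moreover have "norm (x - y) < \<delta>" "norm (x - y) < 1" using * elim by linarith+
      ultimately have "dist (g y) (g x) < e"
        by (intro \<delta>(2)) (auto simp: dist_norm norm_minus_commute)
      then show "\<bar>g y - g x\<bar> < e" by (simp add: dist_real_def)
    qed
  qed
qed

lemma conv_mollifier_uniform_limit:
  assumes "continuous_on UNIV g" "compact A"
  shows "uniform_limit A (\<lambda>n. conv g (mollifier n)) g sequentially"
proof (rule uniform_limitI)
  fix e :: real assume "e > 0"
  then have "\<forall>\<^sub>F n in sequentially. \<forall>x\<in>A. \<forall>y. norm (x - y) < inverse (real (Suc n)) \<longrightarrow> \<bar>g y - g x\<bar> < e / 2"
    by (intro continuous_osc assms) simp
  then show "\<forall>\<^sub>F n in sequentially. \<forall>x\<in>A. dist (conv g (mollifier n) x) (g x) < e"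
  proof eventually_elim
    case (elim n)
    show ?case
    proof
      fix x assume "x \<in> A"
      then have "\<bar>conv g (mollifier n) x - g x\<bar> \<le> e / 2"
        using elim by (intro conv_mollifier_bound continuous_locally_integrable assms) (auto intro: less_imp_le)
      then show "dist (conv g (mollifier n) x) (g x) < e" using \<open>e > 0\<close> by (simp add: dist_real_def)
    qed
  qed
qed

text \<open>One compact set that contains the supports of all mollifications of a function supported
  in \<open>S\<close>, uniformly in the index.\<close>

definition unit_neighbourhood :: "'a::euclidean_space set \<Rightarrow> 'a set" where
  "unit_neighbourhood S = {x + y |x y. x \<in> S \<and> y \<in> cball 0 1}"

lemma compact_unit_neighbourhood: "compact S \<Longrightarrow> compact (unit_neighbourhood S)"
  unfolding unit_neighbourhood_def by (rule compact_sums) auto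

lemma in_unit_neighbourhood:
  assumes "s \<in> S" "norm (x - s) \<le> 1"
  shows "x \<in> unit_neighbourhood S"
proof -
  have "x = s + (x - s)" by simp
  then show ?thesis using assms unfolding unit_neighbourhood_def by fastforce
qed

section \<open>Convergence of mollifications in L1\<close>

lemma nn_integral_lborel_reflect:
  fixes f :: "'a::euclidean_space \<Rightarrow> ennreal"
  assumes [measurable]: "f \<in> borel_measurable borel"
  shows "(\<integral>\<^sup>+y. f (x - y) \<partial>lborel) = (\<integral>\<^sup>+y. f y \<partial>lborel)"
proof -
  have "(\<integral>\<^sup>+y. f y \<partial>lborel) = (\<integral>\<^sup>+y. f y \<partial>distr lborel borel (\<lambda>y. x - y))"
    by (simp add: distr_lborel_reflect)
  also have "\<dots> = (\<integral>\<^sup>+y. f (x - y) \<partial>lborel)" by (rule nn_integral_distr) auto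
  finally show ?thesis by simp
qed

text \<open>Density of compactly supported continuous functions in L1, by induction over integrable
  functions. An indicator is approximated in three stages: by a closed subset from inside, by a
  compact piece of it, and by tent functions of the distance to that piece.\<close>

lemma integrable_approx_compact_support:
  fixes H :: "'a::euclidean_space \<Rightarrow> real"
  assumes "integrable lborel H" "e > 0"
  shows "\<exists>\<phi> C. continuous_on UNIV \<phi> \<and> compact C \<and> (\<forall>x. x \<notin> C \<longrightarrow> \<phi> x = 0) \<and> (LBINT x. \<bar>H x - \<phi> x\<bar>) < e"
  using assms
proof (induction H arbitrary: e rule: integrable_induct)
  case (base A c)
  have A: "A \<in> sets lebesgue" "A \<in> sets borel" using base by auto
  \<comment> \<open>The tolerance for each of the three stages; the added 1 covers
    \<open>c = 0\<close>.\<close>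
  define a where "a = (e / 3) / (\<bar>c\<bar> + 1)"
  have a: "a > 0" using base by (simp add: a_def)
  have ac: "\<bar>c\<bar> * a \<le> e / 3"
  proof -
    have "\<bar>c\<bar> * a \<le> (\<bar>c\<bar> + 1) * a" using a by (intro mult_right_mono) auto
    also have "\<dots> = e / 3"
    proof -
      have "\<bar>c\<bar> + 1 \<noteq> 0" using abs_ge_zero[of c] by linarith
      then show ?thesis unfolding a_def by (metis times_divide_eq_right nonzero_mult_div_cancel_left)
    qed
    finally show ?thesis .
  qed
  obtain T where T: "closed T" "T \<subseteq> A" "A - T \<in> lmeasurable" "emeasure lebesgue (A - T) < ennreal a"
    using sets_lebesgue_inner_closed[OF A(1) a] by blast
  have [measurable]: "A \<in> sets borel" "T \<in> sets borel" using A T by auto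
  have Tfin: "emeasure lborel T < \<infinity>"
    using emeasure_mono[OF T(2), of lborel] base by (auto intro: le_less_trans)
  have "(\<lambda>n. LBINT x. indicator (T \<inter> cball 0 (real n)) x :: real) \<longlonglongrightarrow> (LBINT x. indicator T x)"
  proof (rule integral_dominated_convergence[where w="indicator T"])
    show "integrable lborel (indicat_real T)" using Tfin by (simp add: integrable_real_indicator)
    have "(\<lambda>n. indicator (T \<inter> cball 0 (real n)) x :: real) \<longlonglongrightarrow> indicator T x" for x
    proof (rule tendsto_eventually)
      have "\<forall>\<^sub>F n in sequentially. norm x \<le> real n"
        using eventually_ge_at_top[of "nat \<lceil>norm x\<rceil>"] by eventually_elim linarith
      then show "\<forall>\<^sub>F n in sequentially. indicator (T \<inter> cball 0 (real n)) x = (indicator T x :: real)"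
        by eventually_elim (simp add: indicator_def)
    qed
    then show "AE x in lborel. (\<lambda>n. indicator (T \<inter> cball 0 (real n)) x :: real) \<longlonglongrightarrow> indicator T x" by simp
  qed (auto simp: indicator_def)
  then obtain n where n: "\<bar>(LBINT x. indicator (T \<inter> cball 0 (real n)) x) - (LBINT x. indicat_real T x)\<bar> < a"
    using LIMSEQ_D[OF _ a] by force
  define S where "S = T \<inter> cball 0 (real n)"
  have S: "compact S" "S \<subseteq> T" using T by (auto simp: S_def)
  have [measurable]: "S \<in> sets borel" using S by (simp add: borel_compact)
  define S' where "S' = unit_neighbourhood S"
  have S': "compact S'" unfolding S'_def by (intro compact_unit_neighbourhood S)
  have [measurable]: "S' \<in> sets borel" using S' by (simp add: borel_compact)
  \<comment> \<open>Tents that shrink to the indicator of \<open>S\<close>. The empty set is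
    separated because \<open>infdist\<close> to it is 0 by convention, which would make the tent
    constantly 1.\<close>
  define \<psi> where "\<psi> k x = (if S = {} then 0 else max 0 (1 - real (Suc k) * infdist x S))" for k x
  have \<psi>cont: "continuous_on UNIV (\<psi> k)" for k
    unfolding \<psi>_def by (cases "S = {}") (auto intro!: continuous_intros)
  have \<psi>0: "\<psi> k x = 0" if "x \<notin> S'" for k x
  proof (cases "S = {}")
    case False
    have "1 \<le> infdist x S"
    proof (rule ccontr)
      assume *: "\<not> 1 \<le> infdist x S"
      obtain s where "s \<in> S" "infdist x S = dist x s"
        using infdist_attains_inf[OF compact_imp_closed[OF S(1)] False] by blast
      then have "x \<in> S'" using * unfolding S'_def
        by (intro in_unit_neighbourhood[of s]) (auto simp: dist_norm)
      then show False using that by simp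
    qed
    then have "1 * 1 \<le> real (Suc k) * infdist x S" by (intro mult_mono) auto
    then show ?thesis by (simp add: \<psi>_def del: of_nat_Suc)
  qed (simp add: \<psi>_def)
  have \<psi>b: "0 \<le> \<psi> k x \<and> \<psi> k x \<le> 1" for k x by (auto simp: \<psi>_def infdist_nonneg)
  have [measurable]: "\<psi> k \<in> borel_measurable borel" for k
    by (rule borel_measurable_continuous_onI[OF \<psi>cont])
  have "(\<lambda>k. LBINT x. \<bar>indicator S x - \<psi> k x\<bar>) \<longlonglongrightarrow> (LBINT x::'a. 0 :: real)"
  proof (rule integral_dominated_convergence[where w="\<lambda>x. indicator S' x"])
    show "integrable lborel (\<lambda>x. indicat_real S' x)"
      using emeasure_bounded_finite[OF compact_imp_bounded[OF S']] by (simp add: integrable_real_indicator)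
    have SS: "S \<subseteq> S'" unfolding S'_def by (auto intro: in_unit_neighbourhood)
    have "norm \<bar>indicator S x - \<psi> k x\<bar> \<le> indicator S' x" for k x
      using \<psi>0[of x k] \<psi>b[of k x] SS by (auto simp: indicator_def)
    then show "AE x in lborel. norm \<bar>indicator S x - \<psi> k x\<bar> \<le> indicator S' x" for k by simp
    have "(\<lambda>k. \<bar>indicator S x - \<psi> k x\<bar>) \<longlonglongrightarrow> 0" for x
    proof (cases "x \<in> S")
      case True
      then have "\<psi> k x = 1" for k by (auto simp: \<psi>_def)
      then show ?thesis using True by simp
    next
      case False
      show ?thesis
      proof (cases "S = {}")
        case nonempty: False
        then have pos: "0 < infdist x S"
          using False in_closed_iff_infdist_zero[OF compact_imp_closed[OF S(1)] nonempty, of x] infdist_nonneg[of x S] by linarith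
        have "\<forall>\<^sub>F k in sequentially. inverse (real (Suc k)) < infdist x S"
          by (rule order_tendstoD(2)[OF LIMSEQ_inverse_real_of_nat pos])
        then have "\<forall>\<^sub>F k in sequentially. \<bar>indicator S x - \<psi> k x\<bar> = 0"
        proof eventually_elim
          case (elim k)
          then have "1 \<le> real (Suc k) * infdist x S" by (simp add: field_simps)
          then show ?case using False by (simp add: \<psi>_def del: of_nat_Suc)
        qed
        then show ?thesis by (rule tendsto_eventually)
      qed (simp add: \<psi>_def)
    qed
    then show "AE x in lborel. (\<lambda>k. \<bar>indicator S x - \<psi> k x\<bar>) \<longlonglongrightarrow> 0" by simp
  qed auto
  then obtain k where k: "(LBINT x. \<bar>indicator S x - \<psi> k x\<bar>) < a"
    using LIMSEQ_D[OF _ a] by fastforce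
  have Sfin: "emeasure lborel S < \<infinity>"
    using emeasure_bounded_finite[OF compact_imp_bounded[OF S(1)]] by simp
  have \<psi>int: "integrable lborel (\<psi> k)"
    by (rule compact_support_integrable[OF \<psi>cont S']) (rule \<psi>0)
  have int: "integrable lborel (indicat_real A)" "integrable lborel (indicat_real T)" "integrable lborel (indicat_real S)"
    using base Tfin Sfin by (auto simp: integrable_real_indicator)
  have "(LBINT x. indicat_real A x - indicat_real T x) = (LBINT x. indicat_real (A - T) x)"
    using T(2) by (intro Bochner_Integration.integral_cong) (auto simp: indicator_def)
  also have "\<dots> = measure lborel (A - T)" by simp
  also have "\<dots> \<le> a"
    using T(4) a by (simp add: measure_def enn2real_leI less_imp_le)
  finally have iA: "(LBINT x. indicat_real A x - indicat_real T x) \<le> a" .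
  have iT: "(LBINT x. indicat_real T x - indicat_real S x) \<le> a"
    using n int by (simp add: S_def)
  have "(LBINT x. \<bar>indicator A x *\<^sub>R c - c * \<psi> k x\<bar>) \<le>
     (LBINT x. \<bar>c\<bar> * ((indicator A x - indicator T x) + (indicator T x - indicator S x) + \<bar>indicator S x - \<psi> k x\<bar>))"
  proof (intro integral_mono)
    fix x
    have "\<bar>indicator A x *\<^sub>R c - c * \<psi> k x\<bar> = \<bar>c\<bar> * \<bar>indicator A x - \<psi> k x\<bar>"
      by (simp add: abs_mult[symmetric] algebra_simps)
    also have "\<dots> \<le> \<bar>c\<bar> * ((indicator A x - indicator T x) + (indicator T x - indicator S x) + \<bar>indicator S x - \<psi> k x\<bar>)"
      using T(2) S(2) by (intro mult_left_mono) (auto simp: indicator_def)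
    finally show "\<bar>indicator A x *\<^sub>R c - c * \<psi> k x\<bar> \<le> \<bar>c\<bar> * ((indicator A x - indicator T x) + (indicator T x - indicator S x) + \<bar>indicator S x - \<psi> k x\<bar>)" .
  qed (use int \<psi>int in \<open>auto\<close>)
  also have "\<dots> = \<bar>c\<bar> * ((LBINT x. indicat_real A x - indicat_real T x) + (LBINT x. indicat_real T x - indicat_real S x)
      + (LBINT x. \<bar>indicator S x - \<psi> k x\<bar>))"
    using int \<psi>int by simp
  also have "\<dots> \<le> \<bar>c\<bar> * (a + a + (LBINT x. \<bar>indicator S x - \<psi> k x\<bar>))"
    using iA iT by (intro mult_left_mono) auto
  also have "\<dots> \<le> 2 * (\<bar>c\<bar> * a) + \<bar>c\<bar> * (LBINT x. \<bar>indicator S x - \<psi> k x\<bar>)"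
    by (simp add: algebra_simps)
  also have "\<dots> < e"
  proof (cases "c = 0")
    case False
    then have "\<bar>c\<bar> * (LBINT x. \<bar>indicator S x - \<psi> k x\<bar>) < \<bar>c\<bar> * a"
      using k by (intro mult_strict_left_mono) auto
    then show ?thesis using ac by linarith
  qed (use base in simp)
  finally show ?case
    using \<psi>cont \<psi>0 S'
    by (intro exI[of _ "\<lambda>x. c * \<psi> k x"] exI[of _ S']) (auto intro: continuous_on_mult_left)
next
  case (add f g)
  obtain \<phi> C where 1: "continuous_on UNIV \<phi>" "compact C" "\<forall>x. x \<notin> C \<longrightarrow> \<phi> x = 0" "(LBINT x. \<bar>f x - \<phi> x\<bar>) < e / 2"
    using add.IH(1)[of "e / 2"] add.prems by auto
  obtain \<psi> D where 2: "continuous_on UNIV \<psi>" "compact D" "\<forall>x. x \<notin> D \<longrightarrow> \<psi> x = 0" "(LBINT x. \<bar>g x - \<psi> x\<bar>) < e / 2"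
    using add.IH(2)[of "e / 2"] add.prems by auto
  have int: "integrable lborel \<phi>" "integrable lborel \<psi>"
    using 1 2 compact_support_integrable by metis+
  have "(LBINT x. \<bar>f x + g x - (\<phi> x + \<psi> x)\<bar>) \<le> (LBINT x. \<bar>f x - \<phi> x\<bar> + \<bar>g x - \<psi> x\<bar>)"
    using add.hyps int by (intro integral_mono) auto
  also have "\<dots> = (LBINT x. \<bar>f x - \<phi> x\<bar>) + (LBINT x. \<bar>g x - \<psi> x\<bar>)"
    using add.hyps int by (intro Bochner_Integration.integral_add) auto
  also have "\<dots> < e" using 1 2 by simp
  finally show ?case
    using 1 2 by (intro exI[of _ "\<lambda>x. \<phi> x + \<psi> x"] exI[of _ "C \<union> D"]) (auto intro: continuous_on_add)
next
  case (lim f s)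
  have "(\<lambda>i. LBINT x. \<bar>f x - s i x\<bar>) \<longlonglongrightarrow> (LBINT x::'a. (0::real))"
  \<comment> \<open>The approximants of the induction rule are bounded by twice
    \<open>norm (f x)\<close>; the function itself adds one more.\<close>
  proof (rule integral_dominated_convergence[where w="\<lambda>x. 3 * norm (f x)"])
    have "\<bar>f x - s i x\<bar> \<le> 3 * norm (f x)" for x i
      using lim.hyps(3)[of x i] by simp
    then show "AE x in lborel. norm \<bar>f x - s i x\<bar> \<le> 3 * norm (f x)" for i by simp
    have "(\<lambda>i. \<bar>f x - s i x\<bar>) \<longlonglongrightarrow> 0" for x
      using tendsto_rabs[OF tendsto_diff[OF tendsto_const lim.hyps(2)[of x], of "f x"]] by simp
    then show "AE x in lborel. (\<lambda>i. \<bar>f x - s i x\<bar>) \<longlonglongrightarrow> 0" by simp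
  qed (use lim.hyps in auto)
  then obtain i where i: "(LBINT x. \<bar>f x - s i x\<bar>) < e / 2"
    using LIMSEQ_D[of _ _ "e / 2"] lim.prems by fastforce
  obtain \<phi> C where 1: "continuous_on UNIV \<phi>" "compact C" "\<forall>x. x \<notin> C \<longrightarrow> \<phi> x = 0" "(LBINT x. \<bar>s i x - \<phi> x\<bar>) < e / 2"
    using lim.IH[OF half_gt_zero[OF lim.prems], of i] by blast
  have int: "integrable lborel \<phi>" using 1 compact_support_integrable by metis
  have "(LBINT x. \<bar>f x - \<phi> x\<bar>) \<le> (LBINT x. \<bar>f x - s i x\<bar> + \<bar>s i x - \<phi> x\<bar>)"
    using lim.hyps int by (intro integral_mono) auto
  also have "\<dots> = (LBINT x. \<bar>f x - s i x\<bar>) + (LBINT x. \<bar>s i x - \<phi> x\<bar>)"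
    using lim.hyps int by (intro Bochner_Integration.integral_add) auto
  also have "\<dots> < e" using i 1 by simp
  finally show ?case using 1 by blast
qed

text \<open>Tonelli's theorem: integrating the kernel first in \<open>x\<close> gives one for every
  \<open>y\<close>, so mollification contracts the L1 norm.\<close>

lemma conv_L1:
  assumes H: "integrable lborel (H :: 'a::euclidean_space \<Rightarrow> real)"
  shows "integrable lborel (conv H (mollifier n))"
    "(LBINT x. \<bar>conv H (mollifier n) x\<bar>) \<le> (LBINT x. \<bar>H x\<bar>)"
proof -
  have [measurable]: "H \<in> borel_measurable borel" using H by auto
  have [measurable]: "(mollifier n :: 'a \<Rightarrow> real) \<in> borel_measurable borel"
    by (auto intro!: borel_measurable_continuous_onI smooth_continuous_on test_functions_smooth mollifier_test)
  have [measurable]: "conv H (mollifier n) \<in> borel_measurable borel"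
    by (intro borel_measurable_continuous_onI smooth_continuous_on conv_smooth integrable_locally_integrable H mollifier_test)
  have ki: "integrable lborel (\<lambda>y. mollifier n (x - y))" for x :: 'a
    by (intro integrable_lborel_reflect test_functions_integrable[OF mollifier_test])
  have one: "(\<integral>\<^sup>+y. ennreal (mollifier n (x - y)) \<partial>lborel) = 1" for x :: 'a
    using nn_integral_eq_integral[OF ki[of x]] by (simp add: mollifier_nonneg integral_mollifier_reflect)
  have symm: "(\<integral>\<^sup>+x. ennreal (mollifier n (x - y)) \<partial>lborel) = 1" for y :: 'a
  proof -
    have "(\<integral>\<^sup>+x. ennreal (mollifier n (0 - (y - x))) \<partial>lborel) = (\<integral>\<^sup>+x. ennreal (mollifier n ((0::'a) - x)) \<partial>lborel)"
      by (rule nn_integral_lborel_reflect[where f="\<lambda>w. ennreal (mollifier n (0 - w))"]) measurable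
    then show ?thesis using one[of 0] by simp
  qed
  have *: "(\<integral>\<^sup>+x. ennreal \<bar>conv H (mollifier n) x\<bar> \<partial>lborel) \<le> (\<integral>\<^sup>+x. ennreal \<bar>H x\<bar> \<partial>lborel)"
  proof -
    have "ennreal \<bar>conv H (mollifier n) x\<bar> \<le> (\<integral>\<^sup>+y. ennreal (\<bar>H y\<bar> * mollifier n (x - y)) \<partial>lborel)" for x
    proof -
      have "integrable lborel (\<lambda>y. H y * mollifier n (x - y))"
        by (intro locally_integrable_mult_reflect integrable_locally_integrable H mollifier_test)
      then have "ennreal (norm (conv H (mollifier n) x)) \<le> (\<integral>\<^sup>+y. ennreal (norm (H y * mollifier n (x - y))) \<partial>lborel)"
        unfolding conv_def by (rule integral_norm_bound_ennreal)
      then show ?thesis by (simp add: abs_mult mollifier_nonneg)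
    qed
    then have "(\<integral>\<^sup>+x. ennreal \<bar>conv H (mollifier n) x\<bar> \<partial>lborel) \<le>
        (\<integral>\<^sup>+x. (\<integral>\<^sup>+y. ennreal (\<bar>H y\<bar> * mollifier n (x - y)) \<partial>lborel) \<partial>lborel)"
      by (rule nn_integral_mono)
    also have "\<dots> = (\<integral>\<^sup>+y. (\<integral>\<^sup>+x. ennreal (\<bar>H y\<bar> * mollifier n (x - y)) \<partial>lborel) \<partial>lborel)"
      by (rule lborel_pair.Fubini') measurable
    also have "\<dots> = (\<integral>\<^sup>+y. ennreal \<bar>H y\<bar> * (\<integral>\<^sup>+x. ennreal (mollifier n (x - y)) \<partial>lborel) \<partial>lborel)"
      by (intro nn_integral_cong) (simp add: ennreal_mult mollifier_nonneg nn_integral_cmult)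
    also have "\<dots> = (\<integral>\<^sup>+x. ennreal \<bar>H x\<bar> \<partial>lborel)" by (simp add: symm)
    finally show ?thesis .
  qed
  have "(\<integral>\<^sup>+x. ennreal \<bar>H x\<bar> \<partial>lborel) < \<infinity>" using H by (simp add: integrable_iff_bounded)
  with * show 1: "integrable lborel (conv H (mollifier n))"
    by (auto simp: integrable_iff_bounded intro: le_less_trans)
  have "ennreal (LBINT x. \<bar>conv H (mollifier n) x\<bar>) \<le> ennreal (LBINT x. \<bar>H x\<bar>)"
    using * 1 H by (simp add: nn_integral_eq_integral)
  then show "(LBINT x. \<bar>conv H (mollifier n) x\<bar>) \<le> (LBINT x. \<bar>H x\<bar>)"
    by (subst (asm) ennreal_le_iff) auto
qed

lemma conv_diff:
  assumes "locally_integrable g" "locally_integrable h" "\<phi> \<in> test_functions UNIV"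
  shows "conv (\<lambda>x. g x - h x) \<phi> x = conv g \<phi> x - conv h \<phi> x"
  unfolding conv_def left_diff_distrib
  by (rule Bochner_Integration.integral_diff) (intro locally_integrable_mult_reflect assms)+

text \<open>For a continuous function of compact support uniform convergence suffices, since
  everything lives on a set of finite measure. The general case follows by density, as the
  contraction property transfers the approximation error to the mollified functions.\<close>

lemma conv_mollifier_L1:
  assumes H: "integrable lborel (H :: 'a::euclidean_space \<Rightarrow> real)"
  shows "(\<lambda>n. LBINT x. \<bar>conv H (mollifier n) x - H x\<bar>) \<longlonglongrightarrow> 0"
proof (rule LIMSEQ_I)
  fix e :: real assume e: "e > 0"
  obtain \<phi> C where \<phi>: "continuous_on UNIV \<phi>" "compact C" "\<And>x. x \<notin> C \<Longrightarrow> \<phi> x = 0" "(LBINT x. \<bar>H x - \<phi> x\<bar>) < e / 4"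
    using integrable_approx_compact_support[OF H, of "e / 4"] e by auto
  define C' where "C' = unit_neighbourhood C"
  have C': "compact C'" unfolding C'_def by (intro compact_unit_neighbourhood \<phi>)
  have [measurable]: "C' \<in> sets borel" using C' by (simp add: borel_compact)
  have \<phi>int: "integrable lborel \<phi>" using \<phi> compact_support_integrable by metis
  define m where "m = measure lborel C' + 1"
  have m: "m > 0" by (simp add: m_def add_nonneg_pos)
  have C'fin: "emeasure lborel C' < \<infinity>" using emeasure_bounded_finite[OF compact_imp_bounded[OF C']] by simp
  have 0: "conv \<phi> (mollifier n) x - \<phi> x = 0" if out: "x \<notin> C'" for n x
  proof -
    have "\<phi> y = 0" if y: "mollifier n (x - y) \<noteq> 0" for y
    proof (rule ccontr)
      assume "\<phi> y \<noteq> 0"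
      then have "y \<in> C" using \<phi> by blast
      moreover have "norm (x - y) \<le> 1" by (rule mollifier_neq_0D(2)[OF y])
      ultimately have "x \<in> C'" unfolding C'_def by (intro in_unit_neighbourhood[of y]) (auto simp: dist_norm)
      then show False using out by simp
    qed
    moreover have "\<phi> x = 0"
    proof (rule ccontr)
      assume "\<phi> x \<noteq> 0"
      then have "x \<in> C" using \<phi> by blast
      then have "x \<in> C'" unfolding C'_def by (intro in_unit_neighbourhood[of x]) (auto simp: dist_norm)
      then show False using out by simp
    qed
    ultimately show ?thesis by (simp add: conv_eq_0)
  qed
  have "\<forall>\<^sub>F n in sequentially. \<forall>x\<in>C'. dist (conv \<phi> (mollifier n) x) (\<phi> x) < e / (4 * m)"
    using uniform_limitD[OF conv_mollifier_uniform_limit[OF \<phi>(1) C'], of "e / (4 * m)"] e m by simp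
  then obtain N where N: "\<And>n x. n \<ge> N \<Longrightarrow> x \<in> C' \<Longrightarrow> \<bar>conv \<phi> (mollifier n) x - \<phi> x\<bar> < e / (4 * m)"
    unfolding eventually_sequentially dist_real_def by blast
  show "\<exists>N. \<forall>n\<ge>N. norm ((LBINT x. \<bar>conv H (mollifier n) x - H x\<bar>) - 0) < e"
  proof (intro exI allI impI)
    fix n assume n: "N \<le> n"
    let ?k = "mollifier n :: 'a \<Rightarrow> real"
    note cint = conv_L1(1)[OF H, of n] conv_L1(1)[OF \<phi>int, of n]
    have cd: "conv (\<lambda>x. H x - \<phi> x) ?k x = conv H ?k x - conv \<phi> ?k x" for x
      by (intro conv_diff integrable_locally_integrable H \<phi>int mollifier_test)
    have 1: "(LBINT x. \<bar>conv H ?k x - conv \<phi> ?k x\<bar>) < e / 4"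
      using conv_L1(2)[OF Bochner_Integration.integrable_diff[OF H \<phi>int], of n] \<phi>(4) by (simp add: cd)
    have "(LBINT x. \<bar>conv \<phi> ?k x - \<phi> x\<bar>) \<le> (LBINT x. e / (4 * m) * indicator C' x)"
    proof (intro integral_mono)
      show "integrable lborel (\<lambda>x. e / (4 * m) * indicator C' x)"
        using C'fin by (intro integrable_mult_right) (simp add: integrable_real_indicator)
      show "integrable lborel (\<lambda>x. \<bar>conv \<phi> ?k x - \<phi> x\<bar>)" using cint \<phi>int by auto
      show "\<bar>conv \<phi> ?k x - \<phi> x\<bar> \<le> e / (4 * m) * indicator C' x" for x
        using N[OF n, of x] 0[of x n] by (cases "x \<in> C'") auto
    qed
    also have "\<dots> = e / (4 * m) * measure lborel C'" by simp
    also have "\<dots> \<le> e / 4"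
      using e m by (simp add: m_def field_simps)
    finally have 2: "(LBINT x. \<bar>conv \<phi> ?k x - \<phi> x\<bar>) \<le> e / 4" .
    have "(LBINT x. \<bar>conv H ?k x - H x\<bar>) \<le>
      (LBINT x. \<bar>conv H ?k x - conv \<phi> ?k x\<bar> + \<bar>conv \<phi> ?k x - \<phi> x\<bar> + \<bar>H x - \<phi> x\<bar>)"
      using cint H \<phi>int by (intro integral_mono) auto
    also have "\<dots> = (LBINT x. \<bar>conv H ?k x - conv \<phi> ?k x\<bar>) + (LBINT x. \<bar>conv \<phi> ?k x - \<phi> x\<bar>) + (LBINT x. \<bar>H x - \<phi> x\<bar>)"
      using cint H \<phi>int by simp
    also have "\<dots> < e" using 1 2 \<phi>(4) e by simp
    finally show "norm ((LBINT x. \<bar>conv H ?k x - H x\<bar>) - 0) < e" by simp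
  qed
qed

section \<open>Friedrichs' commutator estimate\<close>

text \<open>Convolving with the constant 1 gives the constant function with value the integral of
  the test function. Its derivative is zero, and by differentiation under the integral it is also
  the integral of the derivative.\<close>

lemma integral_fderiv_eq_0:
  assumes "\<phi> \<in> test_functions (UNIV :: 'a::euclidean_space set)"
  shows "(LBINT x. frechet_derivative \<phi> (at x) v) = 0"
proof -
  let ?D = "\<lambda>w. frechet_derivative \<phi> (at w) v"
  have li: "locally_integrable (\<lambda>_::'a. 1::real)" by (intro continuous_locally_integrable) simp
  have [measurable]: "\<phi> \<in> borel_measurable borel" "?D \<in> borel_measurable borel"
    using test_functions_smooth[OF assms] by (auto intro!: borel_measurable_continuous_onI smooth_continuous_on smooth_fderiv)
  have "conv (\<lambda>_. 1) \<phi> = (\<lambda>_. LBINT y. \<phi> y)"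
    unfolding conv_def by (auto simp: integral_lborel_reflect)
  then have "((\<lambda>_. LBINT y. \<phi> y) has_derivative (\<lambda>v. conv (\<lambda>_. 1) (\<lambda>w. frechet_derivative \<phi> (at w) v) 0)) (at 0)"
    using conv_has_derivative[OF li assms, of 0] by simp
  from has_derivative_unique[OF this has_derivative_const] have "conv (\<lambda>_. 1) ?D 0 = 0"
    by (simp add: fun_eq_iff)
  then show ?thesis using integral_lborel_reflect[of ?D 0] by (simp add: conv_def)
qed

text \<open>For a divergence free field the derivative along \<open>V\<close> is the divergence of
  \<phi>\<open>V\<close>, a sum of partial derivatives of test functions.\<close>

lemma integral_vderiv_eq_0:
  fixes V :: "'a::euclidean_space \<Rightarrow> 'a"
  assumes \<phi>: "\<phi> \<in> test_functions UNIV" and V: "smooth V" "\<And>x. divergence V x = 0"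
  shows "(LBINT x. vderiv V \<phi> x) = 0"
proof -
  have sV: "smooth (\<lambda>x. V x \<bullet> b)" for b by (rule smooth_inner_left[OF V(1)])
  have dV: "frechet_derivative (\<lambda>x. V x \<bullet> b) (at x) v = frechet_derivative V (at x) v \<bullet> b" for b x v
    using frechet_derivative_at[OF bounded_linear.has_derivative[OF bounded_linear_inner_left smooth_has_derivative[OF V(1), of x]], of b]
    by (simp add: fun_eq_iff)
  have test: "(\<lambda>x. \<phi> x * (V x \<bullet> b)) \<in> test_functions UNIV" for b
    by (rule test_functions_mult[OF \<phi> sV])
  have "vderiv V \<phi> x = (\<Sum>b\<in>Basis. frechet_derivative (\<lambda>x. \<phi> x * (V x \<bullet> b)) (at x) b)" for x
  proof -
    have "(\<Sum>b\<in>Basis. frechet_derivative (\<lambda>x. \<phi> x * (V x \<bullet> b)) (at x) b) = \<phi> x * divergence V x + vderiv V \<phi> x"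
      unfolding fderiv_mult[OF test_functions_smooth[OF \<phi>] sV] dV vderiv_basis_sum[OF test_functions_smooth[OF \<phi>]]
      by (simp add: sum.distrib divergence_def sum_distrib_left mult.commute)
    then show ?thesis using V(2) by simp
  qed
  then show ?thesis
    using integral_fderiv_eq_0[OF test] test_functions_integrable[OF test_functions_fderiv[OF test]]
    by (simp add: Bochner_Integration.integral_sum)
qed

text \<open>By linearity the kernel splits into a derivative in the constant direction
  \<open>V x\<close> and a derivative along \<open>V\<close> of the reflected test function in
  \<open>y\<close>. Both integrate to zero; the second one uses the vanishing divergence.\<close>

lemma integral_commutator_kernel_eq_0:
  fixes V :: "'a::euclidean_space \<Rightarrow> 'a"
  assumes \<phi>: "\<phi> \<in> test_functions UNIV" and V: "smooth V" "\<And>x. divergence V x = 0"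
  shows "integrable lborel (\<lambda>y. frechet_derivative \<phi> (at (x - y)) (V x - V y))"
    "(LBINT y. frechet_derivative \<phi> (at (x - y)) (V x - V y)) = 0"
proof -
  let ?D = "\<lambda>w v. frechet_derivative \<phi> (at w) v"
  have lin: "linear (?D w)" for w
    by (simp add: linear_frechet_derivative smooth_differentiable test_functions_smooth[OF \<phi>])
  have eq: "?D (x - y) (V x - V y) = ?D (x - y) (V x) + vderiv V (\<lambda>y. \<phi> (x - y)) y" for y
    by (simp add: linear_diff[OF lin] vderiv_def fderiv_reflect[OF test_functions_smooth[OF \<phi>]])
  have i1: "integrable lborel (\<lambda>y. ?D (x - y) (V x))"
    by (intro integrable_lborel_reflect[of "\<lambda>w. ?D w (V x)"] test_functions_integrable[OF test_functions_fderiv[OF \<phi>]])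
  have i2: "integrable lborel (vderiv V (\<lambda>y. \<phi> (x - y)))"
    by (rule test_functions_integrable[OF test_functions_vderiv[OF test_functions_reflect[OF \<phi>] V(1)]])
  have [measurable]: "(\<lambda>w. ?D w (V x)) \<in> borel_measurable borel"
    by (intro borel_measurable_continuous_onI smooth_continuous_on smooth_fderiv test_functions_smooth[OF \<phi>])
  show "integrable lborel (\<lambda>y. ?D (x - y) (V x - V y))" unfolding eq using i1 i2 by auto
  show "(LBINT y. ?D (x - y) (V x - V y)) = 0"
    unfolding eq Bochner_Integration.integral_add[OF i1 i2]
    using integral_lborel_reflect[of "\<lambda>w. ?D w (V x)" x] integral_fderiv_eq_0[OF \<phi>, of "V x"]
      integral_vderiv_eq_0[OF test_functions_reflect[OF \<phi>] V] by simp
qed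

lemma smooth_lipschitz_on_cball:
  fixes V :: "'a::euclidean_space \<Rightarrow> 'a"
  assumes "smooth V"
  obtains L where "0 \<le> L" "\<And>x y. x \<in> cball 0 R \<Longrightarrow> y \<in> cball 0 R \<Longrightarrow> norm (V x - V y) \<le> L * norm (x - y)"
proof -
  let ?D = "\<lambda>x. frechet_derivative V (at x)"
  have "\<exists>m. 0 \<le> m \<and> (\<forall>x\<in>cball 0 R. norm (?D x b) \<le> m)" for b
  proof -
    have "bounded ((\<lambda>x. ?D x b) ` cball 0 R)"
      by (intro compact_imp_bounded compact_continuous_image smooth_continuous_on smooth_fderiv assms) auto
    then obtain m where "\<forall>x\<in>cball 0 R. norm (?D x b) \<le> m" by (auto simp: bounded_iff)
    then show ?thesis by (intro exI[of _ "\<bar>m\<bar>"]) force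
  qed
  then obtain m where m: "\<And>b. 0 \<le> m b" "\<And>b x. x \<in> cball 0 R \<Longrightarrow> norm (?D x b) \<le> m b" by metis
  define L where "L = (\<Sum>b\<in>(Basis::'a set). m b)"
  show ?thesis
  proof (rule that[of L])
    show "0 \<le> L" unfolding L_def by (simp add: m sum_nonneg)
    fix x y :: 'a assume "x \<in> cball 0 R" "y \<in> cball 0 R"
    have "onorm (?D x) \<le> L" if x: "x \<in> cball 0 R" for x
    proof (rule onorm_le)
      fix v
      have "norm (?D x v) = norm (\<Sum>b\<in>Basis. (v \<bullet> b) *\<^sub>R ?D x b)"
        using fderiv_basis_sum[OF smooth_differentiable[OF assms]] by metis
      also have "\<dots> \<le> (\<Sum>b\<in>Basis. norm v * m b)"
        by (rule order.trans[OF norm_sum]) (auto intro!: sum_mono mult_mono m Basis_le_norm x)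
      finally show "norm (?D x v) \<le> L * norm v" by (simp add: L_def sum_distrib_left mult.commute)
    qed
    then show "norm (V x - V y) \<le> L * norm (x - y)"
      using \<open>x \<in> cball 0 R\<close> \<open>y \<in> cball 0 R\<close>
      by (intro differentiable_bound[of "cball 0 R" V ?D])
        (auto intro: has_derivative_at_withinI smooth_has_derivative assms)
  qed
qed

text \<open>Friedrichs' commutator: the derivative along \<open>V\<close> of the mollified function differs from
  the mollified derivative by an integral in which, \<open>V\<close> being divergence free, a constant can be
  subtracted from \<open>g\<close>; only the oscillation of \<open>g\<close> then enters.\<close>

definition commutator :: "('a::euclidean_space \<Rightarrow> 'a) \<Rightarrow> ('a \<Rightarrow> real) \<Rightarrow> ('a \<Rightarrow> real) \<Rightarrow> 'a \<Rightarrow> real" where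
  "commutator V g \<phi> x = (LBINT y. (g y - g x) * frechet_derivative \<phi> (at (x - y)) (V x - V y))"

text \<open>The derivative of the kernel in direction \<open>V y\<close> is, up to sign, the
  derivative along \<open>V\<close> of the test function \<open>y \<mapsto> \<phi> (x - y)\<close>.
  Testing the weak derivative of \<open>g\<close> against it produces \<open>conv G \<phi>\<close>;
  replacing \<open>V x\<close> by \<open>V y\<close> leaves the commutator.\<close>

lemma vderiv_conv:
  fixes V :: "'a::euclidean_space \<Rightarrow> 'a"
  assumes D: "has_distr_deriv V g G" and \<phi>: "\<phi> \<in> test_functions UNIV"
    and V: "smooth V" "\<And>x. divergence V x = 0"
  shows "vderiv V (conv g \<phi>) x = conv G \<phi> x + commutator V g \<phi> x"
proof -
  let ?D = "\<lambda>w v. frechet_derivative \<phi> (at w) v"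
  have g: "locally_integrable g" using D by (simp add: has_distr_deriv_def)
  have lin: "linear (?D w)" for w
    by (simp add: linear_frechet_derivative smooth_differentiable test_functions_smooth[OF \<phi>])
  have vd: "vderiv V (\<lambda>y. \<phi> (x - y)) y = - ?D (x - y) (V y)" for y
    by (simp add: vderiv_def fderiv_reflect[OF test_functions_smooth[OF \<phi>]])
  note test = test_functions_reflect[OF \<phi>, of x]
  have i1: "integrable lborel (\<lambda>y. g y * ?D (x - y) (V x))"
    by (rule locally_integrable_mult_reflect[OF g test_functions_fderiv[OF \<phi>]])
  have i2: "integrable lborel (\<lambda>y. g y * ?D (x - y) (V y))"
    using locally_integrable_mult_test[OF g test_functions_uminus[OF test_functions_vderiv[OF test V(1)]]]
    by (simp add: vd)
  have i3: "integrable lborel (\<lambda>y. g x * ?D (x - y) (V x - V y))"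
    by (intro integrable_mult_right integral_commutator_kernel_eq_0 \<phi> V)
  have "(LBINT y. g y * ?D (x - y) (V y)) = conv G \<phi> x"
  proof -
    have "(LBINT y. g y * formal_adjoint V (\<lambda>y. \<phi> (x - y)) y) = (LBINT y. G y * \<phi> (x - y))"
      using D test unfolding has_distr_deriv_def by blast
    then show ?thesis by (simp add: formal_adjoint_divfree[OF V(2)] vd conv_def)
  qed
  moreover have "(g y - g x) * ?D (x - y) (V x - V y) =
      g y * ?D (x - y) (V x) - g y * ?D (x - y) (V y) - g x * ?D (x - y) (V x - V y)" for y
    by (simp add: linear_diff[OF lin] algebra_simps)
  then have "commutator V g \<phi> x = (LBINT y. g y * ?D (x - y) (V x)) - (LBINT y. g y * ?D (x - y) (V y))"
    unfolding commutator_def using i1 i2 i3 integral_commutator_kernel_eq_0(2)[OF \<phi> V] by simp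
  ultimately show ?thesis by (simp add: conv_vderiv[OF g \<phi>] conv_def)
qed

text \<open>The kernel has size \<open>N ^ (DIM('a) + 1)\<close> times
  \<open>norm (V x - V y)\<close>, and the latter is at most a constant over \<open>N\<close> on the
  support, whose volume is of order \<open>N ^ (- DIM('a))\<close>. The kernel is thus bounded in L1
  uniformly in \<open>N\<close>, and the oscillation of \<open>g\<close> supplies the
  smallness.\<close>

lemma commutator_uniform_limit:
  fixes V :: "'a::euclidean_space \<Rightarrow> 'a"
  assumes g: "continuous_on UNIV g" and V: "smooth V" "\<And>x. divergence V x = 0" and A: "compact A"
  shows "uniform_limit A (\<lambda>n. commutator V g (mollifier n)) (\<lambda>_. 0) sequentially"
proof (rule uniform_limitI)
  fix e :: real assume e: "e > 0"
  obtain C where C: "0 \<le> C" "\<And>n w v. \<bar>frechet_derivative (mollifier n :: 'a \<Rightarrow> real) (at w) v\<bar>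
       \<le> C * real (Suc n) ^ Suc DIM('a) * norm v"
    by (rule mollifier_fderiv_bound) blast
  obtain R where R: "A \<subseteq> cball 0 R"
    using compact_imp_bounded[OF A] unfolding bounded_iff subset_iff mem_cball_0 by blast
  obtain L where L: "0 \<le> L" "\<And>x y. x \<in> cball 0 (R+1) \<Longrightarrow> y \<in> cball 0 (R+1) \<Longrightarrow> norm (V x - V y) \<le> L * norm (x - y)"
    by (rule smooth_lipschitz_on_cball[OF V(1)]) blast
  \<comment> \<open>The bound for the L1 norm of the kernel; the added 1 makes it positive and the
    final inequality strict.\<close>
  define B where "B = C * L * unit_ball_vol (real DIM('a)) + 1"
  have B: "B > 0" unfolding B_def using C L by (intro add_nonneg_pos mult_nonneg_nonneg) auto
  have "\<forall>\<^sub>F n in sequentially. \<forall>x\<in>A. \<forall>y. norm (x - y) < inverse (real (Suc n)) \<longrightarrow> \<bar>g y - g x\<bar> < e / B"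
    using e B by (intro continuous_osc g A) simp
  then show "\<forall>\<^sub>F n in sequentially. \<forall>x\<in>A. dist (commutator V g (mollifier n) x) 0 < e"
  proof eventually_elim
    case (elim n)
    show ?case
    proof
      fix x assume x: "x \<in> A"
      define N where "N = real (Suc n)"
      have N: "N \<ge> 1" by (simp add: N_def)
      let ?D = "\<lambda>w v. frechet_derivative (mollifier n) (at w) v"
      define c where "c = (e / B) * (C * L * N ^ DIM('a))"
      have c: "c \<ge> 0" unfolding c_def using e B C L N by simp
      have "\<bar>commutator V g (mollifier n) x\<bar> \<le> (LBINT y. c * indicator (ball x (inverse N)) y)"
        unfolding commutator_def
      proof (rule integral_abs_bound_integral)
        let ?F = "\<lambda>y. (g y - g x) * ?D (x - y) (V x - V y)"
        have le: "\<bar>?F y\<bar> \<le> c * indicator (ball x (inverse N)) y" for y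
        proof (cases "norm (x - y) < inverse N")
          case True
          have "inverse N \<le> 1" using N by (simp add: inverse_le_1_iff)
          then have "x \<in> cball 0 (R + 1)" "y \<in> cball 0 (R + 1)"
            using x R True norm_triangle_sub[of y x] by (auto simp: norm_minus_commute subset_iff intro: order.trans)
          then have "norm (V x - V y) \<le> L * norm (x - y)" by (rule L(2))
          also have "\<dots> \<le> L * inverse N" using True L by (intro mult_left_mono) auto
          finally have "C * N ^ Suc DIM('a) * norm (V x - V y) \<le> C * N ^ Suc DIM('a) * (L * inverse N)"
            using C N by (intro mult_left_mono) auto
          also have "\<dots> = C * L * N ^ DIM('a)" using N by simp
          finally have "\<bar>?D (x - y) (V x - V y)\<bar> \<le> C * L * N ^ DIM('a)"
            using C(2)[of n "x - y" "V x - V y"] unfolding N_def by linarith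
          moreover have "\<bar>g y - g x\<bar> \<le> e / B"
            using elim x True by (auto simp: N_def intro: less_imp_le)
          ultimately have "\<bar>?F y\<bar> \<le> c"
            unfolding c_def abs_mult using e B by (intro mult_mono) auto
          then show ?thesis using True by (simp add: dist_norm)
        next
          case False
          have "frechet_derivative (mollifier n) (at (x - y)) v = 0" for v :: 'a
          proof -
            have "mollifier n (x - y) = 0" using False by (intro mollifier_eq_0) (simp add: N_def)
            \<comment> \<open>A nonnegative function has a minimum where it vanishes. This also
              covers the sphere bounding the support, where the function is not locally
              zero.\<close>
            then have "frechet_derivative (mollifier n) (at (x - y)) = (\<lambda>v. 0)"
              by (intro differential_zero_maxmin[of "x - y" UNIV "mollifier n"] smooth_has_derivative
                  test_functions_smooth[OF mollifier_test]) (auto simp: mollifier_nonneg)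
            then show ?thesis by simp
          qed
          then show ?thesis using c by simp
        qed
        have m1: "?F \<in> borel_measurable lborel"
          using integral_commutator_kernel_eq_0(1)[OF mollifier_test V, of n x] borel_measurable_continuous_onI[OF g]
          by (intro borel_measurable_times borel_measurable_diff) auto
        show int: "integrable lborel (\<lambda>y. c * indicator (ball x (inverse N)) y)"
          by (intro integrable_mult_right integrable_real_indicator emeasure_bounded_finite bounded_ball) simp
        show "integrable lborel ?F"
          by (rule Bochner_Integration.integrable_bound[OF int m1]) (use le c in auto)
        show "\<bar>?F y\<bar> \<le> c * indicator (ball x (inverse N)) y" for y by (rule le)
      qed
      also have "\<dots> = c * (unit_ball_vol (real DIM('a)) * inverse N ^ DIM('a))"
        using N by (simp add: content_ball)
      also have "\<dots> = e / B * (C * L * unit_ball_vol (real DIM('a)))"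
        using N by (simp add: c_def power_inverse)
      also have "\<dots> < e / B * B"
        unfolding B_def[symmetric] using e B by (intro mult_strict_left_mono) (auto simp: B_def)
      finally show "dist (commutator V g (mollifier n) x) 0 < e" using B by simp
    qed
  qed
qed

section \<open>Calculus of distributional derivatives\<close>

lemma tendsto_integral_uniform_limit:
  fixes h :: "'a::euclidean_space \<Rightarrow> real"
  assumes h: "integrable lborel h" "\<And>x. x \<notin> A \<Longrightarrow> h x = 0"
    and u: "uniform_limit A u u' sequentially"
    and int: "\<And>n. integrable lborel (\<lambda>x. h x * u n x)" "integrable lborel (\<lambda>x. h x * u' x)"
  shows "(\<lambda>n. LBINT x. h x * u n x) \<longlonglongrightarrow> (LBINT x. h x * u' x)"
proof (rule LIMSEQ_I)
  fix e :: real assume e: "e > 0"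
  define m where "m = (LBINT x. \<bar>h x\<bar>) + 1"
  have m: "m > 0" unfolding m_def by (intro add_nonneg_pos) auto
  have "\<forall>\<^sub>F n in sequentially. \<forall>x\<in>A. dist (u n x) (u' x) < e / m"
    using uniform_limitD[OF u, of "e / m"] e m by simp
  then obtain N where N: "\<And>n x. n \<ge> N \<Longrightarrow> x \<in> A \<Longrightarrow> \<bar>u n x - u' x\<bar> < e / m"
    unfolding eventually_sequentially dist_real_def by blast
  show "\<exists>N. \<forall>n\<ge>N. norm ((LBINT x. h x * u n x) - (LBINT x. h x * u' x)) < e"
  proof (intro exI allI impI)
    fix n assume n: "N \<le> n"
    have "\<bar>(LBINT x. h x * u n x - h x * u' x)\<bar> \<le> (LBINT x. e / m * \<bar>h x\<bar>)"
    proof (rule integral_abs_bound_integral)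
      fix x
      show "\<bar>h x * u n x - h x * u' x\<bar> \<le> e / m * \<bar>h x\<bar>"
      proof (cases "x \<in> A")
        case True
        have "\<bar>h x\<bar> * \<bar>u n x - u' x\<bar> \<le> \<bar>h x\<bar> * (e / m)"
          using N[OF n True] by (intro mult_left_mono) auto
        then show ?thesis by (simp add: abs_mult[symmetric] right_diff_distrib mult.commute)
      qed (simp add: h)
    qed (use h int in auto)
    also have "\<dots> = e / m * (LBINT x. \<bar>h x\<bar>)" by simp
    also have "\<dots> < e / m * m" using e m by (intro mult_strict_left_mono) (auto simp: m_def)
    also have "\<dots> = e" using m by simp
    finally show "norm ((LBINT x. h x * u n x) - (LBINT x. h x * u' x)) < e"
      using int by simp
  qed
qed

text \<open>On the compact support of \<open>h\<close> the mollification sees only the values of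
  \<open>G\<close> in a unit neighbourhood, so \<open>G\<close> may be cut off there and becomes
  integrable. A bound on \<open>h\<close> almost everywhere then suffices, which admits weak
  derivatives in the place of \<open>h\<close>.\<close>

lemma tendsto_integral_conv:
  fixes h G :: "'a::euclidean_space \<Rightarrow> real"
  assumes h: "h \<in> borel_measurable borel" "AE x in lborel. \<bar>h x\<bar> \<le> M" "\<And>x. x \<notin> A \<Longrightarrow> h x = 0" "compact A"
    and G: "locally_integrable G"
  shows "(\<lambda>n. LBINT x. h x * conv G (mollifier n) x) \<longlonglongrightarrow> (LBINT x. h x * G x)"
proof -
  define A' where "A' = unit_neighbourhood A"
  have A': "compact A'" unfolding A'_def by (intro compact_unit_neighbourhood h)
  have [measurable]: "A' \<in> sets borel" "h \<in> borel_measurable borel" using A' h by (auto simp: borel_compact)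
  define H where "H x = indicator A' x * G x" for x
  have H: "integrable lborel H"
    using G A' by (simp add: H_def[abs_def] locally_integrable_def set_integrable_def)
  have [measurable]: "H \<in> borel_measurable borel" using H by auto
  have hG: "h x * G x = h x * H x" for x
  proof (cases "x \<in> A")
    case True
    then have "x \<in> A'" unfolding A'_def by (intro in_unit_neighbourhood[of x]) auto
    then show ?thesis by (simp add: H_def)
  qed (simp add: h)
  have hc: "h x * conv G (mollifier n) x = h x * conv H (mollifier n) x" for x n
  proof (cases "x \<in> A")
    case True
    have "G y = H y" if y: "mollifier n (x - y) \<noteq> 0" for y
    proof -
      have "norm (y - x) \<le> 1" using mollifier_neq_0D(2)[OF y] by (simp add: norm_minus_commute)
      then have "y \<in> A'" unfolding A'_def by (intro in_unit_neighbourhood[OF True])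
      then show ?thesis by (simp add: H_def)
    qed
    then show ?thesis by (simp add: conv_cong[of "mollifier n" x G H])
  qed (simp add: h)
  have M: "integrable lborel (\<lambda>x. h x * u x)" if "integrable lborel u" for u
  proof (rule Bochner_Integration.integrable_bound[of _ "\<lambda>x. M * u x"])
    show "integrable lborel (\<lambda>x. M * u x)" using that by simp
    show "(\<lambda>x. h x * u x) \<in> borel_measurable lborel" using that by auto
    show "AE x in lborel. norm (h x * u x) \<le> norm (M * u x)"
      using h(2) by eventually_elim (auto simp: abs_mult intro!: mult_right_mono)
  qed
  note ci = conv_L1(1)[OF H]
  have "(\<lambda>n. (LBINT x. h x * conv H (mollifier n) x) - (LBINT x. h x * H x)) \<longlonglongrightarrow> 0"
  proof (rule tendsto_rabs_zero_cancel, rule tendsto_sandwich[of "\<lambda>_. 0"])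
    show "\<forall>\<^sub>F n in sequentially. \<bar>(LBINT x. h x * conv H (mollifier n) x) - (LBINT x. h x * H x)\<bar>
        \<le> M * (LBINT x. \<bar>conv H (mollifier n) x - H x\<bar>)"
    proof (rule always_eventually, rule allI)
      fix n
      have "\<bar>(LBINT x. h x * conv H (mollifier n) x) - (LBINT x. h x * H x)\<bar>
          = \<bar>LBINT x. h x * (conv H (mollifier n) x - H x)\<bar>"
        using M[OF ci, of n] M[OF H] by (simp add: right_diff_distrib)
      also have "\<dots> \<le> (LBINT x. \<bar>h x * (conv H (mollifier n) x - H x)\<bar>)"
        by (rule integral_abs_bound)
      also have "\<dots> \<le> (LBINT x. M * \<bar>conv H (mollifier n) x - H x\<bar>)"
      proof (rule integral_mono_AE)
        show "integrable lborel (\<lambda>x. \<bar>h x * (conv H (mollifier n) x - H x)\<bar>)"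
          using M[of "\<lambda>x. conv H (mollifier n) x - H x"] ci H by simp
        show "AE x in lborel. \<bar>h x * (conv H (mollifier n) x - H x)\<bar> \<le> M * \<bar>conv H (mollifier n) x - H x\<bar>"
          using h(2) by eventually_elim (simp add: abs_mult mult_right_mono)
      qed (use ci H in auto)
      finally show "\<bar>(LBINT x. h x * conv H (mollifier n) x) - (LBINT x. h x * H x)\<bar>
        \<le> M * (LBINT x. \<bar>conv H (mollifier n) x - H x\<bar>)" by simp
    qed
    show "(\<lambda>n. M * (LBINT x. \<bar>conv H (mollifier n) x - H x\<bar>)) \<longlonglongrightarrow> 0"
      by (rule tendsto_mult_right_zero[OF conv_mollifier_L1[OF H]])
  qed auto
  then show ?thesis unfolding hc hG by (simp add: LIM_zero_iff)
qed

section \<open>Uniqueness of weak derivatives\<close>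

lemma integrable_AE_eq_0:
  fixes H :: "'a::euclidean_space \<Rightarrow> real"
  assumes H: "integrable lborel H" "\<And>n x. conv H (mollifier n) x = 0"
  shows "AE x in lborel. H x = 0"
proof -
  have "(\<lambda>n::nat. LBINT x. \<bar>H x\<bar>) \<longlonglongrightarrow> 0"
    using conv_mollifier_L1[OF H(1)] by (simp add: H(2))
  then have "(LBINT x. \<bar>H x\<bar>) = 0" by (simp add: LIMSEQ_const_iff)
  then show ?thesis
    using integral_nonneg_eq_0_iff_AE[of lborel "\<lambda>x. \<bar>H x\<bar>"] H(1) by auto
qed

text \<open>The fundamental lemma of the calculus of variations. After multiplication by a dilated
  bump the function is integrable, and each value of its mollification is a pairing of
  \<open>h\<close> with a test function, hence zero. The bumps are positive on balls that exhaust
  the space.\<close>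

lemma locally_integrable_AE_eq_0:
  fixes h :: "'a::euclidean_space \<Rightarrow> real"
  assumes h: "locally_integrable h" "\<And>\<phi>. \<phi> \<in> test_functions UNIV \<Longrightarrow> (LBINT x. h x * \<phi> x) = 0"
  shows "AE x in lborel. h x = 0"
proof -
  have "AE x in lborel. h x * bump (inverse (real (Suc k)) *\<^sub>R x) = 0" for k
  proof (rule integrable_AE_eq_0)
    let ?\<phi> = "\<lambda>x. bump (inverse (real (Suc k)) *\<^sub>R (x::'a))"
    have "Ck m (\<lambda>x. bump (inverse (real (Suc k)) *\<^sub>R (x::'a) + 0))" for m
      by (rule Ck_affine[OF smooth_Ck[OF smooth_bump]])
    then have "smooth ?\<phi>" by (simp add: smooth_def)
    moreover have "?\<phi> x = 0" if "x \<notin> cball 0 (real (Suc k))" for x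
    proof -
      have "1 \<le> norm (inverse (real (Suc k)) *\<^sub>R x)"
        using that by (simp add: field_simps del: of_nat_Suc)
      then show ?thesis by (rule bump_eq_0)
    qed
    ultimately have test: "?\<phi> \<in> test_functions UNIV"
      by (intro test_functionsI[of _ "cball 0 (real (Suc k))"]) auto
    show "integrable lborel (\<lambda>x. h x * ?\<phi> x)" by (rule locally_integrable_mult_test[OF h(1) test])
    fix n x
    have "(\<lambda>y. mollifier n (x - y) * ?\<phi> y) \<in> test_functions UNIV"
      by (intro test_functions_mult test_functions_reflect mollifier_test test_functions_smooth[OF test])
    from h(2)[OF this] show "conv (\<lambda>x. h x * ?\<phi> x) (mollifier n) x = 0"
      by (simp add: conv_def mult_ac)
  qed
  then have "AE x in lborel. \<forall>k. h x * bump (inverse (real (Suc k)) *\<^sub>R x) = 0"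
    by (subst AE_all_countable) (rule allI)
  then show ?thesis
  proof eventually_elim
    case (elim x)
    obtain k where "norm x < real (Suc k)"
      using reals_Archimedean2 by (metis less_Suc_eq of_nat_less_iff order.strict_trans)
    then have "norm (inverse (real (Suc k)) *\<^sub>R x) < 1" by (simp add: field_simps del: of_nat_Suc)
    then show ?case using elim[rule_format, of k] bump_pos by fastforce
  qed
qed

lemma has_distr_deriv_unique:
  assumes "has_distr_deriv V f g" "has_distr_deriv V f h"
  shows "AE x in lborel. g x = h x"
proof -
  have li: "locally_integrable g" "locally_integrable h" using assms by (auto simp: has_distr_deriv_def)
  have "AE x in lborel. g x - h x = 0"
  proof (rule locally_integrable_AE_eq_0)
    show "locally_integrable (\<lambda>x. g x - h x)"
      using li unfolding locally_integrable_def set_integrable_def by (auto simp: right_diff_distrib)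
    fix \<phi> :: "'a \<Rightarrow> real" assume \<phi>: "\<phi> \<in> test_functions UNIV"
    then have "(LBINT x. g x * \<phi> x) = (LBINT x. h x * \<phi> x)"
      using assms unfolding has_distr_deriv_def by metis
    then show "(LBINT x. (g x - h x) * \<phi> x) = 0"
      using locally_integrable_mult_test[OF li(1) \<phi>] locally_integrable_mult_test[OF li(2) \<phi>]
      by (simp add: left_diff_distrib)
  qed
  then show ?thesis by eventually_elim simp
qed

lemma has_distr_deriv_distr_deriv: "has_distr_deriv V f g \<Longrightarrow> has_distr_deriv V f (distr_deriv V f)"
  unfolding distr_deriv_def by (rule someI[of "has_distr_deriv V f"])

section \<open>The product rule for weak derivatives\<close>

lemma locally_integrable_mult_continuous:
  assumes "locally_integrable g" "continuous_on UNIV u"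
  shows "locally_integrable (\<lambda>x. g x * u x)"
  unfolding locally_integrable_def
proof (intro conjI allI impI)
  have [measurable]: "g \<in> borel_measurable borel" "u \<in> borel_measurable borel"
    using assms by (auto simp: locally_integrable_def borel_measurable_continuous_onI)
  show "(\<lambda>x. g x * u x) \<in> borel_measurable borel" by measurable
  fix K :: "'a set" assume K: "compact K"
  then have [measurable]: "K \<in> sets borel" by (simp add: borel_compact)
  obtain M where M: "\<And>x. x \<in> K \<Longrightarrow> \<bar>u x\<bar> \<le> M"
    by (rule continuous_bounded_on_compact[OF assms(2) K]) blast
  have "set_integrable lborel K g" using K assms(1) by (simp add: locally_integrable_def)
  then have "integrable lborel (\<lambda>x. M * (indicator K x *\<^sub>R g x))"
    unfolding set_integrable_def by (rule integrable_mult_right)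
  then show "set_integrable lborel K (\<lambda>x. g x * u x)"
    unfolding set_integrable_def
  proof (rule Bochner_Integration.integrable_bound)
    have "norm (indicator K x *\<^sub>R (g x * u x)) \<le> norm (M * (indicator K x *\<^sub>R g x))" for x
    proof (cases "x \<in> K")
      case True
      have "\<bar>g x\<bar> * \<bar>u x\<bar> \<le> \<bar>g x\<bar> * \<bar>M\<bar>" using M[OF True] by (intro mult_left_mono) auto
      then show ?thesis using True by (simp add: abs_mult mult.commute)
    qed simp
    then show "AE x in lborel. norm (indicator K x *\<^sub>R (g x * u x)) \<le> norm (M * (indicator K x *\<^sub>R g x))" by simp
  qed auto
qed

lemma locally_integrable_mult_test_continuous:
  assumes "locally_integrable g" "\<phi> \<in> test_functions U" "continuous_on UNIV u"
  shows "integrable lborel (\<lambda>x. g x * \<phi> x * u x)"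
  using locally_integrable_mult_test[OF locally_integrable_mult_continuous[OF assms(1,3)] assms(2)]
  by (simp add: mult_ac)

lemma locally_integrable_add:
  "locally_integrable f \<Longrightarrow> locally_integrable g \<Longrightarrow> locally_integrable (\<lambda>x. f x + g x)"
  unfolding locally_integrable_def set_integrable_def by (auto simp: distrib_left)

lemma has_distr_derivD:
  assumes "has_distr_deriv V f F" "\<phi> \<in> test_functions UNIV" "\<And>x. divergence V x = 0"
  shows "(LBINT x. f x * vderiv V \<phi> x) = - (LBINT x. F x * \<phi> x)"
proof -
  have "(LBINT x. f x * formal_adjoint V \<phi> x) = (LBINT x. F x * \<phi> x)"
    using assms unfolding has_distr_deriv_def by blast
  then show ?thesis by (simp add: formal_adjoint_divfree[OF assms(3)])
qed

lemma vderiv_mult: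
  "smooth \<phi> \<Longrightarrow> smooth \<psi> \<Longrightarrow> vderiv V (\<lambda>x. \<phi> x * \<psi> x) x = \<phi> x * vderiv V \<psi> x + vderiv V \<phi> x * \<psi> x"
  by (simp add: vderiv_def fderiv_mult)

lemma vderiv_uminus: "smooth \<phi> \<Longrightarrow> vderiv V (\<lambda>x. - \<phi> x) x = - vderiv V \<phi> x"
  using frechet_derivative_at[OF has_derivative_minus[OF smooth_has_derivative[of \<phi> x]]]
  by (simp add: vderiv_def fun_eq_iff)

lemma commutator_continuous:
  assumes "has_distr_deriv V g G" "smooth V" "\<And>x. divergence V x = 0" "\<phi> \<in> test_functions UNIV"
  shows "continuous_on UNIV (commutator V g \<phi>)"
proof -
  have li: "locally_integrable g" "locally_integrable G" using assms by (auto simp: has_distr_deriv_def)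
  have "commutator V g \<phi> = (\<lambda>x. vderiv V (conv g \<phi>) x - conv G \<phi> x)"
    using vderiv_conv[OF assms(1,4,2,3)] by (intro ext) simp
  moreover have "continuous_on UNIV (\<lambda>x. vderiv V (conv g \<phi>) x - conv G \<phi> x)"
    by (intro continuous_on_diff smooth_continuous_on smooth_vderiv conv_smooth li assms)
  ultimately show ?thesis by simp
qed

text \<open>Only \<open>g\<close> is mollified: the product of the test function with the smooth
  \<open>g_n\<close> is again a test function and may be used against \<open>f\<close>. Expanding by
  the classical product rule gives terms with \<open>g_n\<close>, the mollified \<open>G\<close> and
  the commutator, which converge uniformly, in L1 and to zero respectively.\<close>

lemma has_distr_deriv_mult:
  fixes f g :: "'a::euclidean_space \<Rightarrow> real"
  assumes f: "has_distr_deriv V f F" "continuous_on UNIV f"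
    and g: "has_distr_deriv V g G" "continuous_on UNIV g"
    and V: "smooth V" "\<And>x. divergence V x = 0"
  shows "has_distr_deriv V (\<lambda>x. f x * g x) (\<lambda>x. F x * g x + G x * f x)"
  unfolding has_distr_deriv_def
proof (intro conjI ballI)
  have li: "locally_integrable F" "locally_integrable G" "locally_integrable g" "locally_integrable f"
    using f g by (auto simp: has_distr_deriv_def)
  show "locally_integrable (\<lambda>x. f x * g x)"
    using f g by (intro continuous_locally_integrable continuous_on_mult)
  show "locally_integrable (\<lambda>x. F x * g x + G x * f x)"
    by (intro locally_integrable_add locally_integrable_mult_continuous li f g)
  fix \<phi> :: "'a \<Rightarrow> real" assume \<phi>: "\<phi> \<in> test_functions UNIV"
  obtain A where A: "smooth \<phi>" "compact A" "\<And>x. x \<notin> A \<Longrightarrow> \<phi> x = 0"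
    by (rule test_functionsE[OF \<phi>]) blast
  have v0: "vderiv V \<phi> x = 0" if "x \<notin> A" for x
    unfolding vderiv_def by (rule fderiv_eq_0_outside[OF compact_imp_closed[OF A(2)]]) (use A that in auto)
  note vt = test_functions_vderiv[OF \<phi> V(1)]
  define gn where "gn n = conv g (mollifier n)" for n
  define R where "R n = commutator V g (mollifier n)" for n
  have sgn: "smooth (gn n)" for n unfolding gn_def by (rule conv_smooth[OF li(3) mollifier_test])
  have vgn: "vderiv V (gn n) x = conv G (mollifier n) x + R n x" for n x
    unfolding gn_def R_def by (rule vderiv_conv[OF g(1) mollifier_test V])
  have ug: "uniform_limit A gn g sequentially"
    unfolding gn_def[abs_def] by (rule conv_mollifier_uniform_limit[OF g(2) A(2)])
  have uR: "uniform_limit A R (\<lambda>_. 0) sequentially"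
    unfolding R_def[abs_def] by (rule commutator_uniform_limit[OF g(2) V A(2)])
  have cR: "continuous_on UNIV (R n)" for n
    unfolding R_def by (rule commutator_continuous[OF g(1) V mollifier_test])
  have cG: "continuous_on UNIV (conv G (mollifier n))" for n
    by (intro smooth_continuous_on conv_smooth li mollifier_test)
  note int = locally_integrable_mult_test_continuous
  have eqn: "(LBINT x. f x * vderiv V \<phi> x * gn n x) + (LBINT x. f x * \<phi> x * conv G (mollifier n) x)
      + (LBINT x. f x * \<phi> x * R n x) = - (LBINT x. F x * \<phi> x * gn n x)" for n
  proof -
    have "(LBINT x. f x * vderiv V (\<lambda>x. \<phi> x * gn n x) x) = - (LBINT x. F x * (\<phi> x * gn n x))"
      by (rule has_distr_derivD[OF f(1) test_functions_mult[OF \<phi> sgn] V(2)])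
    moreover have "f x * vderiv V (\<lambda>x. \<phi> x * gn n x) x =
       f x * vderiv V \<phi> x * gn n x + f x * \<phi> x * conv G (mollifier n) x + f x * \<phi> x * R n x" for x
      by (simp add: vderiv_mult[OF A(1) sgn] vgn algebra_simps)
    ultimately show ?thesis
      using int[OF li(4) vt smooth_continuous_on[OF sgn], of n] int[OF li(4) \<phi> cG, of n] int[OF li(4) \<phi> cR, of n]
      by (simp add: mult.assoc)
  qed
  obtain M where M: "\<And>x. \<bar>f x * \<phi> x\<bar> \<le> M"
    by (rule compact_support_bounded[of "\<lambda>x. f x * \<phi> x" A])
      (use A in \<open>auto intro!: continuous_on_mult f smooth_continuous_on[OF A(1)]\<close>)
  have [measurable]: "f \<in> borel_measurable borel" "\<phi> \<in> borel_measurable borel"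
    using f A by (auto intro!: borel_measurable_continuous_onI smooth_continuous_on)
  have L1: "(\<lambda>n. LBINT x. f x * vderiv V \<phi> x * gn n x) \<longlonglongrightarrow> (LBINT x. f x * vderiv V \<phi> x * g x)"
    by (rule tendsto_integral_uniform_limit[OF locally_integrable_mult_test[OF li(4) vt] _ ug
          int[OF li(4) vt smooth_continuous_on[OF sgn]] int[OF li(4) vt g(2)]]) (simp add: v0)
  have L2: "(\<lambda>n. LBINT x. f x * \<phi> x * conv G (mollifier n) x) \<longlonglongrightarrow> (LBINT x. f x * \<phi> x * G x)"
    by (rule tendsto_integral_conv[of _ M A]) (use M A li in auto)
  have L3: "(\<lambda>n. LBINT x. f x * \<phi> x * R n x) \<longlonglongrightarrow> (LBINT x. f x * \<phi> x * 0)"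
    by (rule tendsto_integral_uniform_limit[OF locally_integrable_mult_test[OF li(4) \<phi>] _ uR
          int[OF li(4) \<phi> cR] int[OF li(4) \<phi> continuous_on_const]]) (simp add: A)
  have L4: "(\<lambda>n. LBINT x. F x * \<phi> x * gn n x) \<longlonglongrightarrow> (LBINT x. F x * \<phi> x * g x)"
    by (rule tendsto_integral_uniform_limit[OF locally_integrable_mult_test[OF li(1) \<phi>] _ ug
          int[OF li(1) \<phi> smooth_continuous_on[OF sgn]] int[OF li(1) \<phi> g(2)]]) (simp add: A)
  have "(LBINT x. f x * vderiv V \<phi> x * g x) + (LBINT x. f x * \<phi> x * G x) + (LBINT x. f x * \<phi> x * 0)
     = - (LBINT x. F x * \<phi> x * g x)"
    by (rule LIMSEQ_unique[OF tendsto_add[OF tendsto_add[OF L1 L2] L3]]) (unfold eqn, rule tendsto_minus[OF L4])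
  moreover have "integrable lborel (\<lambda>x. F x * \<phi> x * g x)" by (rule int[OF li(1) \<phi> g(2)])
  moreover have "integrable lborel (\<lambda>x. f x * \<phi> x * G x)" using int[OF li(2) \<phi> f(2)] by (simp add: mult_ac)
  moreover have "(F x * g x + G x * f x) * \<phi> x = F x * \<phi> x * g x + f x * \<phi> x * G x" for x by (simp add: algebra_simps)
  ultimately show "(LBINT x. f x * g x * formal_adjoint V \<phi> x) = (LBINT x. (F x * g x + G x * f x) * \<phi> x)"
    by (simp add: formal_adjoint_divfree[OF V(2)] mult_ac)
qed

section \<open>The chain rule, from polynomials to continuously differentiable functions\<close>

lemma has_distr_deriv_const:
  fixes V :: "'a::euclidean_space \<Rightarrow> 'a"
  assumes "smooth V" "\<And>x. divergence V x = 0"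
  shows "has_distr_deriv V (\<lambda>_. c) (\<lambda>_. 0)"
  unfolding has_distr_deriv_def
  using integral_vderiv_eq_0[OF _ assms]
  by (auto simp: formal_adjoint_divfree[OF assms(2)] intro!: continuous_locally_integrable)

lemma has_distr_deriv_add:
  fixes V :: "'a::euclidean_space \<Rightarrow> 'a"
  assumes f: "has_distr_deriv V f F" and g: "has_distr_deriv V g G"
    and V: "smooth V" "\<And>x. divergence V x = 0"
  shows "has_distr_deriv V (\<lambda>x. f x + g x) (\<lambda>x. F x + G x)"
  unfolding has_distr_deriv_def
proof (intro conjI ballI)
  have li: "locally_integrable F" "locally_integrable G" "locally_integrable g" "locally_integrable f"
    using f g by (auto simp: has_distr_deriv_def)
  show "locally_integrable (\<lambda>x. f x + g x)" "locally_integrable (\<lambda>x. F x + G x)"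
    by (intro locally_integrable_add li)+
  fix \<phi> :: "'a \<Rightarrow> real" assume \<phi>: "\<phi> \<in> test_functions UNIV"
  note vt = test_functions_vderiv[OF \<phi> V(1)]
  show "(LBINT x. (f x + g x) * formal_adjoint V \<phi> x) = (LBINT x. (F x + G x) * \<phi> x)"
    using has_distr_derivD[OF f \<phi> V(2)] has_distr_derivD[OF g \<phi> V(2)]
      locally_integrable_mult_test[OF li(1) \<phi>] locally_integrable_mult_test[OF li(2) \<phi>]
      locally_integrable_mult_test[OF li(3) vt] locally_integrable_mult_test[OF li(4) vt]
    by (simp add: formal_adjoint_divfree[OF V(2)] distrib_right)
qed

text \<open>Induction in Horner form: \<open>a + f * p(f)\<close> needs only sums, constants and the
  product rule.\<close>

lemma has_distr_deriv_poly:
  fixes V :: "'a::euclidean_space \<Rightarrow> 'a"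
  assumes f: "has_distr_deriv V f F" "continuous_on UNIV f"
    and V: "smooth V" "\<And>x. divergence V x = 0"
  shows "has_distr_deriv V (\<lambda>x. poly p (f x)) (\<lambda>x. F x * poly (pderiv p) (f x))"
proof (induction p rule: pCons_induct)
  case 0
  then show ?case using has_distr_deriv_const[OF V, of 0] by simp
next
  case (pCons a p)
  have "continuous_on UNIV (\<lambda>x. poly p (f x))" using f(2) by (intro continuous_intros)
  from has_distr_deriv_add[OF has_distr_deriv_const[OF V, of a] has_distr_deriv_mult[OF f pCons.IH this V] V]
  show ?case by (simp add: pderiv_pCons algebra_simps)
qed

lemma poly_antiderivative:
  fixes p :: "real poly"
  obtains P where "pderiv P = p" "poly P 0 = c"
proof
  let ?P = "(\<Sum>i\<le>degree p. monom (coeff p i / real (Suc i)) (Suc i)) + [:c:]"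
  have "pderiv (monom (coeff p i / real (Suc i)) (Suc i)) = monom (coeff p i) i" for i
    by (simp add: pderiv_monom del: of_nat_Suc)
  moreover have "pderiv (sum f A) = (\<Sum>i\<in>A. pderiv (f i))" for f :: "nat \<Rightarrow> real poly" and A
    using higher_pderiv_sum[of 1 f A] by simp
  ultimately show "pderiv ?P = p"
    by (simp add: pderiv_add pderiv_pCons poly_as_sum_of_monoms del: of_nat_Suc)
  show "poly ?P 0 = c" by (simp add: poly_sum poly_monom)
qed

text \<open>The Weierstrass theorem is applied to the derivative and the polynomial is integrated
  from 0, so that values and derivatives are close at the same time.\<close>

lemma C1_poly_approx:
  fixes g :: "real \<Rightarrow> real"
  assumes g: "\<And>t. 0 \<le> t \<Longrightarrow> (g has_real_derivative g' t) (at t within {0..})"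
    and g': "continuous_on {0..} g'" and b: "0 \<le> b" and e: "0 < e"
  obtains P where "\<And>t. t \<in> {0..b} \<Longrightarrow> \<bar>poly P t - g t\<bar> \<le> e" "\<And>t. t \<in> {0..b} \<Longrightarrow> \<bar>poly (pderiv P) t - g' t\<bar> \<le> e"
proof -
  \<comment> \<open>Integration over an interval of length at most \<open>b\<close> multiplies the
    error by \<open>b\<close>; this choice keeps both the error and its multiple below
    \<open>e\<close>.\<close>
  define \<delta> where "\<delta> = e / (b + 1)"
  have \<delta>: "0 < \<delta>" "\<delta> \<le> e" "\<delta> * b \<le> e"
    using e b by (auto simp: \<delta>_def field_simps)
  have "continuous_on {0..b} g'" using g' by (rule continuous_on_subset) auto
  then obtain q where q: "real_polynomial_function q" "\<And>t. t \<in> {0..b} \<Longrightarrow> \<bar>g' t - q t\<bar> < \<delta>"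
    using Stone_Weierstrass_real_polynomial_function[of "{0..b}" g' \<delta>] \<delta> by auto
  obtain a n where an: "q = (\<lambda>x. \<Sum>i\<le>n. a i * x ^ i)"
    using q(1) unfolding real_polynomial_function_iff_sum by blast
  define p where "p = (\<Sum>i\<le>n. monom (a i) i)"
  have pq: "poly p t = q t" for t by (simp add: p_def an poly_sum poly_monom)
  obtain P where P: "pderiv P = p" "poly P 0 = g 0" by (rule poly_antiderivative)
  show ?thesis
  proof (rule that[of P])
    fix t assume t: "t \<in> {0..b}"
    show "\<bar>poly (pderiv P) t - g' t\<bar> \<le> e"
      using q(2)[OF t] \<delta>(2) by (simp add: P pq)
    have "norm ((poly P t - g t) - (poly P 0 - g 0)) \<le> \<delta> * norm (t - 0)"
    proof (rule field_differentiable_bound[of "{0..b}" "\<lambda>t. poly P t - g t" "\<lambda>t. poly p t - g' t"])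
      fix z assume z: "z \<in> {0..b}"
      have "(g has_real_derivative g' z) (at z within {0..b})"
        using g[of z] z by (auto intro: DERIV_subset)
      then show "((\<lambda>t. poly P t - g t) has_field_derivative poly p z - g' z) (at z within {0..b})"
        using P(1) by (auto intro!: derivative_eq_intros DERIV_subset[OF poly_DERIV])
      show "norm (poly p z - g' z) \<le> \<delta>" using q(2)[OF z] by (simp add: pq)
    qed (use t b in auto)
    also have "\<dots> \<le> \<delta> * b" using t \<delta> by (intro mult_left_mono) auto
    finally show "\<bar>poly P t - g t\<bar> \<le> e" using \<delta>(3) P(2) by simp
  qed
qed

text \<open>On the support of a test function \<open>f\<close> takes values in a compact interval,
  on which \<open>g\<close> and \<open>g'\<close> are uniform limits of polynomials and their
  derivatives. Since \<open>f\<close> is nonnegative, a one-sided derivative at 0 is enough; this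
  matters for powers of the distance.\<close>

lemma has_distr_deriv_chain:
  fixes V :: "'a::euclidean_space \<Rightarrow> 'a"
  assumes f: "has_distr_deriv V f F" "continuous_on UNIV f" "\<And>x. 0 \<le> f x"
    and V: "smooth V" "\<And>x. divergence V x = 0"
    and g: "\<And>t. 0 \<le> t \<Longrightarrow> (g has_real_derivative g' t) (at t within {0..})"
    and g': "continuous_on {0..} g'"
  shows "has_distr_deriv V (\<lambda>x. g (f x)) (\<lambda>x. F x * g' (f x))"
  unfolding has_distr_deriv_def
proof (intro conjI ballI)
  have li: "locally_integrable F" "locally_integrable f" using f by (auto simp: has_distr_deriv_def)
  have "continuous_on {0..} g"
    using g by (auto intro!: DERIV_continuous_on)
  then have cg: "continuous_on UNIV (\<lambda>x. g (f x))"
    using f by (auto intro: continuous_on_compose2)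
  have cg': "continuous_on UNIV (\<lambda>x. g' (f x))"
    using f by (auto intro: continuous_on_compose2[OF g'])
  show "locally_integrable (\<lambda>x. g (f x))" by (rule continuous_locally_integrable[OF cg])
  show "locally_integrable (\<lambda>x. F x * g' (f x))" by (rule locally_integrable_mult_continuous[OF li(1) cg'])
  fix \<phi> :: "'a \<Rightarrow> real" assume \<phi>: "\<phi> \<in> test_functions UNIV"
  obtain A where A: "smooth \<phi>" "compact A" "\<And>x. x \<notin> A \<Longrightarrow> \<phi> x = 0"
    by (rule test_functionsE[OF \<phi>]) blast
  have v0: "vderiv V \<phi> x = 0" if "x \<notin> A" for x
    unfolding vderiv_def by (rule fderiv_eq_0_outside[OF compact_imp_closed[OF A(2)]]) (use A that in auto)
  note vt = test_functions_vderiv[OF \<phi> V(1)]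
  obtain B where B: "\<And>x. x \<in> A \<Longrightarrow> \<bar>f x\<bar> \<le> B"
    by (rule continuous_bounded_on_compact[OF f(2) A(2)]) blast
  define b where "b = \<bar>B\<bar>"
  have b: "0 \<le> b" "\<And>x. x \<in> A \<Longrightarrow> f x \<in> {0..b}" using B f(3) by (auto simp: b_def abs_le_iff) (smt (verit))
  have "\<exists>P. \<forall>t\<in>{0..b}. \<bar>poly P t - g t\<bar> \<le> inverse (real (Suc n)) \<and> \<bar>poly (pderiv P) t - g' t\<bar> \<le> inverse (real (Suc n))" for n
    by (rule C1_poly_approx[of g g' b "inverse (real (Suc n))"]) (erule g, rule g', rule b(1), simp, blast)
  then obtain P where P: "\<And>n t. t \<in> {0..b} \<Longrightarrow> \<bar>poly (P n) t - g t\<bar> \<le> inverse (real (Suc n))"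
     "\<And>n t. t \<in> {0..b} \<Longrightarrow> \<bar>poly (pderiv (P n)) t - g' t\<bar> \<le> inverse (real (Suc n))" by metis
  have ul: "uniform_limit A u v sequentially"
    if "\<And>n x. x \<in> A \<Longrightarrow> \<bar>u n x - v x\<bar> \<le> inverse (real (Suc n))" for u v
  proof (rule uniform_limitI)
    fix e :: real assume "e > 0"
    then have "\<forall>\<^sub>F n in sequentially. inverse (real (Suc n)) < e"
      by (rule order_tendstoD(2)[OF LIMSEQ_inverse_real_of_nat])
    then show "\<forall>\<^sub>F n in sequentially. \<forall>x\<in>A. dist (u n x) (v x) < e"
    proof eventually_elim
      case (elim n)
      show ?case
      proof
        fix x assume "x \<in> A"
        then show "dist (u n x) (v x) < e" using that[of x n] elim unfolding dist_real_def by linarith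
      qed
    qed
  qed
  have u1: "uniform_limit A (\<lambda>n x. poly (P n) (f x)) (\<lambda>x. g (f x)) sequentially"
    by (rule ul) (rule P(1), rule b(2))
  have u2: "uniform_limit A (\<lambda>n x. poly (pderiv (P n)) (f x)) (\<lambda>x. g' (f x)) sequentially"
    by (rule ul) (rule P(2), rule b(2))
  note int = locally_integrable_mult_test_continuous
  have cp: "continuous_on UNIV (\<lambda>x. poly q (f x))" for q :: "real poly" using f(2) by (intro continuous_intros)
  have vi: "integrable lborel (\<lambda>x. vderiv V \<phi> x * u x)" if "continuous_on UNIV u" for u
    using locally_integrable_mult_test[OF continuous_locally_integrable[OF that] vt] by (simp add: mult.commute)
  have L1: "(\<lambda>n. LBINT x. vderiv V \<phi> x * poly (P n) (f x)) \<longlonglongrightarrow> (LBINT x. vderiv V \<phi> x * g (f x))"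
    by (rule tendsto_integral_uniform_limit[OF test_functions_integrable[OF vt] _ u1])
      (auto intro: v0 vi cp cg)
  have L2: "(\<lambda>n. LBINT x. F x * \<phi> x * poly (pderiv (P n)) (f x)) \<longlonglongrightarrow> (LBINT x. F x * \<phi> x * g' (f x))"
    by (rule tendsto_integral_uniform_limit[OF locally_integrable_mult_test[OF li(1) \<phi>] _ u2])
      (auto simp: A intro!: int li \<phi> cp cg')
  have eqn: "(LBINT x. vderiv V \<phi> x * poly (P n) (f x)) = - (LBINT x. F x * \<phi> x * poly (pderiv (P n)) (f x))" for n
    using has_distr_derivD[OF has_distr_deriv_poly[OF f(1,2) V, of "P n"] \<phi> V(2)] by (simp add: mult_ac)
  have "(LBINT x. vderiv V \<phi> x * g (f x)) = - (LBINT x. F x * \<phi> x * g' (f x))"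
    by (rule LIMSEQ_unique[OF L1]) (unfold eqn, rule tendsto_minus[OF L2])
  then show "(LBINT x. g (f x) * formal_adjoint V \<phi> x) = (LBINT x. F x * g' (f x) * \<phi> x)"
    by (simp add: formal_adjoint_divfree[OF V(2)] mult_ac)
qed

text \<open>The mollified \<psi> is nonnegative and, once the smearing radius is below the distance
  from \<open>S\<close> to the complement of \<open>U\<close>, admissible for the Laplacian bound.
  One of the two derivatives is then moved onto \<open>d\<close>. In the limit the mollified
  \<open>p i\<close> converge only in L1, and the bound on \<open>G i\<close> is what makes the
  pairing converge.\<close>

lemma distr_laplacian_le_ibp:
  fixes X :: "'k::finite \<Rightarrow> 'a::euclidean_space \<Rightarrow> 'a"
  assumes X: "\<And>i. smooth (X i)" "\<And>i x. divergence (X i) x = 0"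
    and d: "\<And>i. has_distr_deriv (X i) d (G i)" "\<And>i. AE x in lborel. \<bar>G i x\<bar> \<le> M"
    and lap: "distr_laplacian_le X U d h" and h: "locally_integrable h"
    and U: "open U" "compact S" "S \<subseteq> U"
    and \<psi>: "continuous_on UNIV \<psi>" "\<And>x. 0 \<le> \<psi> x" "\<And>x. x \<notin> S \<Longrightarrow> \<psi> x = 0"
    and p: "\<And>i. has_distr_deriv (X i) \<psi> (p i)" "\<And>i x. x \<notin> S \<Longrightarrow> p i x = 0"
  shows "- (\<Sum>i\<in>UNIV. LBINT x. G i x * p i x) \<le> (LBINT x. h x * \<psi> x)"
proof -
  define S' where "S' = unit_neighbourhood S"
  have S': "compact S'" unfolding S'_def by (intro compact_unit_neighbourhood U)
  have SS': "x \<in> S'" if "s \<in> S" "norm (x - s) \<le> 1" for x s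
    unfolding S'_def using that by (rule in_unit_neighbourhood)
  have SS'1: "x \<notin> S" if "x \<notin> S'" for x using SS'[of x x] that by auto
  have [measurable]: "S' \<in> sets borel" using S' by (simp add: borel_compact)
  have li: "locally_integrable (G i)" "locally_integrable (p i)" "locally_integrable \<psi>" for i
    using d p by (auto simp: has_distr_deriv_def)
  have ld: "locally_integrable d" using d(1)[of undefined] by (simp add: has_distr_deriv_def)
  define \<psi>n where "\<psi>n n = conv \<psi> (mollifier n)" for n
  define R where "R i n = commutator (X i) \<psi> (mollifier n)" for i n
  have near: "\<exists>s\<in>S. norm (x - s) < inverse (real (Suc n))" if "\<psi>n n x \<noteq> 0" for n x
  proof (rule ccontr)
    assume no: "\<not> ?thesis"
    have "\<psi>n n x = 0" unfolding \<psi>n_def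
    proof (rule conv_eq_0)
      fix y assume "mollifier n (x - y) \<noteq> 0"
      then show "\<psi> y = 0" using no \<psi>(3) mollifier_neq_0D(1) by blast
    qed
    then show False using that by simp
  qed
  have \<psi>n0: "\<psi>n n x = 0" if "x \<notin> S'" for n x
  proof (rule ccontr)
    assume "\<psi>n n x \<noteq> 0"
    then obtain s where s: "s \<in> S" "norm (x - s) < inverse (real (Suc n))" using near by blast
    moreover have "inverse (real (Suc n)) \<le> 1" by (simp add: inverse_le_1_iff)
    ultimately show False using that SS'[of s x] by simp
  qed
  have sm: "smooth (\<psi>n n)" for n unfolding \<psi>n_def by (rule conv_smooth[OF li(3) mollifier_test])
  have v0: "vderiv (X i) (\<psi>n n) x = 0" if "x \<notin> S'" for i n x
    unfolding vderiv_def by (rule fderiv_eq_0_outside[OF compact_imp_closed[OF S']]) (use \<psi>n0 that in auto)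
  have test: "\<psi>n n \<in> test_functions UNIV" for n
    by (rule test_functionsI[OF sm S']) (use \<psi>n0 in auto)
  obtain r where r: "r > 0" "(\<Union>x\<in>S. ball x r) \<subseteq> U"
    using compact_subset_open_imp_ball_epsilon_subset[OF U(2,1,3)] by blast
  have "\<forall>\<^sub>F n in sequentially. inverse (real (Suc n)) < r"
    by (rule order_tendstoD(2)[OF LIMSEQ_inverse_real_of_nat r(1)])
  then have "\<forall>\<^sub>F n in sequentially. \<psi>n n \<in> test_functions U"
  proof eventually_elim
    case (elim n)
    define C where "C = {x + y |x y. x \<in> S \<and> y \<in> cball (0::'a) (inverse (real (Suc n)))}"
    have "compact C" unfolding C_def by (intro compact_sums U) auto
    moreover have "C \<subseteq> U"
    proof
      fix z assume "z \<in> C"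
      then obtain x y where "z = x + y" "x \<in> S" "norm y \<le> inverse (real (Suc n))"
        unfolding C_def by auto
      then have "z \<in> ball x r" using elim by (simp add: dist_norm)
      then show "z \<in> U" using r(2) \<open>x \<in> S\<close> by blast
    qed
    moreover have "\<psi>n n z = 0" if "z \<notin> C" for z
    proof (rule ccontr)
      assume "\<psi>n n z \<noteq> 0"
      then obtain s where s: "s \<in> S" "norm (z - s) < inverse (real (Suc n))" using near by blast
      moreover have "z = s + (z - s)" by simp
      ultimately have "z \<in> C" unfolding C_def by fastforce
      then show False using that by simp
    qed
    ultimately show ?case by (intro test_functionsI[OF sm])
  qed
  then have ev: "\<forall>\<^sub>F n in sequentially. - (\<Sum>i\<in>UNIV. LBINT x. G i x * vderiv (X i) (\<psi>n n) x) \<le> (LBINT x. h x * \<psi>n n x)"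
  proof eventually_elim
    case (elim n)
    have eq: "formal_adjoint (X i) (formal_adjoint (X i) (\<psi>n n)) = vderiv (X i) (vderiv (X i) (\<psi>n n))" for i
      using vderiv_uminus[OF smooth_vderiv[OF X(1) sm]]
      by (simp add: formal_adjoint_divfree[OF X(2)])
    note vt = test_functions_vderiv[OF test[of n] X(1)]
    have "(LBINT x. d x * (\<Sum>i\<in>UNIV. vderiv (X i) (vderiv (X i) (\<psi>n n)) x)) \<le> (LBINT x. h x * \<psi>n n x)"
    proof -
      have "\<forall>x. 0 \<le> \<psi>n n x"
        unfolding \<psi>n_def by (intro allI conv_nonneg \<psi>(2) mollifier_nonneg)
      with elim lap show ?thesis unfolding distr_laplacian_le_def eq[symmetric] by blast
    qed
    moreover have "(LBINT x. d x * (\<Sum>i\<in>UNIV. vderiv (X i) (vderiv (X i) (\<psi>n n)) x))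
       = (\<Sum>i\<in>UNIV. LBINT x. d x * vderiv (X i) (vderiv (X i) (\<psi>n n)) x)"
      unfolding sum_distrib_left
      by (rule Bochner_Integration.integral_sum)
        (rule locally_integrable_mult_test[OF ld test_functions_vderiv[OF vt X(1)]])
    ultimately show ?case
      by (simp add: has_distr_derivD[OF d(1) vt X(2)] sum_negf)
  qed
  have intS: "integrable lborel (\<lambda>x. (indicator S' x * k x) * u x)"
    if "locally_integrable k" "continuous_on UNIV u" for k u
    using locally_integrable_mult_continuous[OF that] S' by (simp add: locally_integrable_def set_integrable_def mult.assoc)
  have ind: "integrable lborel (\<lambda>x. indicator S' x * k x)" if "locally_integrable k" for k
    using that S' by (simp add: locally_integrable_def set_integrable_def)
  have lim1: "(\<lambda>n. LBINT x. h x * \<psi>n n x) \<longlonglongrightarrow> (LBINT x. h x * \<psi> x)"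
  proof -
    have "(\<lambda>n. LBINT x. (indicator S' x * h x) * \<psi>n n x) \<longlonglongrightarrow> (LBINT x. (indicator S' x * h x) * \<psi> x)"
      by (rule tendsto_integral_uniform_limit[OF ind[OF h], of S'])
        (auto simp: \<psi>n_def[abs_def] intro!: conv_mollifier_uniform_limit[OF \<psi>(1) S'] intS h \<psi> smooth_continuous_on conv_smooth li mollifier_test)
    moreover have "indicator S' x * h x * \<psi>n n x = h x * \<psi>n n x" for x n
      using \<psi>n0[of x n] by (cases "x \<in> S'") auto
    moreover have "indicator S' x * h x * \<psi> x = h x * \<psi> x" for x
      using \<psi>(3)[of x] SS'1[of x] by (cases "x \<in> S'") auto
    ultimately show ?thesis by simp
  qed
  have lim2: "(\<lambda>n. LBINT x. G i x * vderiv (X i) (\<psi>n n) x) \<longlonglongrightarrow> (LBINT x. G i x * p i x)" for i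
  proof -
    let ?g = "\<lambda>x. indicator S' x * G i x"
    have [measurable]: "G i \<in> borel_measurable borel" using li by (auto simp: locally_integrable_def)
    have cR: "continuous_on UNIV (R i n)" for n
      unfolding R_def by (rule commutator_continuous[OF p(1) X mollifier_test])
    have cp: "continuous_on UNIV (conv (p i) (mollifier n))" for n
      by (intro smooth_continuous_on conv_smooth li mollifier_test)
    have "AE x in lborel. \<bar>?g x\<bar> \<le> \<bar>M\<bar>"
      using d(2)[of i] by eventually_elim (auto simp: indicator_def)
    then have 1: "(\<lambda>n. LBINT x. ?g x * conv (p i) (mollifier n) x) \<longlonglongrightarrow> (LBINT x. ?g x * p i x)"
      by (intro tendsto_integral_conv[of _ _ S'] li S') auto
    \<comment> \<open>The difference between the derivative of the mollified function and the
      mollified derivative disappears in the limit.\<close>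
    have 2: "(\<lambda>n. LBINT x. ?g x * R i n x) \<longlonglongrightarrow> (LBINT x. ?g x * 0)"
      by (rule tendsto_integral_uniform_limit[OF ind[OF li(1)], of S'])
        (auto simp: R_def[abs_def] intro!: commutator_uniform_limit \<psi> X S' intS li cR[unfolded R_def])
    have "G i x * vderiv (X i) (\<psi>n n) x = ?g x * conv (p i) (mollifier n) x + ?g x * R i n x" for n x
    proof -
      have "G i x * vderiv (X i) (\<psi>n n) x = ?g x * vderiv (X i) (\<psi>n n) x"
        using v0[of x i n] by (cases "x \<in> S'") auto
      then show ?thesis
        by (simp add: \<psi>n_def R_def vderiv_conv[OF p(1) mollifier_test X] distrib_left)
    qed
    moreover have pe: "?g x * p i x = G i x * p i x" for x
      using p(2)[of x i] SS'1[of x] by (cases "x \<in> S'") auto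
    have "(LBINT x. G i x * p i x) = (LBINT x. ?g x * p i x)" by (simp only: pe)
    ultimately show ?thesis
      using tendsto_add[OF 1 2] intS[OF li(1) cR] intS[OF li(1) cp] by simp
  qed
  show ?thesis
    by (rule tendsto_le[OF sequentially_bot lim1 tendsto_minus[OF tendsto_sum[OF lim2]] ev])
qed

section \<open>The U-bound\<close>

text \<open>The positive part is squared in the cutoff because this makes it continuously
  differentiable, as the chain rule requires.\<close>

lemma has_real_derivative_max0_square:
  "((\<lambda>x::real. (max 0 x)\<^sup>2) has_real_derivative 2 * max 0 x) (at x)"
proof -
  consider "x > 0" | "x < 0" | "x = 0" by linarith
  then show ?thesis
  proof cases
    case 1
    have "((\<lambda>x::real. x\<^sup>2) has_real_derivative 2 * max 0 x) (at x)"
      using 1 by (auto intro!: derivative_eq_intros)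
    then show ?thesis
      by (rule has_field_derivative_transform_within_open[of _ _ _ "{0<..}"]) (use 1 in auto)
  next
    case 2
    have "((\<lambda>x::real. 0) has_real_derivative 2 * max 0 x) (at x)" using 2 by simp
    then show ?thesis
      by (rule has_field_derivative_transform_within_open[of _ _ _ "{..<0}"]) (use 2 in auto)
  next
    case 3
    have "((\<lambda>h::real. (max 0 h)\<^sup>2 / h) \<longlongrightarrow> 0) (at 0)"
    proof (rule Lim_null_comparison)
      show "\<forall>\<^sub>F h in at 0. norm ((max 0 h)\<^sup>2 / h) \<le> \<bar>h\<bar>" for h :: real
        by (intro always_eventually allI) (auto simp: max_def power2_eq_square abs_mult)
      show "((\<lambda>h::real. \<bar>h\<bar>) \<longlongrightarrow> 0) (at 0)" by (intro tendsto_eq_intros) auto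
    qed
    then show ?thesis using 3 by (simp add: has_field_derivative_iff)
  qed
qed

text \<open>The cutoff in the distance. The factor \<open>t powr (\<theta> - 1)\<close> is what turns the drift term into
  \<open>t powr (2 * (\<theta> - 1))\<close>; the truncation at \<open>R\<close> is decreasing and hence has a favourable sign.\<close>

definition cutoff :: "real \<Rightarrow> real \<Rightarrow> real \<Rightarrow> real" where
  "cutoff \<theta> R t = max 1 t powr (\<theta> - 3) * (max 0 (t - 3/2))\<^sup>2 * (max 0 (1 - t / R))\<^sup>2"

definition cutoff_deriv :: "real \<Rightarrow> real \<Rightarrow> real \<Rightarrow> real" where
  "cutoff_deriv \<theta> R t =
     (\<theta> - 3) * max 1 t powr (\<theta> - 4) * (max 0 (t - 3/2))\<^sup>2 * (max 0 (1 - t / R))\<^sup>2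
     + 2 * max 1 t powr (\<theta> - 3) * max 0 (t - 3/2) * (max 0 (1 - t / R))\<^sup>2
     - 2 / R * max 1 t powr (\<theta> - 3) * (max 0 (t - 3/2))\<^sup>2 * max 0 (1 - t / R)"

definition cutoff_weight :: "real \<Rightarrow> real \<Rightarrow> real \<Rightarrow> real \<Rightarrow> real" where
  "cutoff_weight \<beta> \<theta> R t = exp (- \<beta> * max 1 t powr \<theta>) * cutoff \<theta> R t"

definition cutoff_weight_deriv :: "real \<Rightarrow> real \<Rightarrow> real \<Rightarrow> real \<Rightarrow> real" where
  "cutoff_weight_deriv \<beta> \<theta> R t =
     exp (- \<beta> * max 1 t powr \<theta>) * (cutoff_deriv \<theta> R t - \<beta> * \<theta> * max 1 t powr (\<theta> - 1) * cutoff \<theta> R t)"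

text \<open>Two overlapping open regions: for \<open>t > 1\<close> the maximum with 1 is
  \<open>t\<close> itself, and for \<open>t < 3/2\<close> everything is zero. The maximum only keeps
  the powers away from their singularity at 0.\<close>

lemma cutoff_weight_has_derivative:
  assumes "R > 0"
  shows "(cutoff_weight \<beta> \<theta> R has_real_derivative cutoff_weight_deriv \<beta> \<theta> R t) (at t)"
proof (cases "t > 1")
  case True
  have 1: "((\<lambda>t. (max 0 (t - 3/2))\<^sup>2) has_real_derivative 2 * max 0 (t - 3/2)) (at t)"
    by (rule DERIV_chain2[OF has_real_derivative_max0_square, where g="\<lambda>t. t - 3/2" and Db=1 and x=t, simplified])
      (auto intro!: derivative_eq_intros)
  have 2: "((\<lambda>t. (max 0 (1 - t / R))\<^sup>2) has_real_derivative 2 * max 0 (1 - t / R) * (- (1 / R))) (at t)"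
    by (rule DERIV_chain2[OF has_real_derivative_max0_square])
      (use assms in \<open>auto intro!: derivative_eq_intros\<close>)
  have "((\<lambda>t. exp (- \<beta> * t powr \<theta>) * (t powr (\<theta> - 3) * (max 0 (t - 3/2))\<^sup>2 * (max 0 (1 - t / R))\<^sup>2))
      has_real_derivative cutoff_weight_deriv \<beta> \<theta> R t) (at t)"
  proof -
    have E: "((\<lambda>t. exp (- \<beta> * t powr \<theta>)) has_real_derivative exp (- \<beta> * t powr \<theta>) * (- \<beta> * (\<theta> * t powr (\<theta> - 1)))) (at t)"
      using True by (auto intro!: derivative_eq_intros)
    have P: "((\<lambda>t. t powr (\<theta> - 3)) has_real_derivative (\<theta> - 3) * t powr (\<theta> - 4)) (at t)"
      using True by (auto intro!: derivative_eq_intros)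
    have m: "max 1 t = t" using True by simp
    show ?thesis
      by (rule DERIV_cong[OF DERIV_mult[OF E DERIV_mult[OF DERIV_mult[OF P 1] 2]]])
        (simp add: cutoff_weight_deriv_def cutoff_deriv_def cutoff_def m algebra_simps)
  qed
  then show ?thesis
    by (rule has_field_derivative_transform_within_open[of _ _ _ "{1<..}"])
      (use True in \<open>auto simp: cutoff_weight_def cutoff_def max_def[of 1]\<close>)
next
  case False
  have "((\<lambda>_. 0) has_real_derivative cutoff_weight_deriv \<beta> \<theta> R t) (at t)"
    using False by (simp add: cutoff_weight_deriv_def cutoff_deriv_def cutoff_def max_def[of 0 "t - 3/2"])
  then show ?thesis
    by (rule has_field_derivative_transform_within_open[of _ _ _ "{..<3/2}"])
      (use False in \<open>auto simp: cutoff_weight_def cutoff_def max_def\<close>)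
qed

lemma cutoff_weight_deriv_continuous: "R > 0 \<Longrightarrow> continuous_on A (cutoff_weight_deriv \<beta> \<theta> R)"
  unfolding cutoff_weight_deriv_def[abs_def] cutoff_deriv_def cutoff_def
  by (intro continuous_intros) (auto simp: max_def)

lemma cutoff_weight_continuous: "R > 0 \<Longrightarrow> continuous_on A (cutoff_weight \<beta> \<theta> R)"
  unfolding cutoff_weight_def[abs_def] cutoff_def
  by (intro continuous_intros) (auto simp: max_def)

lemma cutoff_nonneg: "0 \<le> cutoff \<theta> R t"
  by (simp add: cutoff_def)

lemma cutoff_outside:
  assumes "R > 0" "t < 3/2 \<or> R < t"
  shows "cutoff \<theta> R t = 0" "cutoff_deriv \<theta> R t = 0"
proof -
  have "max 0 (t - 3/2) = 0 \<or> max 0 (1 - t / R) = 0"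
    using assms by (auto simp: max_def field_simps)
  then show "cutoff \<theta> R t = 0" "cutoff_deriv \<theta> R t = 0"
    by (auto simp: cutoff_def cutoff_deriv_def)
qed

text \<open>The truncation that remains when \<open>t powr (\<theta> - 1)\<close> is split off from
  \<open>cutoff\<close>. It lies between 0 and 1, which accounts for the exponent
  \<open>\<theta> - 3\<close>: two powers of \<open>t\<close> compensate the growth of the square of
  \<open>t - 3/2\<close>.\<close>

definition cutoff_frac :: "real \<Rightarrow> real \<Rightarrow> real" where
  "cutoff_frac R t = (max 0 (t - 3/2) / max 1 t)\<^sup>2 * (max 0 (1 - t / R))\<^sup>2"

lemma cutoff_eq_frac: "cutoff \<theta> R t = max 1 t powr (\<theta> - 1) * cutoff_frac R t"
proof -
  have "max 1 t powr (\<theta> - 1) = max 1 t powr (\<theta> - 3) * max 1 t powr 2"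
    by (simp only: powr_add[symmetric]) simp
  also have "max 1 t powr 2 = (max 1 t)\<^sup>2" by (subst powr_numeral) auto
  finally show ?thesis
    unfolding cutoff_def cutoff_frac_def power_divide by (simp add: field_simps max_def)
qed

lemma cutoff_frac_bounds:
  assumes "R > 0" "0 \<le> t" shows "0 \<le> cutoff_frac R t" "cutoff_frac R t \<le> 1"
proof -
  have "(max 0 (t - 3/2) / max 1 t)\<^sup>2 \<le> 1" by (rule power_le_one) (auto simp: max_def field_simps)
  moreover have "(max 0 (1 - t / R))\<^sup>2 \<le> 1" using assms by (intro power_le_one) auto
  ultimately show "cutoff_frac R t \<le> 1" unfolding cutoff_frac_def by (intro mult_le_one) auto
qed (simp add: cutoff_frac_def)

text \<open>Of the three terms the first and the last are nonpositive, the last one because the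
  outer truncation decreases. The middle one is at most \<open>2 * t powr (- 1) * t\<close>. The
  bound does not depend on \<open>R\<close>, as the later limit demands.\<close>

lemma cutoff_deriv_le:
  assumes "R > 0" "0 \<le> t" "\<theta> \<le> 2" shows "cutoff_deriv \<theta> R t \<le> 2"
proof -
  have "(\<theta> - 3) * max 1 t powr (\<theta> - 4) * (max 0 (t - 3/2))\<^sup>2 * (max 0 (1 - t / R))\<^sup>2 \<le> 0"
    using assms by (intro mult_nonpos_nonneg) auto
  moreover have "0 \<le> 2 / R * max 1 t powr (\<theta> - 3) * (max 0 (t - 3/2))\<^sup>2 * max 0 (1 - t / R)"
    using assms by simp
  moreover have "2 * max 1 t powr (\<theta> - 3) * max 0 (t - 3/2) * (max 0 (1 - t / R))\<^sup>2 \<le> 2 * 1 * 1"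
  proof (rule mult_mono)
    have "max 1 t powr (\<theta> - 3) * max 0 (t - 3/2) \<le> max 1 t powr (-1) * max 1 t"
      using assms by (intro mult_mono powr_mono) auto
    also have "\<dots> = 1" by (simp add: powr_minus_divide max_def)
    finally show "2 * max 1 t powr (\<theta> - 3) * max 0 (t - 3/2) \<le> 2 * 1" by simp
    show "(max 0 (1 - t / R))\<^sup>2 \<le> 1" using assms by (intro power_le_one) auto
  qed auto
  ultimately show ?thesis unfolding cutoff_deriv_def by linarith
qed

text \<open>This estimates the integrand after integration by parts. With
  \<open>y = t powr (\<theta> - 1)\<close> and \<open>Q\<close> the truncation, the drift terms
  contribute \<open>- \<kappa>\<close> times the square of \<open>f * y\<close> times
  \<open>Q\<close>. The gradient cross term and the term with \<open>K\<close> each give back a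
  quarter of \<kappa> by completing a square, so half of \<kappa> survives.\<close>

lemma u_bound_pointwise:
  fixes F G :: "real ^ 'k" and f t :: real
  assumes \<kappa>_def: "\<kappa> = \<beta> * \<theta> * (1 / \<sigma>\<^sup>2 - \<epsilon>)" and t: "0 \<le> t" and R: "R > 0" and \<theta>: "1 \<le> \<theta>" "\<theta> \<le> 2" and \<beta>: "0 < \<beta>" and \<sigma>: "1 \<le> \<sigma>"
    and G: "1 / \<sigma> \<le> norm G" "norm G \<le> 1" and K: "0 \<le> K" and \<epsilon>: "0 \<le> \<epsilon>" "\<epsilon> < 1 / \<sigma>\<^sup>2"
  shows "(K + \<beta> * \<theta> * \<epsilon> * max 1 t powr (\<theta> - 1)) * (f\<^sup>2 * cutoff_weight \<beta> \<theta> R t)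
      + (2 * f * (G \<bullet> F) * cutoff_weight \<beta> \<theta> R t + f\<^sup>2 * (norm G)\<^sup>2 * cutoff_weight_deriv \<beta> \<theta> R t)
     \<le> exp (- \<beta> * t powr \<theta>) * (4 / \<kappa> * (norm F)\<^sup>2 + (2 + K\<^sup>2 / \<kappa>) * f\<^sup>2
          - \<kappa> / 2 * (f\<^sup>2 * (max 1 t powr (2 * (\<theta> - 1)) * cutoff_frac R t)))"
proof (cases "t < 3/2 \<or> R < t")
  case True
  have \<kappa>: "\<kappa> > 0" unfolding \<kappa>_def using \<theta> \<beta> \<epsilon> by simp
  have "max 1 t \<noteq> 0" by (simp add: max_def)
  then have "cutoff_frac R t = 0" using cutoff_outside(1)[OF R True, of 1] by (simp add: cutoff_eq_frac)
  then show ?thesis using \<kappa> cutoff_outside[OF R True, of \<theta>]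
    by (simp add: cutoff_weight_def cutoff_weight_deriv_def)
next
  case False
  have \<kappa>: "\<kappa> > 0" unfolding \<kappa>_def using \<theta> \<beta> \<epsilon> by simp
  define y where "y = max 1 t powr (\<theta> - 1)"
  define Q where "Q = cutoff_frac R t"
  define a where "a = (norm G)\<^sup>2"
  define b where "b = cutoff_deriv \<theta> R t"
  define e where "e = exp (- \<beta> * t powr \<theta>)"
  have m: "max 1 t = t" using False by simp
  have y: "0 \<le> y" "y\<^sup>2 = max 1 t powr (2 * (\<theta> - 1))"
    by (simp_all add: y_def power2_eq_square powr_add[symmetric])
  have Q: "0 \<le> Q" "Q \<le> 1" unfolding Q_def by (rule cutoff_frac_bounds[OF R t])+
  have e: "e > 0" by (simp add: e_def)
  have a: "1 / \<sigma>\<^sup>2 \<le> a" "0 \<le> a" "a \<le> 1"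
    using power_mono[OF G(1), of 2] \<sigma> power_le_one[of "norm G" 2] G(2)
    by (auto simp: a_def power_divide)
  have b: "b \<le> 2" unfolding b_def by (rule cutoff_deriv_le[OF R t \<theta>(2)])
  \<comment> \<open>The derivative of the cutoff is bounded only from above, so the upper bound on
    \<open>a\<close> is used where it is nonnegative and the sign of the product otherwise.\<close>
  have ab: "a * b \<le> 2"
  proof (cases "b \<ge> 0")
    case True
    then show ?thesis using mult_mono[of a 1 b 2] a b by simp
  next
    case False
    then have "a * b \<le> 0" using a by (intro mult_nonneg_nonpos) auto
    then show ?thesis by simp
  qed
  have GF: "\<bar>G \<bullet> F\<bar> \<le> norm F"
    using Cauchy_Schwarz_ineq2[of G F] mult_right_mono[OF G(2), of "norm F"] by simp
  have 1: "2 * f * (G \<bullet> F) * (y * Q) \<le> \<kappa> / 4 * (f\<^sup>2 * (y\<^sup>2 * Q)) + 4 / \<kappa> * (norm F)\<^sup>2"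
  proof -
    have "2 * f * (G \<bullet> F) * (y * Q) \<le> 2 * \<bar>f\<bar> * norm F * y * Q"
    proof -
      have "f * (G \<bullet> F) \<le> \<bar>f\<bar> * norm F"
        using mult_left_mono[OF GF, of "\<bar>f\<bar>"] abs_le_D1[of "f * (G \<bullet> F)"] by (simp add: abs_mult)
      then have "f * (G \<bullet> F) * (y * Q) \<le> \<bar>f\<bar> * norm F * (y * Q)"
        using y Q by (intro mult_right_mono) auto
      then show ?thesis by (simp add: mult_ac)
    qed
    also have "\<dots> \<le> (\<kappa> / 4 * (\<bar>f\<bar> * y)\<^sup>2 + 4 / \<kappa> * (norm F)\<^sup>2) * Q"
    proof -
      have "0 \<le> (\<kappa> / 4 * (\<bar>f\<bar> * y) - norm F)\<^sup>2" by simp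
      then have "2 * (\<kappa> / 4) * (\<bar>f\<bar> * y) * norm F \<le> (\<kappa> / 4 * (\<bar>f\<bar> * y))\<^sup>2 + (norm F)\<^sup>2"
        by (simp add: power2_diff mult_ac)
      then have "4 / \<kappa> * (2 * (\<kappa> / 4) * (\<bar>f\<bar> * y) * norm F) \<le> 4 / \<kappa> * ((\<kappa> / 4 * (\<bar>f\<bar> * y))\<^sup>2 + (norm F)\<^sup>2)"
        using \<kappa> by (intro mult_left_mono) auto
      also have "4 / \<kappa> * (2 * (\<kappa> / 4) * (\<bar>f\<bar> * y) * norm F) = 2 * \<bar>f\<bar> * norm F * y" using \<kappa> by simp
      also have "4 / \<kappa> * ((\<kappa> / 4 * (\<bar>f\<bar> * y))\<^sup>2 + (norm F)\<^sup>2) = \<kappa> / 4 * (\<bar>f\<bar> * y)\<^sup>2 + 4 / \<kappa> * (norm F)\<^sup>2"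
        using \<kappa> by (simp add: power2_eq_square field_simps)
      finally show ?thesis by (rule mult_right_mono[OF _ Q(1)])
    qed
    also have "\<dots> \<le> \<kappa> / 4 * (f\<^sup>2 * (y\<^sup>2 * Q)) + 4 / \<kappa> * (norm F)\<^sup>2"
    proof -
      have "4 / \<kappa> * (norm F)\<^sup>2 * Q \<le> 4 / \<kappa> * (norm F)\<^sup>2 * 1"
        by (rule mult_left_mono[OF Q(2)]) (use \<kappa> in simp)
      moreover have "(\<kappa> / 4 * (\<bar>f\<bar> * y)\<^sup>2 + 4 / \<kappa> * (norm F)\<^sup>2) * Q =
          \<kappa> / 4 * (f\<^sup>2 * (y\<^sup>2 * Q)) + 4 / \<kappa> * (norm F)\<^sup>2 * Q"
        by (simp only: distrib_right power_mult_distrib power2_abs mult.assoc)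
      ultimately show ?thesis by linarith
    qed
    finally show ?thesis .
  qed
  have 2: "K * (f\<^sup>2 * (y * Q)) \<le> \<kappa> / 4 * (f\<^sup>2 * (y\<^sup>2 * Q)) + K\<^sup>2 / \<kappa> * f\<^sup>2"
  proof -
    have "0 \<le> (\<kappa> / 2 * y - K)\<^sup>2" by simp
    then have "K * y * \<kappa> \<le> \<kappa> * \<kappa> / 4 * y\<^sup>2 + K\<^sup>2"
      by (simp add: power2_eq_square algebra_simps)
    moreover have "(\<kappa> / 4 * y\<^sup>2 + K\<^sup>2 / \<kappa>) * \<kappa> = \<kappa> * \<kappa> / 4 * y\<^sup>2 + K\<^sup>2"
      using \<kappa> by (simp add: distrib_right)
    ultimately have "K * y * \<kappa> \<le> (\<kappa> / 4 * y\<^sup>2 + K\<^sup>2 / \<kappa>) * \<kappa>" by simp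
    then have "K * y \<le> \<kappa> / 4 * y\<^sup>2 + K\<^sup>2 / \<kappa>" using \<kappa> mult_le_cancel_right_pos by blast
    then have "K * y * Q \<le> (\<kappa> / 4 * y\<^sup>2 + K\<^sup>2 / \<kappa>) * Q" using Q by (intro mult_right_mono) auto
    also have "\<dots> \<le> \<kappa> / 4 * y\<^sup>2 * Q + K\<^sup>2 / \<kappa>"
      using mult_left_mono[OF Q(2), of "K\<^sup>2 / \<kappa>"] \<kappa> by (simp add: distrib_right)
    finally have "f\<^sup>2 * (K * y * Q) \<le> f\<^sup>2 * (\<kappa> / 4 * y\<^sup>2 * Q + K\<^sup>2 / \<kappa>)" by (intro mult_left_mono) auto
    then show ?thesis by (simp add: algebra_simps)
  qed
  have 3: "\<beta> * \<theta> * \<epsilon> * y * (f\<^sup>2 * (y * Q)) + f\<^sup>2 * a * (b - \<beta> * \<theta> * y * (y * Q)) \<le> 2 * f\<^sup>2 - \<kappa> * (f\<^sup>2 * (y\<^sup>2 * Q))"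
  proof -
    \<comment> \<open>The lower bound on the gradient of \<open>d\<close> enters here: it makes the
      derivative of the exponential weight outweigh the \<epsilon>-part of the Laplacian
      bound.\<close>
    have "\<beta> * \<theta> * (f\<^sup>2 * (y\<^sup>2 * Q)) * (1 / \<sigma>\<^sup>2) \<le> \<beta> * \<theta> * (f\<^sup>2 * (y\<^sup>2 * Q)) * a"
      using a \<beta> \<theta> Q by (intro mult_left_mono) auto
    moreover have "f\<^sup>2 * (a * b) \<le> f\<^sup>2 * 2" using ab by (intro mult_left_mono) auto
    ultimately show ?thesis by (simp add: \<kappa>_def power2_eq_square algebra_simps)
  qed
  have "(K + \<beta> * \<theta> * \<epsilon> * y) * (f\<^sup>2 * (y * Q)) + (2 * f * (G \<bullet> F) * (y * Q) + f\<^sup>2 * a * (b - \<beta> * \<theta> * y * (y * Q)))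
    \<le> 4 / \<kappa> * (norm F)\<^sup>2 + (2 + K\<^sup>2 / \<kappa>) * f\<^sup>2 - \<kappa> / 2 * (f\<^sup>2 * (y\<^sup>2 * Q))"
    using 1 2 3 by (simp add: algebra_simps)
  from mult_left_mono[OF this, of e] e show ?thesis
    unfolding cutoff_weight_def cutoff_weight_deriv_def cutoff_eq_frac y(2)[symmetric]
      Q_def[symmetric] a_def[symmetric] b_def[symmetric] y_def[symmetric]
    unfolding m e_def by (simp add: algebra_simps)
qed


section \<open>The U-bound with a truncation at distance \<open>R\<close>\<close>

locale drift =
  fixes X :: "'k::finite \<Rightarrow> 'a::euclidean_space \<Rightarrow> 'a" and d :: "'a \<Rightarrow> real" and \<theta> \<beta> \<sigma> K \<epsilon> :: real
  assumes X_smooth: "\<And>i. smooth (X i)" and X_div: "\<And>i x. divergence (X i) x = 0"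
    and d_nonneg: "\<And>x. 0 \<le> d x" and d_L: "d \<in> class_L X" and balls: "\<And>R. compact {x. d x \<le> R}"
    and theta: "1 \<le> \<theta>" "\<theta> \<le> 2" and beta: "0 < \<beta>" and sigma: "1 \<le> \<sigma>"
    and grad_d: "AE x in lborel. 1 / \<sigma> \<le> norm (grad X d x) \<and> norm (grad X d x) \<le> 1"
    and K: "0 \<le> K" and eps: "0 \<le> \<epsilon>" "\<epsilon> < 1 / \<sigma>\<^sup>2"
    and laplacian_d: "distr_laplacian_le X {x. d x > 1} d (\<lambda>x. K + \<beta> * \<theta> * \<epsilon> * d x powr (\<theta> - 1))"
begin

lemma class_L_continuous: "f \<in> class_L X \<Longrightarrow> continuous_on UNIV f"
  by (simp add: class_L_def)

lemma class_L_distr_deriv: "f \<in> class_L X \<Longrightarrow> has_distr_deriv (X i) f (distr_deriv (X i) f)"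
  unfolding class_L_def using has_distr_deriv_distr_deriv by blast

lemma distr_deriv_measurable: "f \<in> class_L X \<Longrightarrow> distr_deriv (X i) f \<in> borel_measurable borel"
  using class_L_distr_deriv[of f i] by (auto simp: has_distr_deriv_def locally_integrable_def)

lemma norm_grad_square: "(norm (grad X f x))\<^sup>2 = (\<Sum>i\<in>UNIV. (distr_deriv (X i) f x)\<^sup>2)"
  by (simp add: norm_vec_def L2_set_def grad_def sum_nonneg)

lemma inner_grad: "grad X f x \<bullet> grad X g x = (\<Sum>i\<in>UNIV. distr_deriv (X i) f x * distr_deriv (X i) g x)"
  by (simp add: inner_vec_def grad_def)

lemma d_cont: "continuous_on UNIV d" by (rule class_L_continuous[OF d_L])

lemma distr_deriv_d_le: "AE x in lborel. \<bar>distr_deriv (X i) d x\<bar> \<le> 1"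
  using grad_d
proof eventually_elim
  case (elim x)
  have "\<bar>grad X d x $ i\<bar> \<le> norm (grad X d x)" by (rule component_le_norm_cart)
  then show ?case using elim by (simp add: grad_def)
qed

definition weight :: "'a \<Rightarrow> real" where "weight x = exp (- \<beta> * d x powr \<theta>)"

lemma weight_continuous: "continuous_on UNIV weight"
  unfolding weight_def[abs_def]
  by (intro continuous_intros continuous_on_powr' d_cont) (use d_nonneg theta in auto)

lemma weight_measurable [measurable]: "weight \<in> borel_measurable borel"
  by (rule borel_measurable_continuous_onI[OF weight_continuous])

lemma weight_pos: "0 < weight x" by (simp add: weight_def)

text \<open>The net strength of the drift: the gain from the exponential weight minus the loss from
  the Laplacian bound. Its positivity is the condition on \<epsilon>.\<close>

definition kappa :: real where "kappa = \<beta> * \<theta> * (1 / \<sigma>\<^sup>2 - \<epsilon>)"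

lemma kappa_pos: "0 < kappa" unfolding kappa_def using theta beta eps by simp

lemma u_bound_cutoff:
  assumes f: "f \<in> class_L X" and R: "0 < R"
    and intF: "integrable lborel (\<lambda>x. weight x * (norm (grad X f x))\<^sup>2)"
    and intf: "integrable lborel (\<lambda>x. weight x * (f x)\<^sup>2)"
  shows "integrable lborel (\<lambda>x. weight x * (f x)\<^sup>2 * (max 1 (d x) powr (2 * (\<theta> - 1)) * cutoff_frac R (d x)))"
    "kappa / 2 * (LBINT x. weight x * (f x)\<^sup>2 * (max 1 (d x) powr (2 * (\<theta> - 1)) * cutoff_frac R (d x)))
      \<le> 4 / kappa * (LBINT x. weight x * (norm (grad X f x))\<^sup>2)
        + (2 + K\<^sup>2 / kappa) * (LBINT x. weight x * (f x)\<^sup>2)"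
proof -
  let ?G = "\<lambda>i. distr_deriv (X i) d" and ?F = "\<lambda>i. distr_deriv (X i) f"
  let ?w = "cutoff_weight \<beta> \<theta> R" and ?w' = "cutoff_weight_deriv \<beta> \<theta> R"
  define S where "S = {x. d x \<le> R} \<inter> {x. 3/2 \<le> d x}"
  have "closed {x. 3/2 \<le> d x}" using d_cont by (intro closed_Collect_le) auto
  then have S: "compact S" unfolding S_def using balls by (intro compact_Int_closed)
  have out: "?w (d x) = 0" "?w' (d x) = 0" if "x \<notin> S" for x
    using that cutoff_outside[OF R, of "d x" \<theta>]
    by (auto simp: S_def cutoff_weight_def cutoff_weight_deriv_def not_le)
  have U: "open {x. d x > 1}" using d_cont by (intro open_Collect_less) auto
  have SU: "S \<subseteq> {x. d x > 1}" by (auto simp: S_def)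
  note fc = class_L_continuous[OF f]
  have wc: "continuous_on UNIV (\<lambda>x. ?w (d x))" "continuous_on UNIV (\<lambda>x. ?w' (d x))"
    by (rule continuous_on_compose2[OF cutoff_weight_continuous[OF R] d_cont subset_UNIV])
      (rule continuous_on_compose2[OF cutoff_weight_deriv_continuous[OF R] d_cont subset_UNIV])
  \<comment> \<open>The test function: \<open>f\<close> squared times the Gibbs weight times the
    cutoff. Its support lies in \<open>S\<close>, which is compact and inside the region where the
    Laplacian bound holds.\<close>
  define \<psi> where "\<psi> x = f x * f x * ?w (d x)" for x
  define p where "p i x = (?F i x * f x + ?F i x * f x) * ?w (d x) + ?G i x * ?w' (d x) * (f x * f x)" for i x
  have dp: "has_distr_deriv (X i) \<psi> (p i)" for i
  proof -
    have "has_distr_deriv (X i) (\<lambda>x. ?w (d x)) (\<lambda>x. ?G i x * ?w' (d x))"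
      by (rule has_distr_deriv_chain[OF class_L_distr_deriv[OF d_L] d_cont d_nonneg X_smooth X_div])
        (rule has_field_derivative_at_within[OF cutoff_weight_has_derivative[OF R]], rule cutoff_weight_deriv_continuous[OF R])
    from has_distr_deriv_mult[OF has_distr_deriv_mult[OF class_L_distr_deriv[OF f] fc class_L_distr_deriv[OF f] fc X_smooth X_div]
        continuous_on_mult[OF fc fc] this wc(1) X_smooth X_div]
    show ?thesis unfolding \<psi>_def p_def .
  qed
  \<comment> \<open>The maximum with 1 alters nothing where \<open>d > 1\<close> and makes the bound
    continuous on the whole space, hence locally integrable, also where \<open>d\<close>
    vanishes.\<close>
  define h where "h x = K + \<beta> * \<theta> * \<epsilon> * max 1 (d x) powr (\<theta> - 1)" for x
  have hc: "continuous_on UNIV h"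
    unfolding h_def[abs_def] by (intro continuous_intros d_cont) (auto simp: max_def)
  have lap: "distr_laplacian_le X {x. d x > 1} d h"
    unfolding distr_laplacian_le_def
  proof (intro ballI impI)
    fix \<phi> assume \<phi>: "\<phi> \<in> test_functions {x. d x > 1}" "\<forall>x. 0 \<le> \<phi> x"
    obtain C where C: "C \<subseteq> {x. d x > 1}" "\<And>x. x \<notin> C \<Longrightarrow> \<phi> x = 0"
      by (rule test_functionsE[OF \<phi>(1)]) blast
    have hp: "h x * \<phi> x = (K + \<beta> * \<theta> * \<epsilon> * d x powr (\<theta> - 1)) * \<phi> x" for x
    proof (cases "x \<in> C")
      case True
      then have "d x > 1" using C by auto
      then show ?thesis by (simp add: h_def max_def)
    qed (simp add: C)
    show "(LBINT x. d x * (\<Sum>i\<in>UNIV. formal_adjoint (X i) (formal_adjoint (X i) \<phi>) x))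
          \<le> (LBINT x. h x * \<phi> x)"
      using laplacian_d \<phi> unfolding distr_laplacian_le_def hp by blast
  qed
  have \<psi>c: "continuous_on UNIV \<psi>" unfolding \<psi>_def[abs_def] by (intro continuous_on_mult fc wc)
  have ibp: "- (\<Sum>i\<in>UNIV. LBINT x. ?G i x * p i x) \<le> (LBINT x. h x * \<psi> x)"
  proof (rule distr_laplacian_le_ibp[OF X_smooth X_div class_L_distr_deriv[OF d_L] distr_deriv_d_le lap continuous_locally_integrable[OF hc] U S SU \<psi>c _ _ dp])
    show "0 \<le> \<psi> x" for x by (simp add: \<psi>_def cutoff_weight_def cutoff_nonneg)
    show "\<psi> x = 0" if "x \<notin> S" for x using out[OF that] by (simp add: \<psi>_def)
    show "p i x = 0" if "x \<notin> S" for i x using out[OF that] by (simp add: p_def)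
  qed
  have [measurable]: "?G i \<in> borel_measurable borel" "?F i \<in> borel_measurable borel" "f \<in> borel_measurable borel" "d \<in> borel_measurable borel" for i
    by (intro distr_deriv_measurable f d_L borel_measurable_continuous_onI fc d_cont)+
  have pint: "integrable lborel (p i)" for i
  proof -
    have "set_integrable lborel S (p i)" using dp[of i] S by (simp add: has_distr_deriv_def locally_integrable_def)
    moreover have "(\<lambda>x. indicator S x *\<^sub>R p i x) = p i"
    proof
      fix x show "indicator S x *\<^sub>R p i x = p i x"
        using out[of x] by (cases "x \<in> S") (auto simp: p_def)
    qed
    ultimately show ?thesis by (simp add: set_integrable_def)
  qed
  have Gpint: "integrable lborel (\<lambda>x. ?G i x * p i x)" for i
  proof (rule Bochner_Integration.integrable_bound[OF pint[of i]])
    show "(\<lambda>x. ?G i x * p i x) \<in> borel_measurable lborel"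
      using pint[of i] by (auto intro!: borel_measurable_times)
    show "AE x in lborel. norm (?G i x * p i x) \<le> norm (p i x)"
      using distr_deriv_d_le[of i] by eventually_elim (simp add: abs_mult mult_left_le_one_le)
  qed
  have hint: "integrable lborel (\<lambda>x. h x * \<psi> x)"
    by (rule compact_support_integrable[OF _ S])
      (use out in \<open>auto simp: \<psi>_def intro!: continuous_on_mult hc fc wc\<close>)
  let ?u = "\<lambda>x. weight x * (f x)\<^sup>2 * (max 1 (d x) powr (2 * (\<theta> - 1)) * cutoff_frac R (d x))"
  have cfc: "continuous_on UNIV (\<lambda>x. cutoff_frac R (d x))"
    unfolding cutoff_frac_def using R by (intro continuous_intros d_cont) (auto simp: max_def)
  show uint: "integrable lborel ?u"
  proof (rule compact_support_integrable[OF _ S])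
    show "continuous_on UNIV ?u"
      by (intro continuous_intros weight_continuous fc d_cont cfc) (auto simp: max_def)
    fix x assume "x \<notin> S"
    then have "cutoff 1 R (d x) = 0" using cutoff_outside[OF R, of "d x" 1] by (auto simp: S_def not_le)
    moreover have "max 1 (d x) \<noteq> 0" by (simp add: max_def)
    ultimately have "cutoff_frac R (d x) = 0" by (simp add: cutoff_eq_frac)
    then show "?u x = 0" by simp
  qed
  \<comment> \<open>The two sides of the integration by parts are collected into one integral, so
    that the pointwise estimate applies almost everywhere and the surviving negative term can be
    moved to the left.\<close>
  have "0 \<le> (LBINT x. h x * \<psi> x) + (\<Sum>i\<in>UNIV. LBINT x. ?G i x * p i x)" using ibp by simp
  also have "\<dots> = (LBINT x. h x * \<psi> x + (\<Sum>i\<in>UNIV. ?G i x * p i x))"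
    using hint Gpint by (simp add: Bochner_Integration.integral_sum)
  also have "\<dots> \<le> (LBINT x. 4 / kappa * (weight x * (norm (grad X f x))\<^sup>2)
      + (2 + K\<^sup>2 / kappa) * (weight x * (f x)\<^sup>2) - kappa / 2 * ?u x)"
  proof (rule integral_mono_AE)
    show "integrable lborel (\<lambda>x. h x * \<psi> x + (\<Sum>i\<in>UNIV. ?G i x * p i x))"
      using hint Gpint by auto
    show "integrable lborel (\<lambda>x. 4 / kappa * (weight x * (norm (grad X f x))\<^sup>2)
      + (2 + K\<^sup>2 / kappa) * (weight x * (f x)\<^sup>2) - kappa / 2 * ?u x)"
      using intF intf uint by (intro Bochner_Integration.integrable_add Bochner_Integration.integrable_diff integrable_mult_right)
    show "AE x in lborel. h x * \<psi> x + (\<Sum>i\<in>UNIV. ?G i x * p i x) \<le> 4 / kappa * (weight x * (norm (grad X f x))\<^sup>2)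
      + (2 + K\<^sup>2 / kappa) * (weight x * (f x)\<^sup>2) - kappa / 2 * ?u x"
      using grad_d
    proof eventually_elim
      case (elim x)
      have "(\<Sum>i\<in>UNIV. ?G i x * p i x) = 2 * f x * (grad X d x \<bullet> grad X f x) * ?w (d x) + (f x)\<^sup>2 * (norm (grad X d x))\<^sup>2 * ?w' (d x)"
        unfolding norm_grad_square inner_grad p_def sum_distrib_left sum_distrib_right sum.distrib[symmetric]
        by (intro sum.cong refl) (simp add: power2_eq_square algebra_simps)
      then have "h x * \<psi> x + (\<Sum>i\<in>UNIV. ?G i x * p i x) =
         (K + \<beta> * \<theta> * \<epsilon> * max 1 (d x) powr (\<theta> - 1)) * ((f x)\<^sup>2 * ?w (d x)) +
         (2 * f x * (grad X d x \<bullet> grad X f x) * ?w (d x) + (f x)\<^sup>2 * (norm (grad X d x))\<^sup>2 * ?w' (d x))"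
        by (simp add: h_def \<psi>_def power2_eq_square)
      also have "\<dots> \<le> exp (- \<beta> * d x powr \<theta>) * (4 / kappa * (norm (grad X f x))\<^sup>2 + (2 + K\<^sup>2 / kappa) * (f x)\<^sup>2
          - kappa / 2 * ((f x)\<^sup>2 * (max 1 (d x) powr (2 * (\<theta> - 1)) * cutoff_frac R (d x))))"
        using elim by (intro u_bound_pointwise[OF kappa_def d_nonneg R theta beta sigma _ _ K eps]) auto
      also have "\<dots> = 4 / kappa * (weight x * (norm (grad X f x))\<^sup>2)
      + (2 + K\<^sup>2 / kappa) * (weight x * (f x)\<^sup>2) - kappa / 2 * ?u x"
        by (simp add: weight_def algebra_simps)
      finally show ?case .
    qed
  qed
  also have "\<dots> = 4 / kappa * (LBINT x. weight x * (norm (grad X f x))\<^sup>2)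
        + (2 + K\<^sup>2 / kappa) * (LBINT x. weight x * (f x)\<^sup>2) - kappa / 2 * (LBINT x. ?u x)"
    using intF intf uint by simp
  finally show "kappa / 2 * (LBINT x. ?u x)
      \<le> 4 / kappa * (LBINT x. weight x * (norm (grad X f x))\<^sup>2)
        + (2 + K\<^sup>2 / kappa) * (LBINT x. weight x * (f x)\<^sup>2)" by simp
qed

end

section \<open>The logarithmic inequality\<close>

lemma locally_ess_bounded_mult:
  assumes "locally_ess_bounded g" "continuous_on UNIV u"
  shows "locally_ess_bounded (\<lambda>x. g x * u x)"
  unfolding locally_ess_bounded_def
proof (intro conjI allI impI)
  show "(\<lambda>x. g x * u x) \<in> borel_measurable borel"
    using assms(1) borel_measurable_continuous_onI[OF assms(2)]
    by (simp add: locally_ess_bounded_def borel_measurable_times)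
  fix C :: "'a set" assume C: "compact C"
  obtain B where B: "\<And>x. x \<in> C \<Longrightarrow> \<bar>u x\<bar> \<le> B"
    by (rule continuous_bounded_on_compact[OF assms(2) C]) blast
  obtain M where M: "AE x in lborel. x \<in> C \<longrightarrow> \<bar>g x\<bar> \<le> M"
    using assms(1) C unfolding locally_ess_bounded_def by blast
  have "AE x in lborel. x \<in> C \<longrightarrow> \<bar>g x * u x\<bar> \<le> \<bar>M\<bar> * \<bar>B\<bar>"
    using M
  proof eventually_elim
    case (elim x)
    show ?case
    proof
      assume x: "x \<in> C"
      show "\<bar>g x * u x\<bar> \<le> \<bar>M\<bar> * \<bar>B\<bar>"
        unfolding abs_mult using B[OF x] elim x by (intro mult_mono) auto
    qed
  qed
  then show "\<exists>M. AE x in lborel. x \<in> C \<longrightarrow> \<bar>g x * u x\<bar> \<le> M" by blast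
qed

lemma locally_ess_bounded_add:
  assumes "locally_ess_bounded g" "locally_ess_bounded h"
  shows "locally_ess_bounded (\<lambda>x. g x + h x)"
  unfolding locally_ess_bounded_def
proof (intro conjI allI impI)
  show "(\<lambda>x. g x + h x) \<in> borel_measurable borel"
    using assms by (auto simp: locally_ess_bounded_def)
  fix C :: "'a set" assume C: "compact C"
  obtain M where M: "AE x in lborel. x \<in> C \<longrightarrow> \<bar>g x\<bar> \<le> M"
    using assms(1) C unfolding locally_ess_bounded_def by blast
  obtain M' where M': "AE x in lborel. x \<in> C \<longrightarrow> \<bar>h x\<bar> \<le> M'"
    using assms(2) C unfolding locally_ess_bounded_def by blast
  have "AE x in lborel. x \<in> C \<longrightarrow> \<bar>g x + h x\<bar> \<le> M + M'"
    using M M' by eventually_elim auto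
  then show "\<exists>M. AE x in lborel. x \<in> C \<longrightarrow> \<bar>g x + h x\<bar> \<le> M" by blast
qed

lemma class_L_mult:
  assumes "f \<in> class_L X" "g \<in> class_L X"
    and X: "\<And>i. smooth (X i)" "\<And>i x. divergence (X i) x = 0"
  shows "(\<lambda>x. f x * g x) \<in> class_L X"
  unfolding class_L_def
proof (intro CollectI conjI allI)
  have fc: "continuous_on UNIV f" and gc: "continuous_on UNIV g" using assms by (auto simp: class_L_def)
  show "continuous_on UNIV (\<lambda>x. f x * g x)" by (intro continuous_on_mult fc gc)
  fix i
  obtain F G where "has_distr_deriv (X i) f F" "locally_ess_bounded F" "has_distr_deriv (X i) g G" "locally_ess_bounded G"
    using assms unfolding class_L_def by blast
  then show "\<exists>h. has_distr_deriv (X i) (\<lambda>x. f x * g x) h \<and> locally_ess_bounded h"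
    by (intro exI[of _ "\<lambda>x. F x * g x + G x * f x"] conjI has_distr_deriv_mult locally_ess_bounded_add
        locally_ess_bounded_mult fc gc X)
qed

lemma class_L_chain:
  assumes f: "f \<in> class_L X" "\<And>x. 0 \<le> f x"
    and X: "\<And>i. smooth (X i)" "\<And>i x. divergence (X i) x = 0"
    and g: "\<And>t. 0 \<le> t \<Longrightarrow> (g has_real_derivative g' t) (at t within {0..})"
    and g': "continuous_on {0..} g'"
  shows "(\<lambda>x. g (f x)) \<in> class_L X"
  unfolding class_L_def
proof (intro CollectI conjI allI)
  have fc: "continuous_on UNIV f" using f by (auto simp: class_L_def)
  have "continuous_on {0..} g" using g by (auto intro!: DERIV_continuous_on)
  then show "continuous_on UNIV (\<lambda>x. g (f x))" using f fc by (auto intro: continuous_on_compose2)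
  have c': "continuous_on UNIV (\<lambda>x. g' (f x))" using f fc by (auto intro: continuous_on_compose2[OF g'])
  fix i
  obtain F where F: "has_distr_deriv (X i) f F" "locally_ess_bounded F"
    using f unfolding class_L_def by blast
  have "has_distr_deriv (X i) (\<lambda>x. g (f x)) (\<lambda>x. F x * g' (f x))"
    by (rule has_distr_deriv_chain[OF F(1) fc f(2) X]) (erule g, rule g')
  then show "\<exists>h. has_distr_deriv (X i) (\<lambda>x. g (f x)) h \<and> locally_ess_bounded h"
    using locally_ess_bounded_mult[OF F(2) c'] by blast
qed

section \<open>Elementary inequalities for powers and logarithms\<close>

lemma powr_add_le:
  fixes a b s :: real
  assumes "0 \<le> a" "0 \<le> b" "0 < s" "s \<le> 1"
  shows "(a + b) powr s \<le> a powr s + b powr s"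
proof (cases "a + b = 0")
  case False
  then have ab: "a + b > 0" using assms by simp
  \<comment> \<open>Numbers in the unit interval increase when raised to a power at most 1. Applied
    to the two fractions that sum to 1, this is subadditivity.\<close>
  have *: "c / (a + b) \<le> (c / (a + b)) powr s" if "0 \<le> c" "c \<le> a + b" for c
  proof (cases "c = 0")
    case False
    then have "(c / (a + b)) powr 1 \<le> (c / (a + b)) powr s"
      using that ab assms by (intro powr_mono') auto
    then show ?thesis using that ab by simp
  qed (use assms in simp)
  have "1 = a / (a + b) + b / (a + b)" using ab by (simp add: add_divide_distrib[symmetric])
  also have "\<dots> \<le> (a / (a + b)) powr s + (b / (a + b)) powr s"
    using assms by (intro add_mono *) auto
  also have "\<dots> = (a powr s + b powr s) / (a + b) powr s"
    using assms ab by (simp add: powr_divide add_divide_distrib)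
  finally show ?thesis using ab by (simp add: field_simps)
qed (use assms in simp)

lemma powr_le_one_plus: "0 \<le> (x::real) \<Longrightarrow> 0 < s \<Longrightarrow> s \<le> 1 \<Longrightarrow> x powr s \<le> 1 + x"
proof (cases "x \<le> 1")
  case True
  assume "0 \<le> x" "0 < s" "s \<le> 1"
  then have "x powr s \<le> 1" using True by (intro powr_le1) auto
  then show ?thesis using \<open>0 \<le> x\<close> by simp
next
  case False
  assume "0 \<le> x" "0 < s" "s \<le> 1"
  then have "x powr s \<le> x powr 1" using False by (intro powr_mono) auto
  then show ?thesis using False by simp
qed

text \<open>Here \<open>w\<close> is the density of the measure and \<open>w * u\<close> becomes \<open>g\<^sup>2\<close>, where \<open>g\<close> is the
  function that goes into the Sobolev inequality.\<close>

lemma log_power_pointwise: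
  fixes u w U z s :: real
  assumes u: "0 < u" and w: "w = exp (- U) / z" and z: "0 < z" and U: "0 \<le> U" and s: "0 < s" "s \<le> 1"
  shows "w * (u * \<bar>ln u\<bar> powr s) \<le> w + (1 + \<bar>ln z\<bar>) * (w * u) + w * u * max 0 (ln (w * u)) + w * u * U powr s"
proof -
  have w0: "w > 0" using w z by simp
  have "u * \<bar>ln u\<bar> powr s \<le> 1 + (1 + \<bar>ln z\<bar>) * u + u * max 0 (ln (w * u)) + u * U powr s"
  proof (cases "u \<ge> 1")
    case True
    \<comment> \<open>For \<open>u \<ge> 1\<close> the logarithm is nonnegative, so only the
      positive part of \<open>ln (w * u)\<close> counts, and subadditivity of the power isolates
      \<open>U powr s\<close>.\<close>
    have "ln (w * u) = ln u - U - ln z"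
      using w0 u z by (simp add: ln_mult w ln_div)
    then have "\<bar>ln u\<bar> \<le> (max 0 (ln (w * u)) + \<bar>ln z\<bar>) + U" using True by (simp add: ln_ge_zero)
    then have "\<bar>ln u\<bar> powr s \<le> ((max 0 (ln (w * u)) + \<bar>ln z\<bar>) + U) powr s"
      using s by (intro powr_mono2) auto
    also have "\<dots> \<le> (max 0 (ln (w * u)) + \<bar>ln z\<bar>) powr s + U powr s"
      using U s by (intro powr_add_le) auto
    also have "\<dots> \<le> 1 + (max 0 (ln (w * u)) + \<bar>ln z\<bar>) + U powr s"
      using s by (intro add_mono powr_le_one_plus) auto
    finally have "u * \<bar>ln u\<bar> powr s \<le> u * (1 + (max 0 (ln (w * u)) + \<bar>ln z\<bar>) + U powr s)"
      using u by (intro mult_left_mono) auto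
    then show ?thesis by (simp add: algebra_simps)
  next
    case False
    \<comment> \<open>For small \<open>u\<close> the singularity of the logarithm is harmless:
      \<open>u * (1 + \<bar>ln u\<bar>)\<close> is at most 1, and the first term on the right, the
      bare density \<open>w\<close>, pays for it.\<close>
    then have "\<bar>ln u\<bar> = ln (1 / u)" using u by (simp add: ln_div ln_le_zero_iff)
    also have "\<dots> \<le> 1 / u - 1" using u by (intro ln_le_minus_one) auto
    finally have "u * (1 + \<bar>ln u\<bar>) \<le> u * (1 / u)" using u by (intro mult_left_mono) auto
    moreover have "u * \<bar>ln u\<bar> powr s \<le> u * (1 + \<bar>ln u\<bar>)"
      using u s by (intro mult_left_mono powr_le_one_plus) auto
    moreover have "u * (1 / u) = 1" using u by simp
    ultimately have "u * \<bar>ln u\<bar> powr s \<le> 1" by linarith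
    moreover have "0 \<le> (1 + \<bar>ln z\<bar>) * u + u * max 0 (ln (w * u)) + u * U powr s"
      using u by (intro add_nonneg_nonneg mult_nonneg_nonneg) auto
    ultimately show ?thesis by linarith
  qed
  from mult_left_mono[OF this, of w] w0 show ?thesis by (simp add: algebra_simps)
qed

text \<open>From \<open>ln x \<le> x\<close> at \<open>x = t powr \<delta> / A\<close>. The
  parameter \<open>A\<close> is free, to be chosen later as the size of the integral of
  \<open>t powr (2 + \<delta>)\<close>.\<close>

lemma entropy_pointwise:
  fixes t A \<delta> :: real
  assumes "0 \<le> t" "1 \<le> A" "0 < \<delta>"
  shows "t\<^sup>2 * max 0 (ln (t\<^sup>2)) \<le> 2 / \<delta> * (t powr (2 + \<delta>) / A + ln A * t\<^sup>2)"
proof (cases "t < 1")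
  case True
  then have "ln (t\<^sup>2) \<le> 0"
    using assms power_le_one[of t 2] by (cases "t = 0") (auto simp: ln_le_zero_iff)
  then have "max 0 (ln (t\<^sup>2)) = 0" by simp
  then show ?thesis using assms by simp
next
  case False
  have "ln (t powr \<delta> / A) \<le> t powr \<delta> / A" using assms False by (intro ln_bound) auto
  then have "\<delta> * ln t \<le> t powr \<delta> / A + ln A" using assms False by (simp add: ln_div ln_powr)
  moreover have "ln (t\<^sup>2) = 2 / \<delta> * (\<delta> * ln t)" using False assms by (simp add: ln_realpow)
  ultimately have "ln (t\<^sup>2) \<le> 2 / \<delta> * (t powr \<delta> / A + ln A)"
    using assms by (simp only:) (intro mult_left_mono, auto)
  moreover have "0 \<le> 2 / \<delta> * (t powr \<delta> / A + ln A)" using assms by simp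
  ultimately have "t\<^sup>2 * max 0 (ln (t\<^sup>2)) \<le> t\<^sup>2 * (2 / \<delta> * (t powr \<delta> / A + ln A))"
    by (intro mult_left_mono) auto
  also have "t powr (2 + \<delta>) = t\<^sup>2 * t powr \<delta>" using False by (simp add: powr_add)
  then have "t\<^sup>2 * (2 / \<delta> * (t powr \<delta> / A + ln A)) = 2 / \<delta> * (t powr (2 + \<delta>) / A + ln A * t\<^sup>2)"
    by (simp add: algebra_simps)
  finally show ?thesis .
qed

text \<open>With \<open>A\<close> at least the integral of the power \<open>2 + \<delta>\<close>,
  the first term of the pointwise bound integrates to at most a constant. What remains is
  \<open>ln A\<close>, and a logarithm absorbs the exponent \<open>2 / (2 + \<delta>)\<close> of the
  Sobolev inequality as a factor, so the result is linear in \<open>S\<close>.\<close>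

lemma nn_integral_entropy_le:
  fixes g :: "'a::euclidean_space \<Rightarrow> real"
  assumes g: "continuous_on UNIV g" "(\<integral>\<^sup>+x. ennreal ((g x)\<^sup>2) \<partial>lborel) = 1"
    and \<delta>: "0 < \<delta>" and S: "0 \<le> S"
    and sob: "ennpowr (\<integral>\<^sup>+x. ennreal (\<bar>g x\<bar> powr (2 + \<delta>)) \<partial>lborel) (2 / (2 + \<delta>)) \<le> ennreal S"
  shows "(\<integral>\<^sup>+x. ennreal ((g x)\<^sup>2 * max 0 (ln ((g x)\<^sup>2))) \<partial>lborel) \<le> ennreal (2 / \<delta> * (1 + (2 + \<delta>) / 2 * S))"
proof -
  have [measurable]: "g \<in> borel_measurable borel" by (rule borel_measurable_continuous_onI[OF g(1)])
  let ?I = "\<integral>\<^sup>+x. ennreal (\<bar>g x\<bar> powr (2 + \<delta>)) \<partial>lborel"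
  have "?I \<noteq> \<infinity>" using sob by (auto simp: ennpowr_def top_unique)
  then obtain P where P: "0 \<le> P" "?I = ennreal P" by (cases ?I) auto
  have PS: "P powr (2 / (2 + \<delta>)) \<le> S" using sob P S by (simp add: ennpowr_def)
  \<comment> \<open>The maximum keeps \<open>ln A\<close> nonnegative when the integral is
    small.\<close>
  define A where "A = max 1 P"
  have A: "1 \<le> A" "P / A \<le> 1" using P by (auto simp: A_def field_simps)
  have lnA: "ln A \<le> (2 + \<delta>) / 2 * S"
  proof (cases "P \<le> 1")
    case True
    then show ?thesis using S \<delta> by (simp add: A_def)
  next
    case False
    have "2 / (2 + \<delta>) * ln P = ln (P powr (2 / (2 + \<delta>)))" using False by (simp add: ln_powr)
    also have "\<dots> \<le> P powr (2 / (2 + \<delta>))" using False by (intro ln_bound) auto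
    also have "\<dots> \<le> S" by (rule PS)
    finally show ?thesis using False \<delta> by (simp add: A_def max_def field_simps)
  qed
  have "(\<integral>\<^sup>+x. ennreal ((g x)\<^sup>2 * max 0 (ln ((g x)\<^sup>2))) \<partial>lborel) \<le>
     (\<integral>\<^sup>+x. ennreal (2 / \<delta> / A) * ennreal (\<bar>g x\<bar> powr (2 + \<delta>)) + ennreal (2 / \<delta> * ln A) * ennreal ((g x)\<^sup>2) \<partial>lborel)"
  proof (rule nn_integral_mono)
    fix x
    have "(g x)\<^sup>2 * max 0 (ln ((g x)\<^sup>2)) \<le> 2 / \<delta> / A * \<bar>g x\<bar> powr (2 + \<delta>) + 2 / \<delta> * ln A * (g x)\<^sup>2"
      using entropy_pointwise[of "\<bar>g x\<bar>" A \<delta>] A \<delta> by (simp add: algebra_simps)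
    moreover have "0 \<le> 2 / \<delta> / A" "0 \<le> 2 / \<delta> * ln A" using A \<delta> by auto
    then have "ennreal (2 / \<delta> / A * \<bar>g x\<bar> powr (2 + \<delta>) + 2 / \<delta> * ln A * (g x)\<^sup>2) =
        ennreal (2 / \<delta> / A) * ennreal (\<bar>g x\<bar> powr (2 + \<delta>)) + ennreal (2 / \<delta> * ln A) * ennreal ((g x)\<^sup>2)"
      by (subst ennreal_plus) (auto simp only: ennreal_mult powr_ge_zero zero_le_power2 intro!: mult_nonneg_nonneg)
    ultimately show "ennreal ((g x)\<^sup>2 * max 0 (ln ((g x)\<^sup>2))) \<le>
        ennreal (2 / \<delta> / A) * ennreal (\<bar>g x\<bar> powr (2 + \<delta>)) + ennreal (2 / \<delta> * ln A) * ennreal ((g x)\<^sup>2)"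
      using ennreal_leI by metis
  qed
  also have "\<dots> = ennreal (2 / \<delta> / A) * ?I + ennreal (2 / \<delta> * ln A) * 1"
    by (simp add: nn_integral_add nn_integral_cmult g(2))
  also have "\<dots> = ennreal (2 / \<delta> * (P / A + ln A))"
    unfolding P(2) using A \<delta> P(1) by (simp add: ennreal_mult[symmetric] ennreal_plus[symmetric] algebra_simps del: ennreal_plus)
  also have "\<dots> \<le> ennreal (2 / \<delta> * (1 + (2 + \<delta>) / 2 * S))"
    using A lnA \<delta> by (intro ennreal_leI mult_left_mono add_mono) auto
  finally show ?thesis .
qed

text \<open>At 0 the difference quotient of \<open>t powr \<theta>\<close> is
  \<open>t powr (\<theta> - 1)\<close>, which tends to 0 exactly because \<theta> > 1. For \<theta>
  = 1 the derivative as written, with \<open>0 powr 0 = 0\<close>, would be wrong there.\<close>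

lemma exp_powr_has_derivative:
  fixes \<theta> c t :: real
  assumes "1 < \<theta>" "0 \<le> t"
  shows "((\<lambda>t. exp (- c * t powr \<theta>)) has_real_derivative - c * \<theta> * t powr (\<theta> - 1) * exp (- c * t powr \<theta>)) (at t within {0..})"
proof -
  have D: "((\<lambda>t. t powr \<theta>) has_real_derivative \<theta> * t powr (\<theta> - 1)) (at t within {0..})"
  proof (cases "t = 0")
    case False
    then show ?thesis using assms by (auto intro!: derivative_eq_intros)
  next
    case True
    have "continuous_on {0..} (\<lambda>t::real. t powr (\<theta> - 1))"
      using assms by (intro continuous_on_powr' continuous_intros) auto
    then have "((\<lambda>t. t powr (\<theta> - 1)) \<longlongrightarrow> 0 powr (\<theta> - 1)) (at 0 within {0..})"
      by (simp only: continuous_on_def) (erule bspec, simp)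
    moreover have "\<forall>\<^sub>F y in at 0 within {0..}. y powr (\<theta> - 1) = (y powr \<theta> - 0 powr \<theta>) / (y - 0)"
      by (auto simp: eventually_at_filter powr_diff)
    ultimately have "((\<lambda>y. (y powr \<theta> - 0 powr \<theta>) / (y - 0)) \<longlongrightarrow> 0 powr (\<theta> - 1)) (at 0 within {0..})"
      by (rule Lim_transform_eventually)
    then show ?thesis using True by (simp add: has_field_derivative_iff)
  qed
  show ?thesis
    by (rule DERIV_cong[OF DERIV_chain'[OF DERIV_cmult[OF D, of "-c"] DERIV_exp]]) simp
qed

section \<open>The full U-bound and the inequality for normalised functions\<close>

context drift
begin

text \<open>Fatou's lemma lets the truncation radius tend to infinity. What the inner cutoff removes
  lies near the origin, where the power of \<open>d\<close> is bounded and the mass of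
  \<open>f\<close> suffices.\<close>

lemma u_bound:
  assumes f: "f \<in> class_L X"
    and intF: "integrable lborel (\<lambda>x. weight x * (norm (grad X f x))\<^sup>2)"
    and intf: "integrable lborel (\<lambda>x. weight x * (f x)\<^sup>2)"
  shows "integrable lborel (\<lambda>x. weight x * (f x)\<^sup>2 * d x powr (2 * (\<theta> - 1)))" (is ?int)
    "(LBINT x. weight x * (f x)\<^sup>2 * d x powr (2 * (\<theta> - 1))) \<le>
       32 / kappa\<^sup>2 * (LBINT x. weight x * (norm (grad X f x))\<^sup>2)
       + (8 / kappa * (2 + K\<^sup>2 / kappa) + 9) * (LBINT x. weight x * (f x)\<^sup>2)" (is "_ \<le> ?b")
proof -
  let ?F = "LBINT x. weight x * (norm (grad X f x))\<^sup>2" and ?f = "LBINT x. weight x * (f x)\<^sup>2"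
  note kp = kappa_pos
  have [measurable]: "f \<in> borel_measurable borel" "d \<in> borel_measurable borel"
    by (intro borel_measurable_continuous_onI class_L_continuous f d_L)+
  \<comment> \<open>The truncated U-bound divided by \<open>kappa / 2\<close>. The factor 4 in the
    comparison below turns the two coefficients into \<open>32 / kappa\<^sup>2\<close> and
    \<open>8 / kappa\<close> times the bracket.\<close>
  define B where "B = 2 / kappa * (4 / kappa * ?F + (2 + K\<^sup>2 / kappa) * ?f)"
  have nonneg: "0 \<le> ?F" "0 \<le> ?f" by (auto intro!: integral_nonneg_AE simp: weight_pos less_imp_le)
  have B: "0 \<le> B" unfolding B_def using kp nonneg by simp
  define q where "q n x = weight x * (f x)\<^sup>2 * (max 1 (d x) powr (2 * (\<theta> - 1)) * cutoff_frac (real (Suc n)) (d x))" for n x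
  define q' where "q' x = weight x * (f x)\<^sup>2 * (max 1 (d x) powr (2 * (\<theta> - 1)) * (max 0 (d x - 3/2) / max 1 (d x))\<^sup>2)" for x
  have qint: "integrable lborel (q n)" and qle: "(LBINT x. q n x) \<le> B" for n
  proof -
    have "0 < real (Suc n)" by simp
    note * = u_bound_cutoff[OF f this intF intf]
    show "integrable lborel (q n)" using *(1) unfolding q_def .
    show "(LBINT x. q n x) \<le> B"
      using mult_left_mono[OF *(2), of "2 / kappa"] kp unfolding q_def B_def by simp
  qed
  have q0: "0 \<le> q n x" for n x
    unfolding q_def by (intro mult_nonneg_nonneg) (auto simp: weight_pos less_imp_le cutoff_frac_def)
  have [measurable]: "q n \<in> borel_measurable borel" for n using qint[of n] by auto
  have lim: "(\<lambda>n. q n x) \<longlonglongrightarrow> q' x" for x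
  proof -
    have "(\<lambda>n. d x * inverse (real (Suc n))) \<longlonglongrightarrow> d x * 0"
      by (intro tendsto_mult tendsto_const LIMSEQ_inverse_real_of_nat)
    then have "(\<lambda>n. (max 0 (1 - d x / real (Suc n)))\<^sup>2) \<longlonglongrightarrow> (max 0 (1 - d x * 0))\<^sup>2"
      unfolding divide_inverse by (intro tendsto_power tendsto_max tendsto_const tendsto_diff)
    then show ?thesis
      unfolding q_def q'_def cutoff_frac_def
      by (intro tendsto_mult tendsto_const) (auto intro: tendsto_eq_intros)
  qed
  have "(\<integral>\<^sup>+x. ennreal (q' x) \<partial>lborel) = (\<integral>\<^sup>+x. liminf (\<lambda>n. ennreal (q n x)) \<partial>lborel)"
    by (intro nn_integral_cong lim_imp_Liminf[symmetric] tendsto_ennrealI lim) simp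
  also have "\<dots> \<le> liminf (\<lambda>n. \<integral>\<^sup>+x. ennreal (q n x) \<partial>lborel)"
    by (rule nn_integral_liminf) measurable
  also have "\<dots> \<le> ennreal B"
  proof (rule Liminf_le)
    show "\<forall>\<^sub>F n in sequentially. (\<integral>\<^sup>+x. ennreal (q n x) \<partial>lborel) \<le> ennreal B"
      using qle by (intro always_eventually allI) (simp add: nn_integral_eq_integral[OF qint] q0 ennreal_leI)
  qed simp
  finally have q'B: "(\<integral>\<^sup>+x. ennreal (q' x) \<partial>lborel) \<le> ennreal B" .
  have q'0: "0 \<le> q' x" for x
    unfolding q'_def by (intro mult_nonneg_nonneg) (auto simp: weight_pos less_imp_le)
  \<comment> \<open>Below distance 3 the power is at most \<open>3 powr 2\<close>, which is the 9.
    Beyond it the ratio \<open>(d x - 3/2) / d x\<close> is at least one half, and undoing its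
    square costs the factor 4.\<close>
  have pt: "weight x * (f x)\<^sup>2 * d x powr (2 * (\<theta> - 1)) \<le> 9 * (weight x * (f x)\<^sup>2) + 4 * q' x" for x
  proof -
    have wf: "0 \<le> weight x * (f x)\<^sup>2" by (simp add: weight_pos less_imp_le)
    have "d x powr (2 * (\<theta> - 1)) \<le> 9 + 4 * (max 1 (d x) powr (2 * (\<theta> - 1)) * (max 0 (d x - 3/2) / max 1 (d x))\<^sup>2)"
    proof (cases "d x < 3")
      case True
      have "d x powr (2 * (\<theta> - 1)) \<le> 3 powr (2 * (\<theta> - 1))"
        using True theta d_nonneg by (intro powr_mono2) auto
      also have "\<dots> \<le> 3 powr 2" using theta by (intro powr_mono) auto
      also have "\<dots> = 9" by (subst powr_numeral) auto
      finally show ?thesis by (simp add: add_increasing2)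
    next
      case False
      have "1 / 2 \<le> max 0 (d x - 3/2) / max 1 (d x)" using False by (simp add: field_simps)
      then have "(1 / 2)\<^sup>2 \<le> (max 0 (d x - 3/2) / max 1 (d x))\<^sup>2" by (intro power_mono) auto
      then have "d x powr (2 * (\<theta> - 1)) * (1 / 4) \<le> d x powr (2 * (\<theta> - 1)) * (max 0 (d x - 3/2) / max 1 (d x))\<^sup>2"
        by (intro mult_left_mono) (auto simp: power_divide)
      moreover have "max 1 (d x) = d x" using False by simp
      ultimately show ?thesis by simp
    qed
    from mult_left_mono[OF this wf] show ?thesis by (simp add: q'_def algebra_simps)
  qed
  have mq: "q' \<in> borel_measurable borel"
    by (rule borel_measurable_LIMSEQ_real[where u=q]) (use lim in auto)
  have q'int: "integrable lborel q'"
    using q'B q'0 mq by (intro integrableI_bounded) (auto simp: top_unique less_top[symmetric] abs_of_nonneg)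
  have q'le: "(LBINT x. q' x) \<le> B"
    using q'B B by (simp add: nn_integral_eq_integral[OF q'int] q'0)
  show ?int
  proof (rule Bochner_Integration.integrable_bound)
    show "integrable lborel (\<lambda>x. 9 * (weight x * (f x)\<^sup>2) + 4 * q' x)" using intf q'int by auto
    show "(\<lambda>x. weight x * (f x)\<^sup>2 * d x powr (2 * (\<theta> - 1))) \<in> borel_measurable lborel" by measurable
    show "AE x in lborel. norm (weight x * (f x)\<^sup>2 * d x powr (2 * (\<theta> - 1))) \<le> norm (9 * (weight x * (f x)\<^sup>2) + 4 * q' x)"
      using pt q'0 by (intro always_eventually allI) (simp add: abs_of_nonneg weight_pos less_imp_le)
  qed
  from integral_mono[OF this _ pt] have "(LBINT x. weight x * (f x)\<^sup>2 * d x powr (2 * (\<theta> - 1))) \<le>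
      (LBINT x. 9 * (weight x * (f x)\<^sup>2) + 4 * q' x)"
    using intf q'int by simp
  also have "\<dots> = 9 * ?f + 4 * (LBINT x. q' x)" using intf q'int by simp
  also have "\<dots> \<le> 9 * ?f + 4 * B" using q'le by simp
  also have "\<dots> = ?b" by (simp add: B_def power2_eq_square algebra_simps)
  finally show "(LBINT x. weight x * (f x)\<^sup>2 * d x powr (2 * (\<theta> - 1))) \<le> ?b" .
qed

text \<open>The square root of the weight, so that \<open>f * half_weight\<close> carries the
  weighted L2 mass of \<open>f\<close> over to Lebesgue measure.\<close>

definition half_weight :: "'a \<Rightarrow> real" where "half_weight x = exp (- (\<beta> / 2) * d x powr \<theta>)"

lemma half_weight_square: "(half_weight x)\<^sup>2 = weight x"
  by (simp add: half_weight_def weight_def power2_eq_square exp_add[symmetric])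

lemma half_weight:
  assumes "1 < \<theta>"
  shows "half_weight \<in> class_L X"
    "has_distr_deriv (X i) half_weight (\<lambda>x. distr_deriv (X i) d x * (- (\<beta> / 2) * \<theta> * d x powr (\<theta> - 1) * exp (- (\<beta> / 2) * d x powr \<theta>)))"
proof -
  have c: "continuous_on {0..} (\<lambda>t. - (\<beta> / 2) * \<theta> * t powr (\<theta> - 1) * exp (- (\<beta> / 2) * t powr \<theta>))"
    using assms by (intro continuous_intros continuous_on_powr') auto
  show "half_weight \<in> class_L X"
    unfolding half_weight_def[abs_def]
    by (rule class_L_chain[OF d_L d_nonneg X_smooth X_div _ c]) (rule exp_powr_has_derivative[OF assms])
  show "has_distr_deriv (X i) half_weight (\<lambda>x. distr_deriv (X i) d x * (- (\<beta> / 2) * \<theta> * d x powr (\<theta> - 1) * exp (- (\<beta> / 2) * d x powr \<theta>)))"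
    unfolding half_weight_def[abs_def]
    by (rule has_distr_deriv_chain[OF class_L_distr_deriv[OF d_L] d_cont d_nonneg X_smooth X_div _ c]) (rule exp_powr_has_derivative[OF assms])
qed

text \<open>The derivative of \<open>half_weight\<close> brings out
  \<open>- (\<beta> / 2) * \<theta> * d powr (\<theta> - 1)\<close> times the gradient of
  \<open>d\<close>, of length at most 1. Squaring the two-term sum doubles each square; the last
  term is the one that the U-bound controls.\<close>

lemma grad_half_weight_mult:
  assumes f: "f \<in> class_L X" and \<theta>: "1 < \<theta>"
  shows "AE x in lborel. (norm (grad X (\<lambda>x. f x * half_weight x) x))\<^sup>2 \<le>
     2 * (weight x * (norm (grad X f x))\<^sup>2) + \<beta>\<^sup>2 * \<theta>\<^sup>2 / 2 * (weight x * (f x)\<^sup>2 * d x powr (2 * (\<theta> - 1)))"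
proof -
  let ?G = "\<lambda>i. distr_deriv (X i) d" and ?F = "\<lambda>i. distr_deriv (X i) f"
  define e' where "e' x = - (\<beta> / 2) * \<theta> * d x powr (\<theta> - 1) * half_weight x" for x
  have hc: "continuous_on UNIV half_weight" by (rule class_L_continuous[OF half_weight(1)[OF \<theta>]])
  have g: "has_distr_deriv (X i) (\<lambda>x. f x * half_weight x) (\<lambda>x. ?F i x * half_weight x + ?G i x * e' x * f x)" for i
    unfolding e'_def half_weight_def
    by (rule has_distr_deriv_mult[OF class_L_distr_deriv[OF f] class_L_continuous[OF f] half_weight(2)[OF \<theta>, unfolded half_weight_def[abs_def]]
          hc[unfolded half_weight_def[abs_def]] X_smooth X_div])
  have "AE x in lborel. distr_deriv (X i) (\<lambda>x. f x * half_weight x) x = ?F i x * half_weight x + ?G i x * e' x * f x" for i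
    by (rule has_distr_deriv_unique[OF has_distr_deriv_distr_deriv[OF g] g])
  then have "AE x in lborel. \<forall>i\<in>UNIV. distr_deriv (X i) (\<lambda>x. f x * half_weight x) x = ?F i x * half_weight x + ?G i x * e' x * f x"
    by (intro AE_finite_allI) auto
  then show ?thesis using grad_d
  proof eventually_elim
    case (elim x)
    have "grad X (\<lambda>x. f x * half_weight x) x = half_weight x *\<^sub>R grad X f x + (e' x * f x) *\<^sub>R grad X d x"
      using elim(1) by (simp add: grad_def vec_eq_iff mult_ac)
    then have "norm (grad X (\<lambda>x. f x * half_weight x) x) \<le> \<bar>half_weight x\<bar> * norm (grad X f x) + \<bar>e' x * f x\<bar> * norm (grad X d x)"
      by (metis norm_scaleR norm_triangle_ineq)
    also have "\<dots> \<le> \<bar>half_weight x\<bar> * norm (grad X f x) + \<bar>e' x * f x\<bar> * 1"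
      using elim(2) by (intro add_left_mono mult_left_mono) auto
    finally have "(norm (grad X (\<lambda>x. f x * half_weight x) x))\<^sup>2 \<le> (\<bar>half_weight x\<bar> * norm (grad X f x) + \<bar>e' x * f x\<bar>)\<^sup>2"
      by (intro power_mono) auto
    also have "\<dots> \<le> 2 * (\<bar>half_weight x\<bar> * norm (grad X f x))\<^sup>2 + 2 * \<bar>e' x * f x\<bar>\<^sup>2"
      using zero_le_power2[of "\<bar>half_weight x\<bar> * norm (grad X f x) - \<bar>e' x * f x\<bar>"]
      unfolding power2_diff power2_sum by linarith
    also have "2 * (\<bar>half_weight x\<bar> * norm (grad X f x))\<^sup>2 = 2 * (weight x * (norm (grad X f x))\<^sup>2)"
      by (simp add: power_mult_distrib half_weight_square)
    also have "2 * \<bar>e' x * f x\<bar>\<^sup>2 = \<beta>\<^sup>2 * \<theta>\<^sup>2 / 2 * (weight x * (f x)\<^sup>2 * d x powr (2 * (\<theta> - 1)))"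
    proof -
      have "(d x powr (\<theta> - 1))\<^sup>2 = d x powr (2 * (\<theta> - 1))"
        by (simp add: power2_eq_square powr_add[symmetric])
      then show ?thesis
        by (simp add: e'_def power_mult_distrib half_weight_square power_divide)
    qed
    finally show ?case .
  qed
qed


text \<open>The gradient enters twice: through the Sobolev inequality for
  \<open>f * half_weight\<close>, with factor \<open>(2 + \<delta>) / \<delta>\<close> from the
  entropy bound, and through \<open>U powr s\<close>. Each \<open>32 / kappa\<^sup>2\<close> is the
  gradient coefficient of the U-bound.\<close>

definition grad_const :: "real \<Rightarrow> real \<Rightarrow> real \<Rightarrow> real" where
  "grad_const s \<delta> C = (2 + \<delta>) / \<delta> * C * (2 + \<beta>\<^sup>2 * \<theta>\<^sup>2 / 2 * (32 / kappa\<^sup>2)) + \<beta> powr s * (32 / kappa\<^sup>2)"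

definition mass_const :: "real \<Rightarrow> real \<Rightarrow> real \<Rightarrow> real \<Rightarrow> real \<Rightarrow> real" where
  "mass_const s \<delta> C D Z = 2 + \<bar>ln Z\<bar> + 2 / \<delta>
     + (2 + \<delta>) / \<delta> * (C * (\<beta>\<^sup>2 * \<theta>\<^sup>2 / 2 * (8 / kappa * (2 + K\<^sup>2 / kappa) + 9)) + D)
     + \<beta> powr s * (8 / kappa * (2 + K\<^sup>2 / kappa) + 9)"

text \<open>The normalisation is with respect to \<open>weight\<close>, without \<open>Z\<close>;
  then \<open>Z * f ^ 2\<close> has mean one under the probability measure, and the density
  \<open>weight / Z\<close> times it is the square of \<open>g\<close>.\<close>

lemma log_power_sobolev_normalized:
  assumes f: "f \<in> class_L X" and \<theta>: "1 < \<theta>" and s: "s = 2 * (\<theta> - 1) / \<theta>" and Z: "0 < Z"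
    and prob: "(\<integral>\<^sup>+x. ennreal (weight x / Z) \<partial>lborel) = 1"
    and \<delta>: "0 < \<delta>" and C: "0 < C" and D: "0 < D"
    and sobolev: "\<And>g. g \<in> class_L X \<Longrightarrow>
      ennpowr (\<integral>\<^sup>+x. ennreal (\<bar>g x\<bar> powr (2 + \<delta>)) \<partial>lborel) (2 / (2 + \<delta>))
        \<le> ennreal C * (\<integral>\<^sup>+x. ennreal ((norm (grad X g x))\<^sup>2) \<partial>lborel)
          + ennreal D * (\<integral>\<^sup>+x. ennreal ((g x)\<^sup>2) \<partial>lborel)"
    and intF: "integrable lborel (\<lambda>x. weight x * (norm (grad X f x))\<^sup>2)"
    and intf: "integrable lborel (\<lambda>x. weight x * (f x)\<^sup>2)"
    and one: "(LBINT x. weight x * (f x)\<^sup>2) = 1"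
  shows "(\<integral>\<^sup>+x. ennreal (weight x * (f x)\<^sup>2 * \<bar>ln (Z * (f x)\<^sup>2)\<bar> powr s) \<partial>lborel) \<le>
     ennreal (grad_const s \<delta> C * (LBINT x. weight x * (norm (grad X f x))\<^sup>2) + mass_const s \<delta> C D Z)"
proof -
  have [measurable]: "f \<in> borel_measurable borel" "d \<in> borel_measurable borel"
    by (intro borel_measurable_continuous_onI class_L_continuous f d_L)+
  have w0: "0 \<le> weight x" for x by (simp add: weight_pos less_imp_le)
  have s01: "0 < s" "s \<le> 1" using \<theta> theta by (auto simp: s field_simps)
  define I where "I = (LBINT x. weight x * (norm (grad X f x))\<^sup>2)"
  define V where "V = 32 / kappa\<^sup>2 * I + (8 / kappa * (2 + K\<^sup>2 / kappa) + 9)"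
  define J where "J = 2 * I + \<beta>\<^sup>2 * \<theta>\<^sup>2 / 2 * V"
  define S where "S = C * J + D"
  have I0: "0 \<le> I" unfolding I_def by (intro integral_nonneg_AE) (simp add: w0)
  have V0: "0 \<le> V" unfolding V_def using I0 kappa_pos by simp
  have J0: "0 \<le> J" unfolding J_def using I0 V0 by simp
  have S0: "0 \<le> S" unfolding S_def using J0 C D by simp
  let ?v = "\<lambda>x. weight x * (f x)\<^sup>2 * d x powr (2 * (\<theta> - 1))"
  note vint = u_bound(1)[OF f intF intf]
  have vle: "(LBINT x. ?v x) \<le> V"
    using u_bound(2)[OF f intF intf] by (simp add: one V_def I_def)
  have v0: "0 \<le> ?v x" for x by (simp add: w0)
  define g where "g x = f x * half_weight x" for x
  have gL: "g \<in> class_L X"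
    unfolding g_def[abs_def] by (rule class_L_mult[OF f half_weight(1)[OF \<theta>] X_smooth X_div])
  have g2: "(g x)\<^sup>2 = weight x * (f x)\<^sup>2" for x
    by (simp add: g_def power_mult_distrib half_weight_square mult.commute)
  have nf: "(\<integral>\<^sup>+x. ennreal (weight x * (f x)\<^sup>2) \<partial>lborel) = 1"
    by (subst nn_integral_eq_integral[OF intf]) (auto simp: w0 one)
  have nv: "(\<integral>\<^sup>+x. ennreal (?v x) \<partial>lborel) \<le> ennreal V"
  proof -
    have "(\<integral>\<^sup>+x. ennreal (?v x) \<partial>lborel) = ennreal (LBINT x. ?v x)"
      by (rule nn_integral_eq_integral[OF vint]) (simp add: w0)
    then show ?thesis using ennreal_leI[OF vle] by (simp only:)
  qed
  have "(\<integral>\<^sup>+x. ennreal ((norm (grad X g x))\<^sup>2) \<partial>lborel) \<le>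
     (\<integral>\<^sup>+x. ennreal (2 * (weight x * (norm (grad X f x))\<^sup>2) + \<beta>\<^sup>2 * \<theta>\<^sup>2 / 2 * ?v x) \<partial>lborel)"
    using grad_half_weight_mult[OF f \<theta>] unfolding g_def[abs_def, symmetric]
    by (intro nn_integral_mono_AE) (auto elim!: eventually_mono intro!: ennreal_leI simp: g_def[abs_def])
  also have "\<dots> = ennreal (LBINT x. 2 * (weight x * (norm (grad X f x))\<^sup>2) + \<beta>\<^sup>2 * \<theta>\<^sup>2 / 2 * ?v x)"
    using intF vint by (intro nn_integral_eq_integral) (auto simp: w0)
  also have "\<dots> \<le> ennreal J"
    using intF vint vle by (intro ennreal_leI) (simp add: J_def I_def mult_left_mono)
  finally have gJ: "(\<integral>\<^sup>+x. ennreal ((norm (grad X g x))\<^sup>2) \<partial>lborel) \<le> ennreal J" .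
  have "ennpowr (\<integral>\<^sup>+x. ennreal (\<bar>g x\<bar> powr (2 + \<delta>)) \<partial>lborel) (2 / (2 + \<delta>)) \<le> ennreal C * ennreal J + ennreal D * 1"
    using order.trans[OF sobolev[OF gL] add_mono[OF mult_left_mono[OF gJ, of "ennreal C"] order_refl]]
    by (simp add: g2 nf)
  also have "\<dots> = ennreal S"
    unfolding S_def using C D J0 by (simp add: ennreal_mult ennreal_plus)
  finally have ent: "(\<integral>\<^sup>+x. ennreal ((g x)\<^sup>2 * max 0 (ln ((g x)\<^sup>2))) \<partial>lborel) \<le> ennreal (2 / \<delta> * (1 + (2 + \<delta>) / 2 * S))"
    by (intro nn_integral_entropy_le class_L_continuous gL \<delta> S0) (simp_all add: g2 nf)
  have [measurable]: "g \<in> borel_measurable borel"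
    by (intro borel_measurable_continuous_onI class_L_continuous gL)
  have pt: "weight x * (f x)\<^sup>2 * \<bar>ln (Z * (f x)\<^sup>2)\<bar> powr s \<le>
     weight x / Z + (1 + \<bar>ln Z\<bar>) * (weight x * (f x)\<^sup>2) + (g x)\<^sup>2 * max 0 (ln ((g x)\<^sup>2)) + \<beta> powr s * ?v x" for x
  proof (cases "f x = 0")
    case True
    then show ?thesis using w0[of x] Z by (simp add: g2)
  next
    case False
    \<comment> \<open>The choice of \<open>s\<close> means
      \<open>\<theta> * s = 2 * (\<theta> - 1)\<close>, the power that the U-bound controls.\<close>
    have "(\<beta> * d x powr \<theta>) powr s = \<beta> powr s * d x powr (2 * (\<theta> - 1))"
      using beta \<theta> d_nonneg by (simp add: powr_mult powr_powr s)
    moreover have "weight x / Z * (Z * (f x)\<^sup>2) = (g x)\<^sup>2" using Z by (simp add: g2)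
    ultimately show ?thesis
      using log_power_pointwise[of "Z * (f x)\<^sup>2" "weight x / Z" "\<beta> * d x powr \<theta>" Z s] False Z beta s01
      by (simp add: weight_def g2 mult_ac)
  qed
  have "(\<integral>\<^sup>+x. ennreal (weight x * (f x)\<^sup>2 * \<bar>ln (Z * (f x)\<^sup>2)\<bar> powr s) \<partial>lborel) \<le>
    (\<integral>\<^sup>+x. ennreal (weight x / Z) + ennreal (1 + \<bar>ln Z\<bar>) * ennreal (weight x * (f x)\<^sup>2)
        + ennreal ((g x)\<^sup>2 * max 0 (ln ((g x)\<^sup>2))) + ennreal (\<beta> powr s) * ennreal (?v x) \<partial>lborel)"
  proof (rule nn_integral_mono)
    fix x
    let ?a = "weight x / Z" and ?b = "weight x * (f x)\<^sup>2" and ?c = "(g x)\<^sup>2 * max 0 (ln ((g x)\<^sup>2))"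
    have 0: "0 \<le> ?a" "0 \<le> ?b" "0 \<le> ?c" "0 \<le> ?v x" using w0[of x] Z by auto
    have "ennreal ?a + ennreal (1 + \<bar>ln Z\<bar>) * ennreal ?b + ennreal ?c + ennreal (\<beta> powr s) * ennreal (?v x)
        = ennreal (?a + (1 + \<bar>ln Z\<bar>) * ?b + ?c + \<beta> powr s * ?v x)"
      using 0 by (simp only: ennreal_mult[symmetric] ennreal_plus[symmetric] add_nonneg_nonneg mult_nonneg_nonneg
          powr_ge_zero abs_ge_zero zero_le_one)
    then show "ennreal (weight x * (f x)\<^sup>2 * \<bar>ln (Z * (f x)\<^sup>2)\<bar> powr s) \<le>
       ennreal ?a + ennreal (1 + \<bar>ln Z\<bar>) * ennreal ?b + ennreal ?c + ennreal (\<beta> powr s) * ennreal (?v x)"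
      using ennreal_leI[OF pt[of x]] by (simp only:)
  qed
  also have "\<dots> = 1 + ennreal (1 + \<bar>ln Z\<bar>) * 1 + (\<integral>\<^sup>+x. ennreal ((g x)\<^sup>2 * max 0 (ln ((g x)\<^sup>2))) \<partial>lborel)
      + ennreal (\<beta> powr s) * (\<integral>\<^sup>+x. ennreal (?v x) \<partial>lborel)"
    by (simp add: nn_integral_add nn_integral_cmult prob nf del: ennreal_plus)
  also have "\<dots> \<le> ennreal 1 + ennreal (1 + \<bar>ln Z\<bar>) + ennreal (2 / \<delta> * (1 + (2 + \<delta>) / 2 * S)) + ennreal (\<beta> powr s) * ennreal V"
    using ent nv by (intro add_mono mult_left_mono) auto
  also have "\<dots> = ennreal (1 + (1 + \<bar>ln Z\<bar>) + 2 / \<delta> * (1 + (2 + \<delta>) / 2 * S) + \<beta> powr s * V)"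
    using S0 V0 \<delta> by (simp only: ennreal_mult[symmetric] ennreal_plus[symmetric] add_nonneg_nonneg mult_nonneg_nonneg
          powr_ge_zero abs_ge_zero zero_le_one divide_nonneg_nonneg zero_le_numeral less_imp_le)
  also have "1 + (1 + \<bar>ln Z\<bar>) + 2 / \<delta> * (1 + (2 + \<delta>) / 2 * S) + \<beta> powr s * V = grad_const s \<delta> C * I + mass_const s \<delta> C D Z"
  proof -
    have "2 / \<delta> * (1 + (2 + \<delta>) / 2 * S) = 2 / \<delta> + (2 + \<delta>) / \<delta> * S"
      using \<delta> by (simp add: field_simps)
    then show ?thesis unfolding grad_const_def mass_const_def S_def J_def V_def by (simp only: ring_distribs) (simp add: mult_ac)
  qed
  finally show ?thesis by (simp add: I_def)
qed

text \<open>\<open>distr_deriv\<close> picks an arbitrary representative, so even homogeneity of the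
  gradient holds only almost everywhere, by uniqueness of the weak derivative.\<close>

lemma class_L_scale:
  assumes f: "f \<in> class_L X"
  shows "(\<lambda>x. c * f x) \<in> class_L X"
    "AE x in lborel. grad X (\<lambda>x. c * f x) x = c *\<^sub>R grad X f x"
proof -
  have const: "(\<lambda>_. c) \<in> class_L X"
    unfolding class_L_def
    by (auto intro!: exI[of _ "\<lambda>_. 0"] has_distr_deriv_const X_smooth X_div simp: locally_ess_bounded_def)
  show "(\<lambda>x. c * f x) \<in> class_L X" by (rule class_L_mult[OF const f X_smooth X_div])
  have g: "has_distr_deriv (X i) (\<lambda>x. c * f x) (\<lambda>x. distr_deriv (X i) f x * c)" for i
    using has_distr_deriv_mult[OF has_distr_deriv_const[OF X_smooth X_div, of i c] continuous_on_const
        class_L_distr_deriv[OF f] class_L_continuous[OF f] X_smooth X_div] by simp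
  have "AE x in lborel. distr_deriv (X i) (\<lambda>x. c * f x) x = distr_deriv (X i) f x * c" for i
    by (rule has_distr_deriv_unique[OF has_distr_deriv_distr_deriv[OF g] g])
  then have "AE x in lborel. \<forall>i\<in>UNIV. distr_deriv (X i) (\<lambda>x. c * f x) x = distr_deriv (X i) f x * c"
    by (intro AE_finite_allI) auto
  then show "AE x in lborel. grad X (\<lambda>x. c * f x) x = c *\<^sub>R grad X f x"
    by eventually_elim (simp add: grad_def vec_eq_iff mult.commute)
qed

end

section \<open>Reduction to normalised functions, with the degenerate cases\<close>

theorem theorem4p2:
  fixes X :: "'k::finite \<Rightarrow> real ^ 'n \<Rightarrow> real ^ 'n"
    and \<rho> :: "real ^ 'n \<Rightarrow> real ^ 'n \<Rightarrow> real"
    and d :: "real ^ 'n \<Rightarrow> real"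
    and \<theta> s \<beta> Z \<sigma> K \<epsilon> \<epsilon>\<^sub>0 Cbar Dbar :: real
  assumes X_smooth: "\<And>i. smooth (X i)"
    and X_div: "\<And>i x. divergence (X i) x = 0"
    and metric: "Metric_space UNIV \<rho>"
    and d_def: "\<And>x. d x = \<rho> 0 x"
    and d_L: "d \<in> class_L X"
    and balls: "\<And>R. compact {x. d x \<le> R}"
    and theta: "1 \<le> \<theta>" "\<theta> \<le> 2"
    and varsigma: "s = 2 * (\<theta> - 1) / \<theta>"
    and beta: "0 < \<beta>"
    and Z: "0 < Z"
    and prob: "prob_space (mu \<theta> \<beta> Z d)"
    and sigma: "1 \<le> \<sigma>"
    and grad_d: "AE x in lborel. 1 / \<sigma> \<le> norm (grad X d x) \<and> norm (grad X d x) \<le> 1"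
    and K: "0 \<le> K"
    and eps: "0 \<le> \<epsilon>" "\<epsilon> < 1 / \<sigma>\<^sup>2"
    and laplacian_d:
      "distr_laplacian_le X {x. d x > 1} d (\<lambda>x. K + \<beta> * \<theta> * \<epsilon> * d x powr (\<theta> - 1))"
    and eps0: "0 < \<epsilon>\<^sub>0" "\<epsilon>\<^sub>0 < 1"
    and Cbar: "0 < Cbar"
    and Dbar: "0 < Dbar"
    and sobolev: "\<And>g. g \<in> class_L X \<Longrightarrow>
      ennpowr (\<integral>\<^sup>+x. ennreal (\<bar>g x\<bar> powr (2 + \<epsilon>\<^sub>0)) \<partial>lborel) (2 / (2 + \<epsilon>\<^sub>0))
        \<le> ennreal Cbar * (\<integral>\<^sup>+x. ennreal ((norm (grad X g x))\<^sup>2) \<partial>lborel)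
          + ennreal Dbar * (\<integral>\<^sup>+x. ennreal ((g x)\<^sup>2) \<partial>lborel)"
  shows "\<exists>C>0. \<exists>D>0. \<forall>f\<in>class_L X.
    integrable (mu \<theta> \<beta> Z d) (\<lambda>x. (f x)\<^sup>2) \<longrightarrow>
      (\<integral>\<^sup>+x. ennreal (if f x = 0 then 0
              else (f x)\<^sup>2 * abs_log_pow ((f x)\<^sup>2 / (LINT y|mu \<theta> \<beta> Z d. (f y)\<^sup>2)) s)
          \<partial>mu \<theta> \<beta> Z d)
        \<le> ennreal C * (\<integral>\<^sup>+x. ennreal ((norm (grad X f x))\<^sup>2) \<partial>mu \<theta> \<beta> Z d)
          + ennreal D * (\<integral>\<^sup>+x. ennreal ((f x)\<^sup>2) \<partial>mu \<theta> \<beta> Z d)"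
proof -
  interpret drift X d \<theta> \<beta> \<sigma> K \<epsilon>
  proof
    show "0 \<le> d x" for x using metric unfolding d_def Metric_space_def by blast
  qed (use X_smooth X_div d_L balls theta beta sigma grad_d K eps laplacian_d in auto)
  have muw: "mu \<theta> \<beta> Z d = density lborel (\<lambda>x. ennreal (weight x / Z))"
    by (simp add: mu_def weight_def)
  have w0: "0 \<le> weight x" for x by (simp add: weight_pos less_imp_le)
  have wZ: "AE x in lborel. 0 \<le> weight x / Z" using w0 Z by simp
  have wm: "(\<lambda>x. weight x / Z) \<in> borel_measurable lborel" by measurable
  have total: "(\<integral>\<^sup>+x. ennreal (weight x / Z) \<partial>lborel) = 1"
    using prob_space.emeasure_space_1[OF prob] by (simp add: muw emeasure_density)
  have nnmu: "(\<integral>\<^sup>+x. ennreal (u x) \<partial>mu \<theta> \<beta> Z d) = (\<integral>\<^sup>+x. ennreal (weight x / Z * u x) \<partial>lborel)"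
    if "u \<in> borel_measurable borel" for u
    unfolding muw using that Z w0 by (subst nn_integral_density) (auto simp: ennreal_mult'[symmetric])
  have s0: "s = 0 \<longleftrightarrow> \<theta> = 1" using theta by (simp add: varsigma)
  \<comment> \<open>The added 1 gives strict positivity, which also makes the right side infinite
    when the gradient integral is.\<close>
  define C where "C = grad_const s \<epsilon>\<^sub>0 Cbar + 1"
  define D where "D = mass_const s \<epsilon>\<^sub>0 Cbar Dbar Z + 1"
  have C1: "0 \<le> grad_const s \<epsilon>\<^sub>0 Cbar" unfolding grad_const_def using eps0 Cbar kappa_pos by simp
  have D1: "0 \<le> mass_const s \<epsilon>\<^sub>0 Cbar Dbar Z" unfolding mass_const_def using eps0 Cbar Dbar kappa_pos by simp
  have main: "(\<integral>\<^sup>+x. ennreal (if f x = 0 then 0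
              else (f x)\<^sup>2 * abs_log_pow ((f x)\<^sup>2 / (LINT y|mu \<theta> \<beta> Z d. (f y)\<^sup>2)) s)
          \<partial>mu \<theta> \<beta> Z d)
        \<le> ennreal C * (\<integral>\<^sup>+x. ennreal ((norm (grad X f x))\<^sup>2) \<partial>mu \<theta> \<beta> Z d)
          + ennreal D * (\<integral>\<^sup>+x. ennreal ((f x)\<^sup>2) \<partial>mu \<theta> \<beta> Z d)"
    (is "?L \<le> ennreal C * ?G + ennreal D * ?F")
    if f: "f \<in> class_L X" and int: "integrable (mu \<theta> \<beta> Z d) (\<lambda>x. (f x)\<^sup>2)" for f
  proof -
    have [measurable]: "f \<in> borel_measurable borel"
      by (intro borel_measurable_continuous_onI class_L_continuous f)
    have [measurable]: "distr_deriv (X i) f \<in> borel_measurable borel" for i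
      by (rule distr_deriv_measurable[OF f])
    have [measurable]: "(\<lambda>x. (norm (grad X f x))\<^sup>2) \<in> borel_measurable borel"
      unfolding norm_grad_square by measurable
    define m where "m = (LINT y|mu \<theta> \<beta> Z d. (f y)\<^sup>2)"
    have F: "?F = ennreal m"
      unfolding m_def by (rule nn_integral_eq_integral[OF int]) simp
    have m0: "0 \<le> m" by (simp add: m_def)
    have [measurable]: "(\<lambda>x. if f x = 0 then 0 else (f x)\<^sup>2 * abs_log_pow ((f x)\<^sup>2 / m) s) \<in> borel_measurable borel"
      unfolding abs_log_pow_def by measurable
    have intf: "integrable lborel (\<lambda>x. weight x * (f x)\<^sup>2)" and mZ: "(LBINT x. weight x * (f x)\<^sup>2) = Z * m"
    proof -
      have i: "integrable lborel (\<lambda>x. weight x / Z * (f x)\<^sup>2)"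
        using int unfolding muw by (subst (asm) integrable_density) (use w0 Z in auto)
      from integrable_mult_right[OF this, of Z] show "integrable lborel (\<lambda>x. weight x * (f x)\<^sup>2)"
        using Z by simp
      have "m = (LBINT x. weight x / Z * (f x)\<^sup>2)"
        unfolding m_def muw by (subst integral_density) (use w0 Z in auto)
      then show "(LBINT x. weight x * (f x)\<^sup>2) = Z * m" using Z by simp
    qed
    \<comment> \<open>For \<open>s = 0\<close> the logarithmic factor is 1 and the mass of
      \<open>f\<close> suffices. If \<open>m = 0\<close>, then \<open>f\<close> vanishes almost
      everywhere and so does the integrand. The rest can be scaled and has an integrable gradient
      term.\<close>
    consider "s = 0" | "?G = \<infinity>" | "m = 0" | "s \<noteq> 0" "?G \<noteq> \<infinity>" "m \<noteq> 0" by blast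
    then show ?thesis
    proof cases
      case 1
      have "?L \<le> 1 * ?F"
        unfolding mult_1 using 1 by (intro nn_integral_mono) (simp add: abs_log_pow_def)
      also have "\<dots> \<le> ennreal D * ?F"
        using D1 by (intro mult_right_mono) (auto simp: D_def ennreal_1[symmetric] simp del: ennreal_1 intro!: ennreal_leI)
      finally show ?thesis by (simp add: add_increasing)
    next
      case 2
      then show ?thesis using C1 by (simp add: C_def ennreal_mult_top)
    next
      case 3
      then have "AE x in lborel. weight x * (f x)\<^sup>2 = 0"
        using integral_nonneg_eq_0_iff_AE[OF intf] mZ w0 by simp
      then have "AE x in lborel. f x = 0"
        by eventually_elim (use weight_pos in \<open>simp add: less_le\<close>)
      then have "(\<integral>\<^sup>+x. ennreal (weight x / Z * (if f x = 0 then 0 else (f x)\<^sup>2 * abs_log_pow ((f x)\<^sup>2 / m) s)) \<partial>lborel) = 0"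
        by (subst nn_integral_0_iff_AE) (auto elim!: eventually_mono)
      then have "?L = 0" unfolding m_def[symmetric] by (subst nnmu) auto
      then show ?thesis by simp
    next
      case 4
      then have \<theta>: "1 < \<theta>" using s0 theta by simp
      have m: "0 < m" using 4 m0 by simp
      \<comment> \<open>This gives \<open>c * f\<close> weighted mass one and turns
        \<open>Z * (c * f) ^ 2\<close> into \<open>f ^ 2 / m\<close>, the argument of the logarithm
        in the claim.\<close>
      define c where "c = 1 / sqrt (Z * m)"
      have c2: "c\<^sup>2 = 1 / (Z * m)" using Z m by (simp add: c_def power_divide)
      let ?f = "\<lambda>x. c * f x"
      have G: "?G = (\<integral>\<^sup>+x. ennreal (weight x / Z * (norm (grad X f x))\<^sup>2) \<partial>lborel)"
        by (rule nnmu) measurable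
      have intG: "integrable lborel (\<lambda>x. weight x / Z * (norm (grad X f x))\<^sup>2)"
        using 4(2) w0 Z unfolding G by (intro integrableI_bounded) (auto simp: less_top[symmetric])
      then have intF: "integrable lborel (\<lambda>x. weight x * (norm (grad X f x))\<^sup>2)"
        using integrable_mult_right[OF intG, of Z] Z by simp
      define I where "I = (LBINT x. weight x * (norm (grad X f x))\<^sup>2)"
      have I0: "0 \<le> I" unfolding I_def by (intro integral_nonneg_AE) (simp add: w0)
      have GI: "?G = ennreal (I / Z)"
        unfolding G using w0 Z by (subst nn_integral_eq_integral[OF intG]) (auto simp: I_def)
      have gs: "AE x in lborel. weight x * (norm (grad X f x))\<^sup>2 * c\<^sup>2 = weight x * (norm (grad X ?f x))\<^sup>2"
        using class_L_scale(2)[OF f, of c] by eventually_elim (simp add: power_mult_distrib)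
      have [measurable]: "(\<lambda>x. (norm (grad X ?f x))\<^sup>2) \<in> borel_measurable borel"
        unfolding norm_grad_square using distr_deriv_measurable[OF class_L_scale(1)[OF f]] by measurable
      have intF': "integrable lborel (\<lambda>x. weight x * (norm (grad X ?f x))\<^sup>2)"
        using integrable_mult_left[OF intF, of "c\<^sup>2"] gs by (subst (asm) integrable_cong_AE) auto
      have I': "(LBINT x. weight x * (norm (grad X ?f x))\<^sup>2) = I * c\<^sup>2"
      proof -
        have "(LBINT x. weight x * (norm (grad X ?f x))\<^sup>2) = (LBINT x. weight x * (norm (grad X f x))\<^sup>2 * c\<^sup>2)"
          using gs by (intro integral_cong_AE) (auto elim!: eventually_mono)
        then show ?thesis by (simp add: I_def)
      qed
      have eqf: "weight x * (?f x)\<^sup>2 = c\<^sup>2 * (weight x * (f x)\<^sup>2)" for x by (simp add: power_mult_distrib)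
      have intf': "integrable lborel (\<lambda>x. weight x * (?f x)\<^sup>2)"
        unfolding eqf using intf by simp
      have one: "(LBINT x. weight x * (?f x)\<^sup>2) = 1"
        unfolding eqf using mZ Z m by (simp add: c2)
      have "?L = (\<integral>\<^sup>+x. ennreal (weight x / Z * (if f x = 0 then 0 else (f x)\<^sup>2 * abs_log_pow ((f x)\<^sup>2 / m) s)) \<partial>lborel)"
        unfolding m_def[symmetric] by (rule nnmu) measurable
      also have "\<dots> = (\<integral>\<^sup>+x. ennreal m * ennreal (weight x * (?f x)\<^sup>2 * \<bar>ln (Z * (?f x)\<^sup>2)\<bar> powr s) \<partial>lborel)"
      proof (rule nn_integral_cong)
        fix x
        have "Z * (?f x)\<^sup>2 = (f x)\<^sup>2 / m" using Z m by (simp add: power_mult_distrib c2)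
        moreover have "m * (weight x * (?f x)\<^sup>2) = weight x / Z * (f x)\<^sup>2" using Z m by (simp add: power_mult_distrib c2)
        ultimately have "weight x / Z * (if f x = 0 then 0 else (f x)\<^sup>2 * abs_log_pow ((f x)\<^sup>2 / m) s)
          = m * (weight x * (?f x)\<^sup>2 * \<bar>ln (Z * (?f x)\<^sup>2)\<bar> powr s)"
          using 4(1) by (simp only: mult.assoc[symmetric]) (simp add: abs_log_pow_def)
        then show "ennreal (weight x / Z * (if f x = 0 then 0 else (f x)\<^sup>2 * abs_log_pow ((f x)\<^sup>2 / m) s))
          = ennreal m * ennreal (weight x * (?f x)\<^sup>2 * \<bar>ln (Z * (?f x)\<^sup>2)\<bar> powr s)"
          using m0 w0 by (simp only: ennreal_mult mult_nonneg_nonneg zero_le_power2 powr_ge_zero)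
      qed
      also have "\<dots> = ennreal m * (\<integral>\<^sup>+x. ennreal (weight x * (?f x)\<^sup>2 * \<bar>ln (Z * (?f x)\<^sup>2)\<bar> powr s) \<partial>lborel)"
        by (rule nn_integral_cmult) measurable
      also have "\<dots> \<le> ennreal m * ennreal (grad_const s \<epsilon>\<^sub>0 Cbar * (I * c\<^sup>2) + mass_const s \<epsilon>\<^sub>0 Cbar Dbar Z)"
        using log_power_sobolev_normalized[OF class_L_scale(1)[OF f] \<theta> varsigma Z total eps0(1) Cbar Dbar sobolev intF' intf' one]
        unfolding I' by (intro mult_left_mono) auto
      also have "\<dots> = ennreal (grad_const s \<epsilon>\<^sub>0 Cbar * (I / Z) + mass_const s \<epsilon>\<^sub>0 Cbar Dbar Z * m)"
      proof -
        have "m * (grad_const s \<epsilon>\<^sub>0 Cbar * (I * c\<^sup>2) + mass_const s \<epsilon>\<^sub>0 Cbar Dbar Z) = grad_const s \<epsilon>\<^sub>0 Cbar * (I / Z) + mass_const s \<epsilon>\<^sub>0 Cbar Dbar Z * m"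
          using m by (simp add: c2 field_simps)
        then show ?thesis by (simp only: ennreal_mult'[OF m0, symmetric])
      qed
      also have "\<dots> \<le> ennreal (C * (I / Z) + D * m)"
        using I0 Z m0 by (intro ennreal_leI add_mono mult_right_mono) (auto simp: C_def D_def)
      also have "\<dots> = ennreal C * ?G + ennreal D * ?F"
      proof -
        have "0 \<le> C" "0 \<le> D" "0 \<le> I / Z" using C1 D1 I0 Z by (auto simp: C_def D_def)
        then show ?thesis
          unfolding GI F using m0 by (simp only: ennreal_mult ennreal_plus mult_nonneg_nonneg)
      qed
      finally show ?thesis .
    qed
  qed
  have pos: "0 < C" "0 < D" using C1 D1 by (auto simp: C_def D_def)
  show ?thesis
    by (rule exI[of _ C], rule conjI[OF pos(1)], rule exI[of _ D], rule conjI[OF pos(2)], intro ballI impI)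
      (rule main)
qed

end
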